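(* Let $\varepsilon \in [0,1]$, $\delta\in[0,1]$, $u = [u_1,\dots,u_n] \in \mathbb{X}$, and $w_0 \in Y$ with $\hat K^\delta(w_0) \in L^1(\Omega)$. Then the state-system $(\mathrm{AC})^{(\varepsilon,\delta)}$ with forcing term $u$ and initial data $w_0$ admits a unique solution $w = [w_1,\dots,w_n] \in \mathbb{Y}$, and moreover the following hold. (I) $w_i \in H^2(\Omega)$ with $\partial_x w_i(\pm L) = 0$, for every $i=1,\dots,n$. (II) There exist $\varpi^* = [\varpi_1^*,\dots,\varpi_n^*] \in \mathbb{Y}\cap [L^\infty(\Omega)]^n$ and $\xi = [\xi_1,\dots,\xi_n] \in \mathbb{X}$ such that $$\frac1\tau(w_i - w_{i-1}) - \partial_x \varpi_i^* - \nu^2\partial_x^2 w_i + \xi_i + g(w_i) = M_u u_i \ \text{ in } X,\quad i=1,\dots,n,$$ with $\varpi_i^* \in \partial f^\varepsilon(\partial_x w_i)$ and $\xi_i \in K^\delta(w_i)$ a.e. in $\Omega$, $i=1,\dots,n$. (III) (Energy inequality) $$\frac{1}{2\tau}|w_i - w_{i-1}|_X^2 + \mathscr{F}^{(\varepsilon,\delta)}(w_i) - \mathscr{F}^{(\varepsilon,\delta)}(w_{i-1}) \le \tau M_u^2 |u_i|_X^2,\quad i=1,\dots,n,$$ where $\mathscr{F}^{(\varepsilon,\delta)}(z) := \Psi^{(\varepsilon,\delta)}(z) + \int_\Omega G(z)\,dx$ for $z\in X$.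
   Context: Let $0<L,T<\infty$, $\Omega := (-L,L)$, $X := L^2(\Omega)$, $Y := H^1(\Omega)\ (\subset C(\overline\Omega))$, $n\in\mathbb{N}$, $\mathbb{X} := [X]^n$, $\mathbb{Y} := [Y]^n$; $\partial_x$ is the distributional derivative. $\nu>0$ and $M_u\ge 0$ are fixed constants. Mosco convergence: for proper l.s.c. convex functions $\psi_n,\psi$ on a Hilbert space $H$, $\psi_n \to \psi$ in the sense of Mosco iff (M1) $\liminf_n \psi_n(w_n) \ge \psi(w)$ whenever $w_n \to w$ weakly in $H$; (M2) for every $w \in D(\psi)$ there are $w_n \to w$ in $H$ with $\psi_n(w_n) \to \psi(w)$. For a family with a continuous parameter, convergence is meant along every sequence of parameters converging to the given limit. Assumption on $f^\varepsilon$: $f^0(r) := |r|$; $\{f^\varepsilon\}_{\varepsilon\in(0,1]} \subset C^2(\mathbb{R})$ are convex functions with $f^\varepsilon(0)=0$, $f^\varepsilon \ge 0$ on $\mathbb{R}$; for every $\varepsilon_0 \in [0,1]$, as $\varepsilon \to \varepsilon_0$, $f^\varepsilon(r) \to f^{\varepsilon_0}(r)$ for every $r\in\mathbb{R}$ and $f^\varepsilon \to f^{\varepsilon_0}$ on $\mathbb{R}$ in the sense of Mosco; there is $C_0>0$ independent of $\varepsilon$ with $|(f^\varepsilon)'(r)| \le C_0(1+|r|)$ for all $r \in \mathbb{R}$, $\varepsilon\in(0,1]$; and for every $\lambda>0$, $(f^\varepsilon)'' \to 0$ uniformly on $\{|r| \ge \lambda\}$ as $\varepsilon \to 0$. For $\varepsilon\in(0,1]$,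 $\partial f^\varepsilon(r) = \{(f^\varepsilon)'(r)\}$; $\partial f^0(r) = \{r/|r|\}$ if $r\neq 0$, $\partial f^0(0)=[-1,1]$. Assumption on $g$: $g\in C^1(\mathbb{R})$, there is $C_g>0$ such that $r\mapsto g(r)+C_g r$ is monotone (nondecreasing), and $g$ has a nonnegative primitive $0\le G\in C^2(\mathbb{R})$, $G'=g$. Assumption on $K^\delta$: $\hat K^0 := I_{[-1,1]}$ (equal to $0$ on $[-1,1]$ and $+\infty$ elsewhere) and $K^0 := \partial I_{[-1,1]}$ (set-valued subdifferential). $\{\hat K^\delta\}_{\delta\in(0,1]} \subset C^2(\mathbb{R})$ and $\{K^\delta\}_{\delta\in(0,1]} \subset C^1(\mathbb{R})$ satisfy: $K^\delta = (\hat K^\delta)'$ and $\hat K^\delta \equiv 0$ on $[-1,1]$ for all $\delta\in(0,1]$; for each $\delta\in(0,1]$ there is $C_K^\delta>0$ with $0 \le (K^\delta)' \le C_K^\delta$ on $\mathbb{R}$; for every $\delta_0\in[0,1]$, $\hat K^\delta \to \hat K^{\delta_0}$ on $\mathbb{R}$ in the sense of Mosco as $\delta\to\delta_0$, and if $\delta_0 \in (0,1]$ also $\hat K^\delta \to \hat K^{\delta_0}$ in $C_{\mathrm{loc}}(\mathbb{R})$. For $\delta\in(0,1]$, $\xi \in K^\delta(z)$ means $\xi = K^\delta(z)$. Time step: $\tau := T/n$ with $0<\tau<\tau^* := \frac{1}{8(C_g+1)}$. Functional: for $\varepsilon,\delta\in[0,1]$, $\Psi^{(\varepsilon,\delta)}(z)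 := \int_\Omega f^\varepsilon(\partial_x z)\,dx + \frac{\nu^2}{2}\int_\Omega |\partial_x z|^2\,dx + \int_\Omega \hat K^\delta(z)\,dx$ if $z\in Y$, and $:=\infty$ if $z\in X\setminus Y$; $D(\Psi^{(\varepsilon,\delta)})$ is its effective domain. State-system $(\mathrm{AC})^{(\varepsilon,\delta)}$ for forcing $u\in\mathbb{X}$ and initial value $w_0\in Y$: find $w=[w_1,\dots,w_n]$ with $$\frac1\tau(w_i-w_{i-1}) - \partial_x\big(\partial f^\varepsilon(\partial_x w_i)+\nu^2\partial_x w_i\big) + K^\delta(w_i) + g(w_i) \ni M_u u_i \text{ in } \Omega,\quad \partial_x w_i(\pm L)=0,\quad i=1,\dots,n.$$ Being a solution means: $w_i\in D(\Psi^{(\varepsilon,\delta)})$ and, for all $z\in D(\Psi^{(\varepsilon,\delta)})$ and $i=1,\dots,n$, $$\frac1\tau(w_i-w_{i-1},w_i-z)_X+(g(w_i)-M_uu_i,w_i-z)_X+\Psi^{(\varepsilon,\delta)}(w_i)-\Psi^{(\varepsilon,\delta)}(z)\le 0.$$ *)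

theory Defs
  imports "HOL-Analysis.Analysis"
begin

definition weakly_tendsto :: "(nat \<Rightarrow> 'a::real_inner) \<Rightarrow> 'a \<Rightarrow> bool" where
  "weakly_tendsto w x \<longleftrightarrow> (\<forall>y. (\<lambda>k. w k \<bullet> y) \<longlonglongrightarrow> x \<bullet> y)"

definition mosco_tendsto ::
    "(nat \<Rightarrow> 'a::{real_inner, complete_space} \<Rightarrow> ereal) \<Rightarrow> ('a \<Rightarrow> ereal) \<Rightarrow> bool" where
  "mosco_tendsto \<psi>s \<psi> \<longleftrightarrow>
     (\<forall>w x. weakly_tendsto w x \<longrightarrow> \<psi> x \<le> liminf (\<lambda>k. \<psi>s k (w k))) \<and>
     (\<forall>x. \<psi> x < \<infinity> \<longrightarrow> (\<exists>w. w \<longlonglongrightarrow> x \<and> (\<lambda>k. \<psi>s k (w k)) \<longlonglongrightarrow> \<psi> x))"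

definition mosco_continuous ::
    "(real \<Rightarrow> 'a::{real_inner, complete_space} \<Rightarrow> ereal) \<Rightarrow> bool" where
  "mosco_continuous \<phi> \<longleftrightarrow>
     (\<forall>a\<in>{0..1}. \<forall>s. (\<forall>k. s k \<in> {0..1}) \<longrightarrow> s \<longlonglongrightarrow> a \<longrightarrow>
        mosco_tendsto (\<lambda>k. \<phi> (s k)) (\<phi> a))"

definition subdiff :: "('a::real_inner \<Rightarrow> ereal) \<Rightarrow> 'a \<Rightarrow> 'a set" where
  "subdiff \<phi> x = {\<xi>. \<bar>\<phi> x\<bar> \<noteq> \<infinity> \<and> (\<forall>y. \<phi> x + ereal (\<xi> \<bullet> (y - x)) \<le> \<phi> y)}"

definition convex_indicator :: "'a set \<Rightarrow> 'a \<Rightarrow> ereal" where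
  "convex_indicator C x = (if x \<in> C then 0 else \<infinity>)"

lemma subdiff_differentiable:
  fixes h :: "real \<Rightarrow> real"
  assumes "convex_on UNIV h" "(h has_real_derivative D) (at x)"
  shows "subdiff (\<lambda>r. ereal (h r)) x = {D}"
proof -
  have above: "h x + D * (y - x) \<le> h y" for y
  proof -
    have "h y - h x \<ge> D * (y - x)"
      by (rule convex_on_imp_above_tangent[of UNIV]) (use assms in auto)
    then show ?thesis by simp
  qed
  have uniq: "\<xi> = D" if "\<And>y. h x + \<xi> * (y - x) \<le> h y" for \<xi>
  proof -
    have "((\<lambda>y. h y - \<xi> * (y - x)) has_real_derivative (D - \<xi>)) (at x)"
      by (auto intro!: derivative_eq_intros assms(2))
    then have "D - \<xi> = 0"
      by (rule DERIV_local_min[of _ _ _ 1]) (use that in \<open>auto simp: algebra_simps\<close>)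
    then show ?thesis by simp
  qed
  have "subdiff (\<lambda>r. ereal (h r)) x = {\<xi>. \<forall>y. h x + \<xi> * (y - x) \<le> h y}"
    by (simp add: subdiff_def)
  also have "\<dots> = {D}"
    using above uniq by blast
  finally show ?thesis .
qed

lemma subdiff_abs:
  fixes x :: real
  shows "subdiff (\<lambda>r. ereal \<bar>r\<bar>) x = (if x = 0 then {-1..1} else {x / \<bar>x\<bar>})"
proof (cases "x = 0")
  case True
  have "\<xi> \<in> {-1..1}" if "\<forall>y. \<xi> * y \<le> \<bar>y\<bar>" for \<xi> :: real
    using that[rule_format, of 1] that[rule_format, of "-1"] by auto
  moreover have "\<xi> * y \<le> \<bar>y\<bar>" if "\<xi> \<in> {-1..1}" for \<xi> y :: real
  proof -
    have "\<xi> * y \<le> \<bar>\<xi>\<bar> * \<bar>y\<bar>" by (metis abs_ge_self abs_mult)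
    also have "\<dots> \<le> 1 * \<bar>y\<bar>" using that by (intro mult_right_mono) auto
    finally show ?thesis by simp
  qed
  ultimately have "{\<xi>. \<forall>y. \<xi> * y \<le> \<bar>y\<bar>} = {-1..1::real}" by blast
  then show ?thesis using True by (simp add: subdiff_def)
next
  case False
  have cv: "convex_on UNIV (\<lambda>r::real. \<bar>r\<bar>)"
    using convex_on_dist[OF convex_UNIV, of "0::real"] by (simp add: dist_real_def)
  have D: "((\<lambda>r. \<bar>r\<bar>) has_real_derivative (x / \<bar>x\<bar>)) (at x)"
  proof (cases "0 < x")
    case True
    have "((\<lambda>r. r) has_real_derivative 1) (at x)" by (rule DERIV_ident)
    then have "((\<lambda>r. \<bar>r\<bar>) has_real_derivative 1) (at x)"
      by (rule has_field_derivative_transform_within_open[where S = "{0<..}"]) (use True in auto)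
    then show ?thesis using True by simp
  next
    case neg: False
    have "((\<lambda>r. - r) has_real_derivative (-1)) (at x)" by (auto intro!: derivative_eq_intros)
    then have "((\<lambda>r. \<bar>r\<bar>) has_real_derivative (-1)) (at x)"
      by (rule has_field_derivative_transform_within_open[where S = "{..<0}"])
        (use neg \<open>x \<noteq> 0\<close> in auto)
    then show ?thesis using neg \<open>x \<noteq> 0\<close> by simp
  qed
  show ?thesis
    unfolding subdiff_differentiable[OF cv D] using False by simp
qed

definition Ck :: "nat \<Rightarrow> (real \<Rightarrow> real) \<Rightarrow> bool" where
  "Ck k h \<longleftrightarrow> (\<forall>j<k. \<forall>x. (deriv ^^ j) h differentiable (at x)) \<and>
             continuous_on UNIV ((deriv ^^ k) h)"

text \<open>Elements of the Lebesgue and Sobolev spaces are represented by functions on the whole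
  line, and equality in these spaces is equality almost everywhere on \<open>(-L, L)\<close>. Nothing below
  depends on the values outside the open interval.\<close>

abbreviation Om :: "real \<Rightarrow> real measure" where
  "Om L \<equiv> lebesgue_on {-L<..<L}"

definition L2 :: "real \<Rightarrow> (real \<Rightarrow> real) set" where
  "L2 L = {u \<in> borel_measurable (Om L). integrable (Om L) (\<lambda>x. (u x)\<^sup>2)}"

definition L2_inner :: "real \<Rightarrow> (real \<Rightarrow> real) \<Rightarrow> (real \<Rightarrow> real) \<Rightarrow> real" where
  "L2_inner L u v = (\<integral>x. u x * v x \<partial>Om L)"

definition L2_norm :: "real \<Rightarrow> (real \<Rightarrow> real) \<Rightarrow> real" where
  "L2_norm L u = sqrt (L2_inner L u u)"

definition Linf :: "real \<Rightarrow> (real \<Rightarrow> real) set" where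
  "Linf L = {u \<in> borel_measurable (Om L). \<exists>C. AE x in Om L. \<bar>u x\<bar> \<le> C}"

definition L1_ext :: "real \<Rightarrow> (real \<Rightarrow> ereal) set" where
  "L1_ext L = {\<phi> \<in> borel_measurable (Om L). (\<integral>\<^sup>+x. e2ennreal \<bar>\<phi> x\<bar> \<partial>Om L) < \<infinity>}"

definition L1_loc :: "real \<Rightarrow> (real \<Rightarrow> real) set" where
  "L1_loc L = {u. \<forall>S. compact S \<longrightarrow> S \<subseteq> {-L<..<L} \<longrightarrow> integrable (lebesgue_on S) u}"

definition test_fun :: "real \<Rightarrow> (real \<Rightarrow> real) \<Rightarrow> bool" where
  "test_fun L \<phi> \<longleftrightarrow> (\<forall>k. Ck k \<phi>) \<and>
     compact (closure {x. \<phi> x \<noteq> 0}) \<and> closure {x. \<phi> x \<noteq> 0} \<subseteq> {-L<..<L}"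

definition has_weak_deriv :: "real \<Rightarrow> (real \<Rightarrow> real) \<Rightarrow> (real \<Rightarrow> real) \<Rightarrow> bool" where
  "has_weak_deriv L u v \<longleftrightarrow> u \<in> L1_loc L \<and> v \<in> L1_loc L \<and>
     (\<forall>\<phi>. test_fun L \<phi> \<longrightarrow>
        (\<integral>x. u x * deriv \<phi> x \<partial>Om L) = - (\<integral>x. v x * \<phi> x \<partial>Om L))"

text \<open>The distributional derivative, when it is a function, is determined only up to null sets;
  \<open>Dx L u\<close> is an arbitrary representative.\<close>

definition Dx :: "real \<Rightarrow> (real \<Rightarrow> real) \<Rightarrow> real \<Rightarrow> real" where
  "Dx L u = (SOME v. has_weak_deriv L u v)"

definition H1 :: "real \<Rightarrow> (real \<Rightarrow> real) set" where
  "H1 L = {u \<in> L2 L. \<exists>v\<in>L2 L. has_weak_deriv L u v}"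

definition H2 :: "real \<Rightarrow> (real \<Rightarrow> real) set" where
  "H2 L = {u \<in> H1 L. Dx L u \<in> H1 L}"

text \<open>Value at a point \<open>a\<close> of \<open>[-L, L]\<close>, through the (unique) representative that is continuous
  up to the boundary.\<close>

definition has_value_at :: "real \<Rightarrow> (real \<Rightarrow> real) \<Rightarrow> real \<Rightarrow> real \<Rightarrow> bool" where
  "has_value_at L v a y \<longleftrightarrow>
     (\<exists>c. continuous_on {-L..L} c \<and> (AE x in Om L. c x = v x) \<and> c a = y)"

definition f_assumption :: "(real \<Rightarrow> real \<Rightarrow> real) \<Rightarrow> bool" where
  "f_assumption f \<longleftrightarrow>
     f 0 = (\<lambda>r. \<bar>r\<bar>) \<and>
     (\<forall>\<epsilon>\<in>{0<..1}. Ck 2 (f \<epsilon>) \<and> convex_on UNIV (f \<epsilon>) \<and> f \<epsilon> 0 = 0 \<and> (\<forall>r. 0 \<le> f \<epsilon> r)) \<and>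
     (\<forall>\<epsilon>0\<in>{0..1}. \<forall>r. ((\<lambda>\<epsilon>. f \<epsilon> r) \<longlongrightarrow> f \<epsilon>0 r) (at \<epsilon>0 within {0..1})) \<and>
     mosco_continuous (\<lambda>\<epsilon> r. ereal (f \<epsilon> r)) \<and>
     (\<exists>C0>0. \<forall>\<epsilon>\<in>{0<..1}. \<forall>r. \<bar>deriv (f \<epsilon>) r\<bar> \<le> C0 * (1 + \<bar>r\<bar>)) \<and>
     (\<forall>c>0. uniform_limit {r. c \<le> \<bar>r\<bar>} (\<lambda>\<epsilon>. deriv (deriv (f \<epsilon>))) (\<lambda>r. 0) (at 0 within {0<..1}))"

definition g_assumption :: "(real \<Rightarrow> real) \<Rightarrow> (real \<Rightarrow> real) \<Rightarrow> real \<Rightarrow> bool" where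
  "g_assumption g G C\<^sub>g \<longleftrightarrow>
     Ck 1 g \<and> 0 < C\<^sub>g \<and> mono (\<lambda>r. g r + C\<^sub>g * r) \<and>
     Ck 2 G \<and> (\<forall>r. 0 \<le> G r) \<and> (\<forall>r. (G has_real_derivative g r) (at r))"

text \<open>The family of potentials is given by real functions \<open>Kh \<delta>\<close> for \<open>\<delta> \<in> (0, 1]\<close> and completed at
  \<open>\<delta> = 0\<close> by the indicator function of \<open>[-1, 1]\<close>; \<open>Kh 0\<close> and \<open>K 0\<close> are never used.\<close>

definition Khat :: "(real \<Rightarrow> real \<Rightarrow> real) \<Rightarrow> real \<Rightarrow> real \<Rightarrow> ereal" where
  "Khat Kh \<delta> z = (if \<delta> = 0 then convex_indicator {-1..1} z else ereal (Kh \<delta> z))"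

definition Kset :: "(real \<Rightarrow> real \<Rightarrow> real) \<Rightarrow> real \<Rightarrow> real \<Rightarrow> real set" where
  "Kset K \<delta> z = (if \<delta> = 0 then subdiff (convex_indicator {-1..1}) z else {K \<delta> z})"

definition K_assumption :: "(real \<Rightarrow> real \<Rightarrow> real) \<Rightarrow> (real \<Rightarrow> real \<Rightarrow> real) \<Rightarrow> bool" where
  "K_assumption Kh K \<longleftrightarrow>
     (\<forall>\<delta>\<in>{0<..1}. Ck 2 (Kh \<delta>) \<and> Ck 1 (K \<delta>) \<and>
        (\<forall>r. (Kh \<delta> has_real_derivative K \<delta> r) (at r)) \<and> (\<forall>r\<in>{-1..1}. Kh \<delta> r = 0) \<and>
        (\<exists>C>0. \<forall>r. 0 \<le> deriv (K \<delta>) r \<and> deriv (K \<delta>) r \<le> C)) \<and>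
     mosco_continuous (Khat Kh) \<and>
     (\<forall>\<delta>0\<in>{0<..1}. \<forall>S. compact S \<longrightarrow> uniform_limit S Kh (Kh \<delta>0) (at \<delta>0 within {0<..1}))"

text \<open>Under the standing assumptions all integrands in \<open>Psi\<close> and \<open>Energy\<close> are nonnegative, so the
  nonnegative integral is the Lebesgue integral with values in \<open>[0, \<infinity>]\<close>.\<close>

definition Psi :: "real \<Rightarrow> real \<Rightarrow> (real \<Rightarrow> real \<Rightarrow> real) \<Rightarrow> (real \<Rightarrow> real \<Rightarrow> real) \<Rightarrow>
    real \<Rightarrow> real \<Rightarrow> (real \<Rightarrow> real) \<Rightarrow> ereal" where
  "Psi L \<nu> f Kh \<epsilon> \<delta> z =
     (if z \<in> H1 L then
        enn2ereal (\<integral>\<^sup>+x. ennreal (f \<epsilon> (Dx L z x)) \<partial>Om L)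
        + ereal (\<nu>\<^sup>2 / 2) * enn2ereal (\<integral>\<^sup>+x. ennreal (\<bar>Dx L z x\<bar>\<^sup>2) \<partial>Om L)
        + enn2ereal (\<integral>\<^sup>+x. e2ennreal (Khat Kh \<delta> (z x)) \<partial>Om L)
      else \<infinity>)"

definition DPsi :: "real \<Rightarrow> real \<Rightarrow> (real \<Rightarrow> real \<Rightarrow> real) \<Rightarrow> (real \<Rightarrow> real \<Rightarrow> real) \<Rightarrow>
    real \<Rightarrow> real \<Rightarrow> (real \<Rightarrow> real) set" where
  "DPsi L \<nu> f Kh \<epsilon> \<delta> = {z \<in> L2 L. Psi L \<nu> f Kh \<epsilon> \<delta> z < \<infinity>}"

definition Energy :: "real \<Rightarrow> real \<Rightarrow> (real \<Rightarrow> real \<Rightarrow> real) \<Rightarrow> (real \<Rightarrow> real \<Rightarrow> real) \<Rightarrow>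
    (real \<Rightarrow> real) \<Rightarrow> real \<Rightarrow> real \<Rightarrow> (real \<Rightarrow> real) \<Rightarrow> ereal" where
  "Energy L \<nu> f Kh G \<epsilon> \<delta> z =
     Psi L \<nu> f Kh \<epsilon> \<delta> z + enn2ereal (\<integral>\<^sup>+x. ennreal (G (z x)) \<partial>Om L)"

text \<open>The unknowns are \<open>w 1, \<dots>, w n\<close>; the initial value is stored as \<open>w 0\<close>.\<close>

definition AC_solution :: "real \<Rightarrow> real \<Rightarrow> (real \<Rightarrow> real \<Rightarrow> real) \<Rightarrow> (real \<Rightarrow> real \<Rightarrow> real) \<Rightarrow>
    (real \<Rightarrow> real) \<Rightarrow> real \<Rightarrow> nat \<Rightarrow> real \<Rightarrow> real \<Rightarrow> real \<Rightarrow>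
    (nat \<Rightarrow> real \<Rightarrow> real) \<Rightarrow> (real \<Rightarrow> real) \<Rightarrow> (nat \<Rightarrow> real \<Rightarrow> real) \<Rightarrow> bool" where
  "AC_solution L \<nu> f Kh g M\<^sub>u n \<tau> \<epsilon> \<delta> u w0 w \<longleftrightarrow>
     w 0 = w0 \<and>
     (\<forall>i\<in>{1..n}. w i \<in> DPsi L \<nu> f Kh \<epsilon> \<delta> \<and>
        (\<forall>z\<in>DPsi L \<nu> f Kh \<epsilon> \<delta>.
           ereal (1 / \<tau> * L2_inner L (\<lambda>x. w i x - w (i - 1) x) (\<lambda>x. w i x - z x)
                  + L2_inner L (\<lambda>x. g (w i x) - M\<^sub>u * u i x) (\<lambda>x. w i x - z x))
           + Psi L \<nu> f Kh \<epsilon> \<delta> (w i) - Psi L \<nu> f Kh \<epsilon> \<delta> z \<le> 0))"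

end

theory Submission
  imports Defs
begin

text \<open>
  Each time level is an elliptic inclusion on an interval. Its unknown is \<open>w\<close>, and with
  \<open>h r = f\<^sup>\<epsilon> r + \<nu>\<^sup>2/2 r\<^sup>2\<close> it reads

    \<open>H \<in> \<partial>h(w')\<close>,  \<open>H' = (w - v)/\<tau> + g w - M\<^sub>u u + \<xi>\<close>,  \<open>\<xi> \<in> K\<^sup>\<delta> w\<close>,  \<open>H(-L) = H(L) = 0\<close>,

  where \<open>v\<close> is the previous level and \<open>H = \<omega> + \<nu>\<^sup>2 w'\<close> is the flux. Two features of dimension one carry
  the proof. First, \<open>H\<^sup>1\<close> functions are exactly the functions \<open>c + prim L q\<close>, a constant plus the
  indefinite integral of an \<open>L\<^sup>2\<close> function (\<open>H1_iff_prim\<close>), so the problem is posed on pairs \<open>(c, q)\<close>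
  and integration by parts is Fubini's theorem. Secondly, \<open>h\<close> is uniformly convex, so \<open>\<partial>h\<close> has a
  Lipschitz inverse \<open>\<beta>\<close> even where \<open>f\<^sup>\<epsilon>\<close> has a kink, and the first inclusion becomes the
  equation \<open>w' = \<beta>(H)\<close>. All regularity follows from it: \<open>w'\<close> is continuous, vanishes at both ends
  because \<open>H\<close> does and \<open>\<beta> 0 = 0\<close>, and lies in \<open>H\<^sup>1\<close> because \<open>\<beta>\<close> is Lipschitz
  (\<open>\<beta>_prim_is_prim\<close>); and \<open>\<omega> = H - \<nu>\<^sup>2 \<beta>(H)\<close> selects the subdifferential of \<open>f\<^sup>\<epsilon>\<close>.

  For \<open>\<delta> > 0\<close> the solution minimises a functional on \<open>(c, q)\<close>. The condition on \<open>\<tau>\<close> makes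
  \<open>r/\<tau> + g r\<close> strongly monotone, hence the functional is uniformly convex and every minimising
  sequence is Cauchy in \<open>H\<^sup>1\<close>. The Euler-Lagrange inequality, localised to arbitrary measurable
  sets, gives \<open>H \<in> \<partial>h(w')\<close> almost everywhere (\<open>solution_exists\<close>).

  For \<open>\<delta> = 0\<close> the constraint \<open>\<bar>w\<bar> \<le> 1\<close> is penalised. Testing the penalised equation with the penalty bounds
  the multiplier in \<open>L\<^sup>2\<close> (\<open>penalty_bound\<close>), and a comparison of two penalisations shows that \<open>w\<close>
  converges strongly in \<open>H\<^sup>1\<close> (\<open>penalised_difference\<close>). The multipliers may converge only weakly; Mazur's
  lemma (\<open>mazur\<close>) replaces them by strongly convergent convex combinations, and every condition on them
  that has to survive the limit is convex (\<open>obstacle_solution_exists\<close>).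

  The strong form implies the variational inequality by testing with \<open>w - z\<close>
  (\<open>strong_step_VI\<close>). Uniqueness comes from the strong monotonicity of \<open>r/\<tau> + g r\<close>, and the energy
  inequality from the test function \<open>z = v\<close>. The theorem follows by recursion over the time levels.
\<close>

section \<open>Square-integrable functions\<close>

lemma borel_measurable_ident_Om [measurable]: "(\<lambda>x. x) \<in> borel_measurable (Om L)"
  using id_borel_measurable_lebesgue_on[of "{-L<..<L}"] by (simp add: id_def)

lemma finite_measure_Om: "finite_measure (Om L)"
  by (rule finite_measure_lebesgue_on) (use lmeasurable_box[of "-L" L] in simp)

lemma measure_Om: "0 < L \<Longrightarrow> measure (Om L) {-L<..<L} = 2 * L"
  by (simp add: measure_restrict_space)

lemma integrable_const_Om [simp]: "integrable (Om L) (\<lambda>x. c::real)"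
  using finite_measure_Om by (simp add: finite_measure.integrable_const)

lemma integral_const_Om: "0 < L \<Longrightarrow> (LINT x|Om L. c) = 2 * L * (c::real)"
  by (simp add: measure_Om)

lemma AE_Om_neq: "AE y in Om L. y \<noteq> x"
proof -
  have "AE y in lebesgue. y \<noteq> x"
    by (rule AE_completion[OF AE_lborel_singleton])
  then show ?thesis by (subst AE_restrict_space_iff) auto
qed

lemma L2_meas: "q \<in> L2 L \<Longrightarrow> q \<in> borel_measurable (Om L)"
  and L2_sq: "q \<in> L2 L \<Longrightarrow> integrable (Om L) (\<lambda>x. (q x)\<^sup>2)"
  by (auto simp: L2_def)

lemma L2_mult_integrable:
  assumes "u \<in> L2 L" "v \<in> L2 L"
  shows "integrable (Om L) (\<lambda>x. u x * v x)"
proof (rule Bochner_Integration.integrable_bound)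
  show "integrable (Om L) (\<lambda>x. (u x)\<^sup>2 + (v x)\<^sup>2)"
    using assms L2_sq by auto
  show "(\<lambda>x. u x * v x) \<in> borel_measurable (Om L)"
    using assms L2_meas by auto
  have "\<bar>a * b\<bar> \<le> a\<^sup>2 + b\<^sup>2" for a b :: real
  proof -
    have "0 \<le> \<bar>a\<bar> * \<bar>b\<bar>" by simp
    then show ?thesis
      using sum_squares_bound[of "\<bar>a\<bar>" "\<bar>b\<bar>"] unfolding abs_mult power2_abs by linarith
  qed
  then show "AE x in Om L. norm (u x * v x) \<le> norm ((u x)\<^sup>2 + (v x)\<^sup>2)"
    by simp
qed

lemma L2_dominated:
  assumes "v \<in> L2 L" "u \<in> borel_measurable (Om L)" "AE x in Om L. \<bar>u x\<bar> \<le> \<bar>v x\<bar>"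
  shows "u \<in> L2 L"
  unfolding L2_def
proof (intro CollectI conjI assms(2))
  show "integrable (Om L) (\<lambda>x. (u x)\<^sup>2)"
    by (rule Bochner_Integration.integrable_bound[OF L2_sq[OF assms(1)]])
      (use assms in \<open>auto simp: abs_le_square_iff\<close>)
qed

lemma L2_const [simp]: "(\<lambda>x. c) \<in> L2 L"
  by (auto simp: L2_def)

lemma L2_bounded:
  assumes "u \<in> borel_measurable (Om L)" "AE x in Om L. \<bar>u x\<bar> \<le> C"
  shows "u \<in> L2 L"
  by (rule L2_dominated[OF L2_const[of C] assms(1)]) (use assms(2) in auto)

lemma L2_integrable: "u \<in> L2 L \<Longrightarrow> integrable (Om L) u"
  using L2_mult_integrable[of u L "\<lambda>x. 1"] by simp

lemma L2_cong_AE: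
  assumes "u \<in> L2 L" "v \<in> borel_measurable (Om L)" "AE x in Om L. v x = u x"
  shows "v \<in> L2 L"
  by (rule L2_dominated[OF assms(1,2)]) (use assms(3) in auto)

lemma L2_cmult: "u \<in> L2 L \<Longrightarrow> (\<lambda>x. c * u x) \<in> L2 L"
  by (auto simp: L2_def power_mult_distrib)

lemma L2_add:
  assumes "u \<in> L2 L" "v \<in> L2 L"
  shows "(\<lambda>x. u x + v x) \<in> L2 L"
  unfolding L2_def
proof (intro CollectI conjI)
  show "(\<lambda>x. u x + v x) \<in> borel_measurable (Om L)"
    using assms L2_meas by auto
  have "(u x + v x)\<^sup>2 = (u x)\<^sup>2 + (v x)\<^sup>2 + 2 * (u x * v x)" for x
    by (simp add: power2_sum)
  then show "integrable (Om L) (\<lambda>x. (u x + v x)\<^sup>2)"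
    using L2_mult_integrable[OF assms] L2_sq[OF assms(1)] L2_sq[OF assms(2)] by simp
qed

lemma L2_diff: "u \<in> L2 L \<Longrightarrow> v \<in> L2 L \<Longrightarrow> (\<lambda>x. u x - v x) \<in> L2 L"
  using L2_add[OF _ L2_cmult[of v L "-1"], of u] by simp

lemma L2_abs: "u \<in> L2 L \<Longrightarrow> (\<lambda>x. \<bar>u x\<bar>) \<in> L2 L"
  by (auto simp: L2_def)

lemma L2_mult_bounded:
  assumes "u \<in> L2 L" "v \<in> borel_measurable (Om L)" "AE x in Om L. \<bar>v x\<bar> \<le> C"
  shows "(\<lambda>x. v x * u x) \<in> L2 L"
proof (rule L2_dominated[OF L2_cmult[OF assms(1), of C]])
  show "(\<lambda>x. v x * u x) \<in> borel_measurable (Om L)"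
    using L2_meas[OF assms(1)] assms(2) by simp
  show "AE x in Om L. \<bar>v x * u x\<bar> \<le> \<bar>C * u x\<bar>"
    using assms(3) by eventually_elim (auto simp: abs_mult intro: mult_right_mono)
qed

lemma L2_indicator: "u \<in> L2 L \<Longrightarrow> A \<in> sets (Om L) \<Longrightarrow> (\<lambda>x. indicator A x * u x) \<in> L2 L"
  by (rule L2_mult_bounded[where C = 1]) (auto simp: indicator_def)

lemma integrable_mult_AE_bounded:
  fixes u v :: "real \<Rightarrow> real"
  assumes "integrable (Om L) u" "v \<in> borel_measurable (Om L)" "AE x in Om L. \<bar>v x\<bar> \<le> C"
  shows "integrable (Om L) (\<lambda>x. v x * u x)"
proof (rule Bochner_Integration.integrable_bound)
  show "integrable (Om L) (\<lambda>x. C * u x)" using assms by simp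
  show "(\<lambda>x. v x * u x) \<in> borel_measurable (Om L)" using assms by simp
  show "AE x in Om L. norm (v x * u x) \<le> norm (C * u x)"
    using assms(3) by eventually_elim (auto simp: abs_mult intro: mult_right_mono)
qed

abbreviation sqn :: "real \<Rightarrow> (real \<Rightarrow> real) \<Rightarrow> real" where
  "sqn L q \<equiv> LINT x|Om L. (q x)\<^sup>2"

lemma sqn_nonneg: "0 \<le> sqn L q"
  by simp

text \<open>The discriminant argument: \<open>\<integral> (u + t v)\<^sup>2 \<ge> 0\<close> for every \<open>t\<close>.\<close>

lemma L2_Cauchy_Schwarz:
  assumes u: "u \<in> L2 L" and v: "v \<in> L2 L"
  shows "(LINT x|Om L. u x * v x)\<^sup>2 \<le> sqn L u * sqn L v"
proof -
  define a b c where "a = sqn L u" and "b = (LINT x|Om L. u x * v x)" and "c = sqn L v"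
  have quad: "0 \<le> a + 2 * t * b + t\<^sup>2 * c" for t
  proof -
    have "0 \<le> (LINT x|Om L. (u x + t * v x)\<^sup>2)" by simp
    also have "\<dots> = (LINT x|Om L. (u x)\<^sup>2 + 2 * t * (u x * v x) + t\<^sup>2 * (v x)\<^sup>2)"
      by (intro Bochner_Integration.integral_cong) (auto simp: power2_eq_square algebra_simps)
    also have "\<dots> = a + 2 * t * b + t\<^sup>2 * c"
      using L2_sq[OF u] L2_sq[OF v] L2_mult_integrable[OF u v] by (simp add: a_def b_def c_def)
    finally show ?thesis .
  qed
  have "b\<^sup>2 \<le> a * c"
  proof (cases "c = 0")
    case True
    have "b = 0"
    proof (rule ccontr)
      assume "b \<noteq> 0"
      with quad[of "- (a + 1) / (2 * b)"] True show False by (simp add: field_simps)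
    qed
    then show ?thesis using True by simp
  next
    case False
    then have c: "c > 0" using sqn_nonneg[of L v] by (simp add: c_def less_le)
    have "0 \<le> c * (a + 2 * (- b / c) * b + (- b / c)\<^sup>2 * c)"
      using quad[of "- b / c"] c by (intro mult_nonneg_nonneg) auto
    also have "\<dots> = a * c - b\<^sup>2" using c by (simp add: field_simps power2_eq_square)
    finally show ?thesis by simp
  qed
  then show ?thesis by (simp add: a_def b_def c_def)
qed

lemma L1_le_sqn:
  assumes "0 < L" "u \<in> L2 L"
  shows "(LINT x|Om L. \<bar>u x\<bar>) \<le> sqrt (2 * L * sqn L u)"
  using L2_Cauchy_Schwarz[OF L2_abs[OF assms(2)] L2_const[of 1 L]] assms(1)
  by (simp add: measure_Om real_le_rsqrt mult.commute)

lemma sqn_add_le: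
  assumes "u \<in> L2 L" "v \<in> L2 L"
  shows "sqn L (\<lambda>x. u x + v x) \<le> 2 * sqn L u + 2 * sqn L v"
proof -
  have "sqn L (\<lambda>x. u x + v x) \<le> (LINT x|Om L. 2 * (u x)\<^sup>2 + 2 * (v x)\<^sup>2)"
  proof (rule integral_mono)
    fix x
    have "0 \<le> (u x - v x)\<^sup>2" by simp
    then show "(u x + v x)\<^sup>2 \<le> 2 * (u x)\<^sup>2 + 2 * (v x)\<^sup>2"
      by (simp add: power2_eq_square algebra_simps)
  qed (use assms L2_sq L2_add[OF assms] in auto)
  also have "\<dots> = 2 * sqn L u + 2 * sqn L v"
    using assms L2_sq by simp
  finally show ?thesis .
qed

lemma sqn_cmult: "sqn L (\<lambda>x. c * u x) = c\<^sup>2 * sqn L u"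
  by (simp add: power_mult_distrib)

text \<open>Completeness: an \<open>L\<^sup>2\<close>-Cauchy sequence is \<open>L\<^sup>1\<close>-Cauchy, hence has a subsequence converging
  almost everywhere, and Fatou's lemma turns the Cauchy bound into convergence in \<open>L\<^sup>2\<close>.\<close>

lemma L2_complete:
  assumes L: "0 < L" and q: "\<And>n. q n \<in> L2 L"
    and C: "\<And>e. 0 < e \<Longrightarrow> \<exists>N. \<forall>m\<ge>N. \<forall>n\<ge>N. sqn L (\<lambda>x. q m x - q n x) < e"
  obtains l s where "l \<in> L2 L" "(\<lambda>n. sqn L (\<lambda>x. q n x - l x)) \<longlonglongrightarrow> 0"
    "strict_mono s" "AE x in Om L. (\<lambda>n. q (s n) x) \<longlonglongrightarrow> l x"
proof -
  have "\<exists>N. \<forall>i\<ge>N. \<forall>j\<ge>N. (LINT x|Om L. norm (q i x - q j x)) < e" if "e > 0" for e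
  proof -
    from C[of "e\<^sup>2 / (2 * L)"] that L obtain N where
      N: "\<And>m n. m \<ge> N \<Longrightarrow> n \<ge> N \<Longrightarrow> sqn L (\<lambda>x. q m x - q n x) < e\<^sup>2 / (2 * L)" by auto
    have "(LINT x|Om L. norm (q i x - q j x)) < e" if "i \<ge> N" "j \<ge> N" for i j
    proof -
      have "(LINT x|Om L. \<bar>q i x - q j x\<bar>) \<le> sqrt (2 * L * sqn L (\<lambda>x. q i x - q j x))"
        by (rule L1_le_sqn[OF L L2_diff[OF q q]])
      also have "\<dots> < sqrt (e\<^sup>2)"
        by (rule real_sqrt_less_mono) (use N[OF that] L in \<open>simp add: field_simps\<close>)
      finally show ?thesis using \<open>e > 0\<close> by simp
    qed
    then show ?thesis by blast
  qed
  from cauchy_L1_AE_cauchy_subseq[OF L2_integrable[OF q] this]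
  obtain s where s: "strict_mono s" "AE x in Om L. Cauchy (\<lambda>i. q (s i) x)" by metis
  have [measurable]: "q n \<in> borel_measurable (Om L)" for n using q L2_meas by auto
  define l where "l x = (if Cauchy (\<lambda>i. q (s i) x) then lim (\<lambda>i. q (s i) x) else 0)" for x
  have l[measurable]: "l \<in> borel_measurable (Om L)"
    unfolding l_def by measurable
  have lim: "AE x in Om L. (\<lambda>n. q (s n) x) \<longlonglongrightarrow> l x"
    using s(2) by eventually_elim
      (simp add: l_def convergent_LIMSEQ_iff[THEN iffD1, OF Cauchy_convergent])
  have fatou: "(\<integral>\<^sup>+x. ennreal ((q n x - l x)\<^sup>2) \<partial>Om L) \<le> ennreal e"
    if N: "\<And>m. m \<ge> N \<Longrightarrow> sqn L (\<lambda>x. q n x - q m x) \<le> e" for n N e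
  proof -
    have "(\<integral>\<^sup>+x. ennreal ((q n x - l x)\<^sup>2) \<partial>Om L)
        = (\<integral>\<^sup>+x. liminf (\<lambda>m. ennreal ((q n x - q (s m) x)\<^sup>2)) \<partial>Om L)"
    proof (rule nn_integral_cong_AE, use lim in eventually_elim)
      case (elim x)
      have "(\<lambda>m. ennreal ((q n x - q (s m) x)\<^sup>2)) \<longlonglongrightarrow> ennreal ((q n x - l x)\<^sup>2)"
        by (intro tendsto_intros elim) 
      then show ?case using lim_imp_Liminf[OF sequentially_bot] by metis
    qed
    also have "\<dots> \<le> liminf (\<lambda>m. \<integral>\<^sup>+x. ennreal ((q n x - q (s m) x)\<^sup>2) \<partial>Om L)"
      by (intro nn_integral_liminf) measurable
    also have "\<dots> = liminf (\<lambda>m. ennreal (sqn L (\<lambda>x. q n x - q (s m) x)))"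
      by (intro arg_cong[of _ _ liminf] ext nn_integral_eq_integral L2_sq L2_diff q) auto
    also have "\<dots> \<le> ennreal e"
    proof -
      have "eventually (\<lambda>m. ennreal (sqn L (\<lambda>x. q n x - q (s m) x)) \<le> ennreal e) sequentially"
        unfolding eventually_sequentially
        by (rule exI[of _ N]) (use N seq_suble[OF s(1)] in \<open>auto intro!: ennreal_leI intro: order_trans\<close>)
      from Limsup_bounded[OF this] show ?thesis
        using Liminf_le_Limsup[OF sequentially_bot] order_trans by blast
    qed
    finally show ?thesis .
  qed
  obtain N1 where N1: "\<And>m n. m \<ge> N1 \<Longrightarrow> n \<ge> N1 \<Longrightarrow> sqn L (\<lambda>x. q m x - q n x) < 1"
    using C[of 1] by auto
  have "integrable (Om L) (\<lambda>x. (q N1 x - l x)\<^sup>2)"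
    using fatou[of N1 N1 1] N1[of N1] by (intro integrableI_nonneg)
      (auto simp: less_imp_le intro: le_less_trans)
  then have "(\<lambda>x. q N1 x - l x) \<in> L2 L" by (simp add: L2_def)
  from L2_diff[OF q this, of N1] have lL2: "l \<in> L2 L" by simp
  have "(\<lambda>n. sqn L (\<lambda>x. q n x - l x)) \<longlonglongrightarrow> 0"
  proof (rule LIMSEQ_I)
    fix e :: real assume "0 < e"
    then obtain N where N: "\<And>m n. m \<ge> N \<Longrightarrow> n \<ge> N \<Longrightarrow> sqn L (\<lambda>x. q m x - q n x) < e / 2"
      using C[of "e / 2"] by auto
    have "sqn L (\<lambda>x. q n x - l x) < e" if "n \<ge> N" for n
    proof -
      have "ennreal (sqn L (\<lambda>x. q n x - l x)) = (\<integral>\<^sup>+x. ennreal ((q n x - l x)\<^sup>2) \<partial>Om L)"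
        by (intro nn_integral_eq_integral[symmetric] L2_sq L2_diff q lL2) auto
      also have "\<dots> \<le> ennreal (e / 2)"
        by (rule fatou[of N]) (use N[OF that] in \<open>auto intro: less_imp_le\<close>)
      finally show ?thesis using \<open>0 < e\<close> by (simp add: ennreal_le_iff)
    qed
    then show "\<exists>no. \<forall>n\<ge>no. norm (sqn L (\<lambda>x. q n x - l x) - 0) < e" by auto
  qed
  from that[OF lL2 this s(1) lim] show ?thesis .
qed

section \<open>Indefinite integrals\<close>

text \<open>Integrating over the whole interval against the indicator of a half-line keeps every statement
  about \<open>prim\<close> inside the one measure \<open>Om L\<close>, and \<open>prim\<close> extends to the line by constants.\<close>

definition prim :: "real \<Rightarrow> (real \<Rightarrow> real) \<Rightarrow> real \<Rightarrow> real" where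
  "prim L q x = (LINT y|Om L. indicator {..x} y * q y)"

lemma integrable_indicator_Om:
  fixes q :: "real \<Rightarrow> real"
  assumes "integrable (Om L) q" "A \<in> sets borel"
  shows "integrable (Om L) (\<lambda>y. indicator A y * q y)"
  by (rule integrable_mult_AE_bounded[where C = 1])
     (use assms in \<open>auto simp: indicator_def
       intro!: measurable_compose[OF borel_measurable_ident_Om borel_measurable_indicator[of A, unfolded indicator_def]]\<close>)

lemma prim_add:
  assumes "integrable (Om L) q" "integrable (Om L) r"
  shows "prim L (\<lambda>y. q y + r y) x = prim L q x + prim L r x"
  using integrable_indicator_Om[OF assms(1), of "{..x}"] integrable_indicator_Om[OF assms(2), of "{..x}"]
  by (simp add: prim_def distrib_left)

lemma prim_cmult: "prim L (\<lambda>y. c * q y) x = c * prim L q x"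
  by (simp add: prim_def mult.left_commute)

lemma prim_diff:
  assumes "integrable (Om L) q" "integrable (Om L) r"
  shows "prim L (\<lambda>y. q y - r y) x = prim L q x - prim L r x"
  using prim_add[OF assms(1), of "\<lambda>y. -1 * r y" x] prim_cmult[of L "-1" r x] assms by simp

lemma prim_cong_AE:
  assumes "AE y in Om L. q y = r y" "q \<in> borel_measurable (Om L)" "r \<in> borel_measurable (Om L)"
  shows "prim L q x = prim L r x"
  unfolding prim_def
  by (rule integral_cong_AE) (use assms in auto)

lemma prim_left: "x \<le> -L \<Longrightarrow> prim L q x = 0"
  unfolding prim_def by (rule integral_eq_zero_AE) (auto intro!: AE_I2)

lemma prim_right: "L \<le> x \<Longrightarrow> prim L q x = (LINT y|Om L. q y)"
  unfolding prim_def by (rule Bochner_Integration.integral_cong) auto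

lemma prim_increment:
  assumes "integrable (Om L) q" "a \<le> b"
  shows "prim L q b - prim L q a = (LINT y|Om L. indicator {a<..b} y * q y)"
proof -
  have "prim L q b - prim L q a = (LINT y|Om L. indicator {..b} y * q y - indicator {..a} y * q y)"
    unfolding prim_def
    by (rule Bochner_Integration.integral_diff[symmetric]) (intro integrable_indicator_Om assms(1); simp)+
  also have "\<dots> = (LINT y|Om L. indicator {a<..b} y * q y)"
    by (rule Bochner_Integration.integral_cong) (use assms(2) in \<open>auto simp: indicator_def\<close>)
  finally show ?thesis .
qed

lemma abs_integral_indicator_le:
  fixes q :: "real \<Rightarrow> real"
  assumes "integrable (Om L) q" "A \<in> sets borel"
  shows "\<bar>LINT y|Om L. indicator A y * q y\<bar> \<le> (LINT y|Om L. \<bar>q y\<bar>)"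
proof -
  have "\<bar>LINT y|Om L. indicator A y * q y\<bar> \<le> (LINT y|Om L. \<bar>indicator A y * q y\<bar>)"
    using integral_norm_bound[of "Om L" "\<lambda>y. indicator A y * q y"] by simp
  also have "\<dots> \<le> (LINT y|Om L. \<bar>q y\<bar>)"
    by (rule integral_mono) (use integrable_indicator_Om[OF assms] assms in \<open>auto simp: indicator_def\<close>)
  finally show ?thesis .
qed

lemma abs_prim_le: "integrable (Om L) q \<Longrightarrow> \<bar>prim L q x\<bar> \<le> (LINT y|Om L. \<bar>q y\<bar>)"
  unfolding prim_def by (rule abs_integral_indicator_le) auto

lemma abs_prim_le_sqn: "0 < L \<Longrightarrow> q \<in> L2 L \<Longrightarrow> \<bar>prim L q x\<bar> \<le> sqrt (2 * L * sqn L q)"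
  using abs_prim_le[OF L2_integrable] L1_le_sqn by (meson order_trans)

lemma continuous_on_prim:
  assumes q: "integrable (Om L) q"
  shows "continuous_on S (prim L q)"
proof (rule continuous_on_subset[of UNIV])
  show "continuous_on UNIV (prim L q)"
    unfolding continuous_on_sequentially
  proof (intro allI ballI impI)
    fix X :: "nat \<Rightarrow> real" and a assume "(\<forall>n. X n \<in> UNIV) \<and> X \<longlonglongrightarrow> a"
    then have X: "X \<longlonglongrightarrow> a" by simp
    have [measurable]: "q \<in> borel_measurable (Om L)" using q by auto
    show "(prim L q \<circ> X) \<longlonglongrightarrow> prim L q a"
      unfolding prim_def o_def
    proof (rule integral_dominated_convergence[where w = "\<lambda>y. \<bar>q y\<bar>"])
      show "AE y in Om L. (\<lambda>n. indicator {..X n} y * q y) \<longlonglongrightarrow> indicator {..a} y * q y"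
        using AE_Om_neq[of a L]
      proof eventually_elim
        case (elim y)
        have "eventually (\<lambda>n. indicator {..X n} y = (indicator {..a} y :: real)) sequentially"
        proof (cases "y < a")
          case True
          then show ?thesis using order_tendstoD(1)[OF X True]
            by (auto elim!: eventually_mono simp: indicator_def)
        next
          case False
          with elim have "a < y" by simp
          then show ?thesis using order_tendstoD(2)[OF X, of y]
            by (auto elim!: eventually_mono simp: indicator_def)
        qed
        then show ?case
          by (intro tendsto_mult tendsto_const tendsto_eventually)
      qed
    qed (use q in \<open>auto simp: indicator_def\<close>)
  qed
qed simp

lemma continuous_on_borel_measurable_Om:
  "continuous_on {-L..L} f \<Longrightarrow> f \<in> borel_measurable (Om L)"
  by (rule continuous_imp_measurable_on_sets_lebesgue)
     (auto intro: continuous_on_subset)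

lemma prim_borel_measurable: "integrable (Om L) q \<Longrightarrow> prim L q \<in> borel_measurable (Om L)"
  by (intro continuous_on_borel_measurable_Om continuous_on_prim)

lemma continuous_on_L2:
  assumes "continuous_on {-L..L} f"
  shows "f \<in> L2 L"
proof -
  have "bounded (f ` {-L..L})"
    by (rule compact_imp_bounded[OF compact_continuous_image[OF assms]]) auto
  then obtain C where "\<forall>x\<in>{-L..L}. \<bar>f x\<bar> \<le> C" by (auto simp: bounded_iff)
  then show ?thesis
    by (intro L2_bounded[where C = C] continuous_on_borel_measurable_Om assms AE_I2) auto
qed

text \<open>Fubini's theorem on the triangle \<open>y \<le> x\<close> gives integration by parts without any
  differentiation theorem.\<close>

lemma integral_prim_mult:
  assumes q: "integrable (Om L) q" and r: "integrable (Om L) r"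
  shows "(LINT x|Om L. prim L q x * r x)
      = prim L q L * prim L r L - (LINT x|Om L. q x * prim L r x)"
proof -
  interpret fin: finite_measure "Om L" by (rule finite_measure_Om)
  interpret P: pair_sigma_finite "Om L" "Om L" ..
  have [measurable]: "q \<in> borel_measurable (Om L)" "r \<in> borel_measurable (Om L)" using q r by auto
  let ?F = "\<lambda>x y. indicator {..x} y * q y * r x :: real"
  have ind: "(\<lambda>p. indicator {..fst p} (snd p) :: real) \<in> borel_measurable (Om L \<Otimes>\<^sub>M Om L)"
  proof -
    have eq: "(\<lambda>p. indicator {..fst p} (snd p) :: real) = (\<lambda>p. if snd p \<le> fst p then 1 else 0)"
      by (auto simp: indicator_def)
    have [measurable]: "fst \<in> borel_measurable (Om L \<Otimes>\<^sub>M Om L)" "snd \<in> borel_measurable (Om L \<Otimes>\<^sub>M Om L)"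
      using measurable_compose[OF measurable_fst borel_measurable_ident_Om]
        measurable_compose[OF measurable_snd borel_measurable_ident_Om] by auto
    show ?thesis unfolding eq by measurable
  qed
  have qr: "integrable (Om L \<Otimes>\<^sub>M Om L) (\<lambda>(x, y). q y * r x)"
    by (rule P.Fubini_integrable) (use q r in \<open>auto simp: abs_mult\<close>)
  have int: "integrable (Om L \<Otimes>\<^sub>M Om L) (\<lambda>(x, y). ?F x y)"
  proof (rule Bochner_Integration.integrable_bound[OF qr])
    show "(\<lambda>(x, y). ?F x y) \<in> borel_measurable (Om L \<Otimes>\<^sub>M Om L)"
      using ind unfolding split_beta' by measurable
    show "AE p in Om L \<Otimes>\<^sub>M Om L. norm (case p of (x, y) \<Rightarrow> ?F x y)
        \<le> norm (case p of (x, y) \<Rightarrow> q y * r x)"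
      by (auto simp: indicator_def)
  qed
  have "(LINT x|Om L. prim L q x * r x) = (LINT x|Om L. LINT y|Om L. ?F x y)"
    by (simp add: prim_def)
  also have "\<dots> = (LINT y|Om L. LINT x|Om L. ?F x y)"
    by (rule P.Fubini_integral[OF int, symmetric])
  also have "\<dots> = (LINT y|Om L. q y * (prim L r L - prim L r y))"
  proof (rule Bochner_Integration.integral_cong[OF refl])
    fix y
    have "(LINT x|Om L. ?F x y) = q y * (LINT x|Om L. indicator {..x} y * r x)"
      by (subst integral_mult_right_zero[symmetric]) (simp add: ac_simps)
    also have "(LINT x|Om L. indicator {..x} y * r x) = (LINT x|Om L. r x - indicator {..y} x * r x)"
    proof (rule integral_cong_AE)
      show "AE x in Om L. indicator {..x} y * r x = r x - indicator {..y} x * r x"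
        using AE_Om_neq[of y L] by eventually_elim (auto simp: indicator_def)
      have "(\<lambda>x. indicator {..x} y * r x) = (\<lambda>x. (if y \<le> x then 1 else 0) * r x)"
        by (auto simp: indicator_def)
      then show "(\<lambda>x. indicator {..x} y * r x) \<in> borel_measurable (Om L)" by simp
    qed measurable
    also have "\<dots> = prim L r L - prim L r y"
      using r integrable_indicator_Om[OF r, of "{..y}"] by (simp add: prim_right prim_def[of L r y])
    finally show "(LINT x|Om L. ?F x y) = q y * (prim L r L - prim L r y)" .
  qed
  also have "\<dots> = (LINT y|Om L. prim L r L * q y - prim L r y * q y)"
    by (simp add: algebra_simps)
  also have "\<dots> = (LINT y|Om L. prim L r L * q y) - (LINT y|Om L. prim L r y * q y)"
    by (rule Bochner_Integration.integral_diff)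
      (use q r in \<open>auto intro!: integrable_mult_AE_bounded[OF _ prim_borel_measurable AE_I2[OF abs_prim_le]]\<close>)
  also have "(LINT y|Om L. prim L r L * q y) = prim L q L * prim L r L"
    by (simp add: prim_right[of L L q])
  finally show ?thesis by (simp add: mult.commute)
qed

text \<open>Since \<open>prim L r\<close> vanishes at both ends, there are no boundary terms and \<open>c\<close> drops out.\<close>

lemma integral_by_parts:
  assumes q: "integrable (Om L) q" and r: "integrable (Om L) r" and "prim L r L = 0"
  shows "(LINT x|Om L. r x * (c + prim L q x)) = - (LINT x|Om L. prim L r x * q x)"
proof -
  have rq: "integrable (Om L) (\<lambda>x. prim L q x * r x)"
    by (rule integrable_mult_AE_bounded[OF r prim_borel_measurable[OF q] AE_I2[OF abs_prim_le[OF q]]])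
  have "(LINT x|Om L. r x * (c + prim L q x)) = c * prim L r L + (LINT x|Om L. prim L q x * r x)"
    using r rq by (simp add: prim_right distrib_left mult.commute)
  then show ?thesis
    using integral_prim_mult[OF q r] assms(3) by (simp add: mult.commute)
qed

lemma integral_indicator_subinterval:
  fixes q :: "real \<Rightarrow> real"
  assumes "-L \<le> a" "b \<le> L" and q: "q \<in> borel_measurable (lebesgue_on {a..b})"
  shows "(LINT y|Om L. indicator {a<..b} y * q y) = (LINT y|lebesgue_on {a..b}. q y)"
proof -
  have m: "(\<lambda>y. indicator {a..b} y *\<^sub>R q y) \<in> borel_measurable lebesgue"
    using q by (subst (asm) borel_measurable_restrict_space_iff) auto
  have "(LINT y|Om L. indicator {a<..b} y * q y)
      = (LINT y|lebesgue. indicator {-L<..<L} y *\<^sub>R (indicator {a<..b} y * q y))"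
    by (subst integral_restrict_space) auto
  also have "\<dots> = (LINT y|lebesgue. indicator {-L<..<L} y * indicator {a<..b} y * (indicator {a..b} y *\<^sub>R q y))"
    by (rule Bochner_Integration.integral_cong) (auto simp: indicator_def)
  also have "\<dots> = (LINT y|lebesgue. indicator {a..b} y *\<^sub>R q y)"
  proof (rule integral_cong_AE)
    have "AE y in lebesgue. y \<noteq> c" for c :: real
      by (rule AE_completion[OF AE_lborel_singleton])
    from this[of a] this[of L] this[of "-L"]
    show "AE y in lebesgue. indicator {-L<..<L} y * indicator {a<..b} y * (indicator {a..b} y *\<^sub>R q y)
        = indicator {a..b} y *\<^sub>R q y"
      by eventually_elim (use assms in \<open>auto simp: indicator_def\<close>)
    show "(\<lambda>y. indicator {-L<..<L} y * indicator {a<..b} y * (indicator {a..b} y *\<^sub>R q y)) \<in> borel_measurable lebesgue"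
      by (intro borel_measurable_times m borel_measurable_indicator) auto
  qed (rule m)
  also have "\<dots> = (LINT y|lebesgue_on {a..b}. q y)"
    by (subst integral_restrict_space) auto
  finally show ?thesis .
qed

lemma prim_continuous:
  assumes p: "continuous_on {-L..L} p" and x: "-L \<le> a" "a \<le> b" "b \<le> L"
  shows "prim L p b - prim L p a = integral {a..b} p"
proof -
  have c: "continuous_on {a..b} p" using p x by (auto intro: continuous_on_subset)
  have "prim L p b - prim L p a = (LINT y|lebesgue_on {a..b}. p y)"
    unfolding prim_increment[OF L2_integrable[OF continuous_on_L2[OF p]] x(2)]
    by (rule integral_indicator_subinterval)
       (use x c in \<open>auto intro: continuous_imp_measurable_on_sets_lebesgue\<close>)
  also have "\<dots> = integral {a..b} p"
    by (rule lebesgue_integral_eq_integral) (auto intro: continuous_imp_integrable_real c)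
  finally show ?thesis .
qed

lemma prim_has_derivative_continuous:
  assumes p: "continuous_on {-L..L} p" and x: "x \<in> {-L..L}"
  shows "(prim L p has_real_derivative p x) (at x within {-L..L})"
proof -
  have "((\<lambda>u. integral {-L..u} p) has_real_derivative p x) (at x within {-L..L})"
    by (rule integral_has_real_derivative[OF p x])
  then show ?thesis
  proof (rule has_field_derivative_transform_within[where d = 1])
    fix u assume "u \<in> {-L..L}"
    then show "integral {-L..u} p = prim L p u"
      using prim_continuous[OF p, of "-L" u] by (simp add: prim_left)
  qed (use x in auto)
qed

text \<open>The link with classical calculus, where the fundamental theorem of calculus is available.\<close>

lemma prim_of_derivative:
  assumes d: "\<And>x. x \<in> {-L..L} \<Longrightarrow> (F has_real_derivative p x) (at x within {-L..L})"
    and p: "continuous_on {-L..L} p" and x: "x \<in> {-L..L}"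
  shows "F x = F (-L) + prim L p x"
proof -
  have "(p has_integral (F x - F (-L))) {-L..x}"
    by (rule fundamental_theorem_of_calculus)
       (use x in \<open>auto intro!: has_field_derivative_subset[OF d]
          simp flip: has_real_derivative_iff_has_vector_derivative\<close>)
  then show ?thesis
    using prim_continuous[OF p, of "-L" x] x by (auto simp: prim_left integral_unique)
qed

section \<open>Smooth bump functions\<close>

text \<open>\<open>Ck\<close> speaks of iterated derivatives. A set of functions closed under differentiation contains all
  iterated derivatives of its members, which settles every order at once.\<close>

lemma closed_under_deriv_imp_smooth:
  assumes step: "\<And>h. h \<in> S \<Longrightarrow> \<exists>k\<in>S. \<forall>x. (h has_real_derivative k x) (at x)" and h: "h \<in> S"
  shows "Ck k h"
proof -
  have step': "deriv h \<in> S \<and> (\<forall>x. (h has_real_derivative deriv h x) (at x))" if h: "h \<in> S" for h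
  proof -
    from step[OF h] obtain k where k: "k \<in> S" "\<And>x. (h has_real_derivative k x) (at x)" by auto
    then have "deriv h = k" by (auto intro: DERIV_imp_deriv)
    with k show ?thesis by simp
  qed
  have "(deriv ^^ j) h \<in> S" for j
    by (induction j) (use h step' in auto)
  then have D: "((deriv ^^ j) h has_real_derivative (deriv ^^ Suc j) h x) (at x)" for j x
    using step' by simp
  show ?thesis
    unfolding Ck_def
  proof (intro conjI allI impI)
    show "(deriv ^^ j) h differentiable at x" for j x
      using D[of j x] real_differentiable_def by blast
    show "continuous_on UNIV ((deriv ^^ k) h)"
      by (rule DERIV_continuous_on) (use D in auto)
  qed
qed

lemma Ck_has_derivative:
  assumes "\<And>k. Ck k h"
  shows "(h has_real_derivative deriv h x) (at x)"
proof -
  have "h differentiable at x" using assms[of 1] by (auto simp: Ck_def)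
  then show ?thesis by (simp add: DERIV_deriv_iff_real_differentiable)
qed

lemma smooth_deriv:
  assumes "\<And>k. Ck k h"
  shows "Ck k (deriv h)"
proof -
  have "(deriv ^^ j) (deriv h) = (deriv ^^ Suc j) h" for j
    by (simp add: funpow_swap1)
  then show ?thesis
    using assms[of "Suc k"] unfolding Ck_def by (metis Suc_mono)
qed

lemma smooth_linear:
  assumes f: "\<And>k. Ck k f" and g: "\<And>k. Ck k g"
  shows "Ck k (\<lambda>x. f x + c * g x)"
proof (rule closed_under_deriv_imp_smooth)
  let ?S = "{\<lambda>x. f x + c * g x | f g. (\<forall>k. Ck k f) \<and> (\<forall>k. Ck k g)}"
  show "(\<lambda>x. f x + c * g x) \<in> ?S" using f g by blast
  fix h assume "h \<in> ?S"
  then obtain f g where h: "h = (\<lambda>x. f x + c * g x)" and s: "\<And>k. Ck k f" "\<And>k. Ck k g" by auto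
  show "\<exists>k\<in>?S. \<forall>x. (h has_real_derivative k x) (at x)"
  proof (intro bexI[of _ "\<lambda>x. deriv f x + c * deriv g x"] allI)
    show "(h has_real_derivative deriv f x + c * deriv g x) (at x)" for x
      unfolding h by (intro DERIV_add DERIV_cmult Ck_has_derivative s)
    show "(\<lambda>x. deriv f x + c * deriv g x) \<in> ?S"
      using smooth_deriv[OF s(1)] smooth_deriv[OF s(2)] by blast
  qed
qed

lemma smooth_antideriv:
  assumes "\<And>x. (F has_real_derivative h x) (at x)" "\<And>k. Ck k h"
  shows "Ck k F"
proof (rule closed_under_deriv_imp_smooth)
  let ?S = "insert F {h. \<forall>k. Ck k h}"
  show "F \<in> ?S" by simp
  show "\<exists>k\<in>?S. \<forall>x. (f has_real_derivative k x) (at x)" if "f \<in> ?S" for f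
  proof (cases "f = F")
    case True
    then show ?thesis using assms by auto
  next
    case False
    then show ?thesis
      using that Ck_has_derivative[of f] smooth_deriv[of f] by (intro bexI[of _ "deriv f"]) auto
  qed
qed

text \<open>The functions \<open>P(1/t) exp(-1/t)\<close>, extended by zero to \<open>t \<le> 0\<close>, are closed under
  differentiation, because \<open>exp(-1/t)\<close> vanishes to infinite order at the origin.\<close>

definition flat :: "real poly \<Rightarrow> real \<Rightarrow> real" where
  "flat P t = (if 0 < t then poly P (1 / t) * exp (- 1 / t) else 0)"

lemma poly_exp_decay: "((\<lambda>x. poly P x * exp (- x)) \<longlongrightarrow> 0) (at_top :: real filter)"
proof -
  have "((\<lambda>x. \<Sum>i\<le>degree P. coeff P i * (x ^ i / exp x)) \<longlongrightarrow> (\<Sum>i\<le>degree P. coeff P i * 0)) at_top"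
    by (intro tendsto_sum tendsto_mult tendsto_const tendsto_power_div_exp_0)
  moreover have "(\<Sum>i\<le>degree P. coeff P i * (x ^ i / exp x)) = poly P x * exp (- x)" for x
    by (simp add: poly_altdef sum_distrib_right exp_minus field_simps sum_divide_distrib)
  ultimately show ?thesis by simp
qed

lemma flat_has_derivative:
  "(flat P has_real_derivative flat ([:0, 0, 1:] * (P - pderiv P)) t) (at t)"
proof -
  consider "t < 0" | "t = 0" | "0 < t" by linarith
  then show ?thesis
  proof cases
    case 1
    have "((\<lambda>t. 0) has_real_derivative 0) (at t)" by simp
    then have "(flat P has_real_derivative 0) (at t)"
      by (rule has_field_derivative_transform_within_open[where S = "{..<0}"])
         (use 1 in \<open>auto simp: flat_def\<close>)
    then show ?thesis using 1 by (simp add: flat_def)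
  next
    case 3
    have "((\<lambda>t. poly P (1 / t) * exp (- 1 / t)) has_real_derivative
        flat ([:0, 0, 1:] * (P - pderiv P)) t) (at t)"
      using 3 by (auto intro!: derivative_eq_intros DERIV_chain'[OF _ poly_DERIV]
        simp: flat_def field_simps power2_eq_square)
    then show ?thesis
      by (rule has_field_derivative_transform_within_open[where S = "{0<..}"])
         (use 3 in \<open>auto simp: flat_def\<close>)
  next
    case 2
    have "((\<lambda>y. flat P y / y) \<longlongrightarrow> 0) (at_right 0)"
    proof -
      have "((\<lambda>y::real. poly ([:0, 1:] * P) (inverse y) * exp (- inverse y)) \<longlongrightarrow> 0) (at_right 0)"
        by (rule filterlim_compose[OF poly_exp_decay filterlim_inverse_at_top_right])
      then show ?thesis
        by (rule Lim_transform_eventually)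
           (auto simp: eventually_at_right_field flat_def field_simps intro!: exI[of _ 1])
    qed
    moreover have "((\<lambda>y. flat P y / y) \<longlongrightarrow> 0) (at_left 0)"
      by (rule Lim_transform_eventually[OF tendsto_const])
         (auto simp: eventually_at_left_field flat_def intro!: exI[of _ "-1"])
    ultimately have "((\<lambda>y. flat P y / y) \<longlongrightarrow> 0) (at 0)"
      by (simp add: filterlim_split_at)
    then show ?thesis
      using 2 by (simp add: has_field_derivative_iff flat_def)
  qed
qed

text \<open>Products of two flat functions, one for each end of an interval, are closed under
  differentiation only up to linear combinations; hence the span.\<close>

inductive_set bump_span :: "real \<Rightarrow> real \<Rightarrow> real \<Rightarrow> (real \<Rightarrow> real) set" for n a b where
  base: "(\<lambda>x. flat P (n * (x - a)) * flat Q (n * (b - x))) \<in> bump_span n a b"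
| lin: "f \<in> bump_span n a b \<Longrightarrow> g \<in> bump_span n a b \<Longrightarrow> (\<lambda>x. c * f x + d * g x) \<in> bump_span n a b"

lemma bump_span_smooth: "h \<in> bump_span n a b \<Longrightarrow> Ck k h"
proof (rule closed_under_deriv_imp_smooth)
  show "\<exists>k\<in>bump_span n a b. \<forall>x. (h has_real_derivative k x) (at x)" if "h \<in> bump_span n a b" for h
    using that
  proof induction
    case (base P Q)
    let ?D = "\<lambda>P. [:0, 0, 1:] * (P - pderiv P) :: real poly"
    show ?case
    proof (intro bexI allI)
      fix x
      have "((\<lambda>x. flat P (n * (x - a))) has_real_derivative flat (?D P) (n * (x - a)) * n) (at x)"
        by (rule DERIV_chain'[OF _ flat_has_derivative]) (auto intro!: derivative_eq_intros)
      moreover have "((\<lambda>x. flat Q (n * (b - x))) has_real_derivative flat (?D Q) (n * (b - x)) * (- n)) (at x)"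
        by (rule DERIV_chain'[OF _ flat_has_derivative]) (auto intro!: derivative_eq_intros)
      ultimately show "((\<lambda>x. flat P (n * (x - a)) * flat Q (n * (b - x))) has_real_derivative
          n * (flat (?D P) (n * (x - a)) * flat Q (n * (b - x)))
            + (- n) * (flat P (n * (x - a)) * flat (?D Q) (n * (b - x)))) (at x)"
        by (auto intro!: derivative_eq_intros)
    qed (intro bump_span.intros)
  next
    case (lin f g c d)
    then obtain f' g' where "f' \<in> bump_span n a b" "g' \<in> bump_span n a b"
      "\<And>x. (f has_real_derivative f' x) (at x)" "\<And>x. (g has_real_derivative g' x) (at x)" by metis
    then show ?case
      by (intro bexI[of _ "\<lambda>x. c * f' x + d * g' x"] allI bump_span.lin DERIV_add DERIV_cmult)
  qed
qed

definition bump :: "nat \<Rightarrow> real \<Rightarrow> real \<Rightarrow> real \<Rightarrow> real" where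
  "bump n a b x = flat 1 (real (Suc n) * (x - a)) * flat 1 (real (Suc n) * (b - x))"

lemma bump_smooth: "Ck k (bump n a b)"
  using bump_span_smooth[OF bump_span.base[of 1 "real (Suc n)" a 1 b]]
  by (simp add: bump_def[abs_def])

lemma flat_1_bounds: "0 \<le> flat 1 t" "flat 1 t \<le> 1"
  by (auto simp: flat_def)

lemma bump_bounds: "0 \<le> bump n a b x" "bump n a b x \<le> 1"
  using flat_1_bounds by (auto simp: bump_def intro: mult_le_one)

lemma bump_outside: "x \<notin> {a<..<b} \<Longrightarrow> bump n a b x = 0"
  by (auto simp: bump_def flat_def zero_less_mult_iff)

lemma bump_pos: "x \<in> {a<..<b} \<Longrightarrow> 0 < bump n a b x"
  by (auto simp: bump_def flat_def)

text \<open>Because \<open>exp(-1/(n s)) \<rightarrow> 1\<close> for \<open>s > 0\<close>, sharpening the bumps recovers the indicator of an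
  interval.\<close>

lemma bump_tendsto_indicator: "(\<lambda>n. bump n a b x) \<longlonglongrightarrow> indicator {a<..<b} x"
proof -
  have lim: "(\<lambda>n. flat 1 (real (Suc n) * s)) \<longlonglongrightarrow> 1" if "0 < s" for s
  proof -
    have "(\<lambda>n. exp (- inverse (real (Suc n)) * (1 / s))) \<longlonglongrightarrow> exp (- 0 * (1 / s))"
      by (intro tendsto_intros LIMSEQ_inverse_real_of_nat)
    moreover have "flat 1 (real (Suc n) * s) = exp (- inverse (real (Suc n)) * (1 / s))" for n
      using that by (simp add: flat_def field_simps del: of_nat_Suc)
    ultimately show ?thesis by simp
  qed
  show ?thesis
  proof (cases "x \<in> {a<..<b}")
    case True
    then have "(\<lambda>n. bump n a b x) \<longlonglongrightarrow> 1 * 1"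
      unfolding bump_def by (intro tendsto_mult lim) auto
    then show ?thesis using True by simp
  next
    case False
    then show ?thesis by (simp add: bump_outside)
  qed
qed

section \<open>Weak derivatives and indefinite integrals\<close>

lemma test_funI:
  assumes "\<And>k. Ck k \<phi>" "-L < a" "b < L" "\<And>x. x \<notin> {a..b} \<Longrightarrow> \<phi> x = 0"
  shows "test_fun L \<phi>"
proof -
  have "closure {x. \<phi> x \<noteq> 0} \<subseteq> {a..b}"
    by (rule closure_minimal) (use assms(4) in blast, simp)
  moreover from this have "compact (closure {x. \<phi> x \<noteq> 0})"
    using compact_Icc[of a b] closed_closure by (metis compact_Int_closed inf.absorb_iff2)
  ultimately show ?thesis
    unfolding test_fun_def using assms(1-3) by fastforce
qed

lemma test_fun_support:
  assumes "test_fun L \<phi>" "0 < L"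
  obtains a b where "-L < a" "a \<le> b" "b < L" "\<And>x. x \<notin> {a<..<b} \<Longrightarrow> \<phi> x = 0"
proof -
  let ?K = "closure {x. \<phi> x \<noteq> 0}"
  have K: "compact ?K" "?K \<subseteq> {-L<..<L}" using assms by (auto simp: test_fun_def)
  have "compact (insert 0 ?K)" "insert 0 ?K \<noteq> {}" using K by auto
  from compact_attains_inf[OF this] compact_attains_sup[OF this] obtain m M where
    mM: "m \<in> insert 0 ?K" "M \<in> insert 0 ?K" "\<And>x. x \<in> insert 0 ?K \<Longrightarrow> m \<le> x" "\<And>x. x \<in> insert 0 ?K \<Longrightarrow> x \<le> M"
    by auto
  then have "-L < m" "m \<le> M" "M < L" using K assms(2) by auto
  show ?thesis
  proof (rule that[of "(m - L) / 2" "(M + L) / 2"])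
    show "\<phi> x = 0" if "x \<notin> {(m - L) / 2<..<(M + L) / 2}" for x
    proof (rule ccontr)
      assume "\<phi> x \<noteq> 0"
      then have "x \<in> ?K" by (meson closure_subset mem_Collect_eq subsetD)
      then have "m \<le> x" "x \<le> M" using mM by auto
      with that \<open>-L < m\<close> \<open>M < L\<close> show False by auto
    qed
  qed (use \<open>-L < m\<close> \<open>m \<le> M\<close> \<open>M < L\<close> in auto)
qed

lemma test_fun_continuous: "test_fun L \<phi> \<Longrightarrow> continuous_on S \<phi>"
  using continuous_on_subset[of UNIV \<phi> S] by (auto simp: test_fun_def Ck_def dest!: spec[of _ 0])

lemma test_fun_derivative: "test_fun L \<phi> \<Longrightarrow> (\<phi> has_real_derivative deriv \<phi> x) (at x)"
  by (rule Ck_has_derivative) (simp add: test_fun_def)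

lemma test_fun_bump: "-L < a \<Longrightarrow> b < L \<Longrightarrow> test_fun L (bump n a b)"
  by (rule test_funI[of _ _ a b]) (auto simp: bump_smooth bump_outside)

lemma test_fun_deriv:
  assumes "test_fun L \<phi>" "0 < L"
  shows "test_fun L (deriv \<phi>)"
proof -
  obtain a b where ab: "-L < a" "a \<le> b" "b < L" "\<And>x. x \<notin> {a<..<b} \<Longrightarrow> \<phi> x = 0"
    using test_fun_support[OF assms] by metis
  have "deriv \<phi> x = 0" if "x \<notin> {a..b}" for x
  proof -
    have "((\<lambda>x. 0) has_real_derivative 0) (at x)" by simp
    then have "(\<phi> has_real_derivative 0) (at x)"
      by (rule has_field_derivative_transform_within_open[where S = "- {a..b}"])
         (use that ab(4) in auto)
    then show ?thesis by (rule DERIV_imp_deriv)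
  qed
  then show ?thesis
    using ab assms(1) by (intro test_funI[of _ _ a b] smooth_deriv) (auto simp: test_fun_def)
qed

lemma L1_loc_integrable_Om:
  assumes "integrable (Om L) v"
  shows "v \<in> L1_loc L"
  unfolding L1_loc_def
proof (intro CollectI allI impI)
  fix S assume S: "compact S" "S \<subseteq> {-L<..<L}"
  then have m: "S \<in> sets lebesgue" by (simp add: compact_imp_closed)
  have "set_integrable lebesgue {-L<..<L} v"
    using assms by (simp add: integrable_restrict_space set_integrable_def)
  from set_integrable_subset[OF this m S(2)] show "integrable (lebesgue_on S) v"
    using m by (simp add: integrable_restrict_space set_integrable_def)
qed

lemma borel_measurable_indicator_Om:
  "A \<in> sets borel \<Longrightarrow> (\<lambda>x. indicator A x :: real) \<in> borel_measurable (Om L)"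
  using measurable_compose[OF borel_measurable_ident_Om borel_measurable_indicator[of A borel]] by simp

text \<open>A locally integrable function need not be integrable up to the boundary, so integrals over
  \<open>Om L\<close> are taken after cutting off to a compact subinterval.\<close>

lemma L1_loc_cutoff:
  assumes "v \<in> L1_loc L" "-L < a" "b < L"
  shows "integrable lebesgue (\<lambda>x. indicator {a..b} x * v x)"
    and "integrable (Om L) (\<lambda>x. indicator {a..b} x * v x)"
proof -
  have "integrable (lebesgue_on {a..b}) v"
  proof -
    have "compact {a..b}" "{a..b} \<subseteq> {-L<..<L}" using assms by auto
    then show ?thesis using assms(1) unfolding L1_loc_def by blast
  qed
  then show 1: "integrable lebesgue (\<lambda>x. indicator {a..b} x * v x)"
    by (simp add: integrable_restrict_space)
  have eq: "(\<lambda>x. indicator {-L<..<L} x *\<^sub>R (indicator {a..b} x * v x)) = (\<lambda>x. indicator {a..b} x * v x)"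
    using assms by (auto simp: indicator_def fun_eq_iff)
  show "integrable (Om L) (\<lambda>x. indicator {a..b} x * v x)"
    by (subst integrable_restrict_space, simp, unfold eq, rule 1)
qed

lemma L1_loc_mult_test:
  assumes v: "v \<in> L1_loc L" and \<phi>: "test_fun L \<phi>" and "0 < L"
  shows "integrable (Om L) (\<lambda>x. v x * \<phi> x)"
proof -
  obtain a b where ab: "-L < a" "a \<le> b" "b < L" "\<And>x. x \<notin> {a<..<b} \<Longrightarrow> \<phi> x = 0"
    using test_fun_support[OF \<phi> \<open>0 < L\<close>] by metis
  have c: "continuous_on {-L..L} \<phi>" by (rule test_fun_continuous[OF \<phi>])
  have "bounded (\<phi> ` {-L..L})"
    by (rule compact_imp_bounded[OF compact_continuous_image[OF c]]) auto
  then obtain C where C: "\<forall>x\<in>{-L..L}. \<bar>\<phi> x\<bar> \<le> C" by (auto simp: bounded_iff)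
  have "integrable (Om L) (\<lambda>x. \<phi> x * (indicator {a..b} x * v x))"
    by (rule integrable_mult_AE_bounded[where C = C])
       (use L1_loc_cutoff(2)[OF v ab(1,3)] C c in \<open>auto intro!: AE_I2 continuous_on_borel_measurable_Om\<close>)
  moreover have "\<phi> x * (indicator {a..b} x * v x) = v x * \<phi> x" for x
    using ab(4)[of x] by (cases "x \<in> {a..b}") auto
  ultimately show ?thesis by simp
qed

lemma L1_loc_diff: "u \<in> L1_loc L \<Longrightarrow> v \<in> L1_loc L \<Longrightarrow> (\<lambda>x. u x - v x) \<in> L1_loc L"
  by (auto simp: L1_loc_def)

text \<open>The half-lines generate the Borel sets, so a function whose integrals over all of them vanish
  has vanishing integral over every Borel set.\<close>

lemma AE_zero_if_integrals_zero:
  fixes V :: "real \<Rightarrow> real"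
  assumes V: "integrable lebesgue V" and tot: "(LINT y|lebesgue. V y) = 0"
    and half: "\<And>x. (LINT y|lebesgue. indicator {..<x} y * V y) = 0"
  shows "AE y in lebesgue. V y = 0"
proof -
  obtain W where W: "W \<in> borel_measurable lborel" "AE x in lborel. V x = W x"
    using completion_ex_borel_measurable_real[of V lborel] V by auto
  have VW: "AE x in lebesgue. V x = W x"
    by (rule AE_completion[OF W(2)])
  have [measurable]: "V \<in> borel_measurable lebesgue" using V by auto
  have [measurable]: "W \<in> borel_measurable borel" using W(1) by simp
  have Wl: "W \<in> borel_measurable lebesgue"
    by (rule measurable_completion) (use W(1) in simp)
  have intW: "integrable lborel W"
    using V integrable_cong_AE[OF _ Wl VW] by (simp add: integrable_completion)
  have int: "(LINT y|lborel. indicator A y * W y) = (LINT y|lebesgue. indicator A y * V y)"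
    if [measurable]: "A \<in> sets borel" for A
  proof -
    have [measurable]: "A \<in> sets lebesgue" by simp
    have "(LINT y|lborel. indicator A y * W y) = (LINT y|lebesgue. indicator A y * W y)"
      by (rule integral_completion[symmetric]) simp
    also have "\<dots> = (LINT y|lebesgue. indicator A y * V y)"
      by (rule integral_cong_AE) (use VW Wl in auto)
    finally show ?thesis .
  qed
  have si: "set_integrable lborel A W" if "A \<in> sets borel" for A
    unfolding set_integrable_def by (rule integrable_mult_indicator) (use intW that in auto)
  have zero: "(LINT y:A|lborel. W y) = 0" if A: "A \<in> sets borel" for A
  proof -
    have 1: "A \<in> sigma_sets UNIV (range lessThan)"
      using A unfolding borel_Iio by (simp add: sets_measure_of)
    have 2: "Int_stable (range (lessThan :: real \<Rightarrow> real set))"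
    proof -
      have "{..<a} \<inter> {..<b} = {..<min a b}" for a b :: real by auto
      then show ?thesis by (auto simp: Int_stable_def)
    qed
    have 3: "range lessThan \<subseteq> Pow (UNIV :: real set)" by simp
    show ?thesis
      using 2 3 1
    proof (induction rule: sigma_sets_induct_disjoint)
      case (basic B)
      then show ?case using half int by (auto simp: set_lebesgue_integral_def)
    next
      case empty
      show ?case by (simp add: set_lebesgue_integral_def)
    next
      case (compl B)
      have B: "B \<in> sets borel" using compl(1) unfolding borel_Iio by (simp add: sets_measure_of)
      have "(LINT y:(UNIV - B) \<union> B|lborel. W y) = (LINT y:UNIV - B|lborel. W y) + (LINT y:B|lborel. W y)"
        by (rule set_integral_Un) (use B si in auto)
      moreover have "(LINT y:UNIV|lborel. W y) = 0"
        using int[of UNIV] tot by (simp add: set_lebesgue_integral_def)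
      ultimately show ?case using compl(2) by (simp add: Un_commute)
    next
      case (union F)
      have F: "F i \<in> sets borel" for i
        using union(2) unfolding borel_Iio by (auto simp: sets_measure_of)
      have "(LINT y:(\<Union>i. F i)|lborel. W y) = (\<Sum>i. (LINT y:F i|lborel. W y))"
        by (rule lebesgue_integral_countable_add)
           (use F union(1) si in \<open>auto simp: disjoint_family_on_def\<close>)
      then show ?case using union(3) by simp
    qed
  qed
  have "AE x in lborel. W x = (\<lambda>x. 0) x"
    by (rule density_unique_real[OF intW]) (use zero in \<open>auto simp: set_lebesgue_integral_def\<close>)
  then have "AE x in lebesgue. W x = 0" by (intro AE_completion) simp
  then show ?thesis using VW by eventually_elim simp
qed

text \<open>The fundamental lemma of the calculus of variations.\<close>

lemma AE_zero_if_test_zero: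
  assumes L: "0 < L" and v: "v \<in> L1_loc L"
    and zero: "\<And>\<phi>. test_fun L \<phi> \<Longrightarrow> (LINT x|Om L. v x * \<phi> x) = 0"
  shows "AE x in Om L. v x = 0"
proof -
  have int0: "(LINT x|lebesgue. indicator {a<..<b} x * v x) = 0" if ab: "-L < a" "b < L" for a b
  proof -
    note i = L1_loc_cutoff(2)[OF v ab]
    have "(\<lambda>n. LINT x|Om L. bump n a b x * (indicator {a..b} x * v x))
        \<longlonglongrightarrow> (LINT x|Om L. indicator {a<..<b} x * (indicator {a..b} x * v x))"
    proof (rule integral_dominated_convergence[where w = "\<lambda>x. \<bar>indicator {a..b} x * v x\<bar>"])
      show "(\<lambda>x. bump n a b x * (indicator {a..b} x * v x)) \<in> borel_measurable (Om L)" for n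
        by (rule borel_measurable_times[OF continuous_on_borel_measurable_Om[OF
          test_fun_continuous[OF test_fun_bump[OF ab]]] borel_measurable_integrable[OF i]])
      show "(\<lambda>x. indicator {a<..<b} x * (indicator {a..b} x * v x)) \<in> borel_measurable (Om L)"
        by (rule borel_measurable_times[OF borel_measurable_indicator_Om borel_measurable_integrable[OF i]]) simp
      show "AE x in Om L. (\<lambda>n. bump n a b x * (indicator {a..b} x * v x))
          \<longlonglongrightarrow> indicator {a<..<b} x * (indicator {a..b} x * v x)"
        by (intro AE_I2 tendsto_mult tendsto_const bump_tendsto_indicator)
      show "AE x in Om L. norm (bump n a b x * (indicator {a..b} x * v x))
          \<le> \<bar>indicator {a..b} x * v x\<bar>" for n
        using bump_bounds[of n a b] by (intro AE_I2) (auto simp: abs_mult intro!: mult_left_le_one_le)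
    qed (use i in auto)
    moreover have "(LINT x|Om L. bump n a b x * (indicator {a..b} x * v x)) = 0" for n
    proof -
      have "bump n a b x * (indicator {a..b} x * v x) = v x * bump n a b x" for x
        using bump_outside[of x a b n] by (cases "x \<in> {a..b}") auto
      then show ?thesis using zero[OF test_fun_bump[OF ab]] by presburger
    qed
    ultimately have "(LINT x|Om L. indicator {a<..<b} x * (indicator {a..b} x * v x)) = 0"
      by (simp add: LIMSEQ_const_iff)
    moreover have "(LINT x|Om L. indicator {a<..<b} x * (indicator {a..b} x * v x))
        = (LINT x|lebesgue. indicator {a<..<b} x * v x)"
      by (subst integral_restrict_space)
         (use ab in \<open>auto intro!: Bochner_Integration.integral_cong simp: indicator_def\<close>)
    ultimately show ?thesis by simp
  qed
  have ae: "AE x in lebesgue. indicator {a<..<b} x * v x = 0" if ab: "-L < a" "b < L" for a b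
  proof (rule AE_zero_if_integrals_zero)
    show "integrable lebesgue (\<lambda>x. indicator {a<..<b} x * v x)"
    proof -
      have "integrable lebesgue (\<lambda>x. indicator {a<..<b} x *\<^sub>R (indicator {a..b} x * v x))"
        by (rule integrable_mult_indicator) (use L1_loc_cutoff(1)[OF v ab] in auto)
      moreover have "(\<lambda>x. indicator {a<..<b} x *\<^sub>R (indicator {a..b} x * v x)) = (\<lambda>x. indicator {a<..<b} x * v x)"
        by (auto simp: indicator_def fun_eq_iff)
      ultimately show ?thesis by (simp only:)
    qed
    show "(LINT x|lebesgue. indicator {a<..<b} x * v x) = 0" by (rule int0[OF ab])
    fix c
    have "indicator {..<c} x * (indicator {a<..<b} x * v x) = indicator {a<..<min b c} x * v x" for x
      by (auto simp: indicator_def)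
    moreover have "min b c < L" using ab by simp
    ultimately show "(LINT x|lebesgue. indicator {..<c} x * (indicator {a<..<b} x * v x)) = 0"
      using int0[OF ab(1)] by presburger
  qed
  have "AE x in lebesgue. \<forall>n. indicator {-L + 1 / real (Suc n)<..<L - 1 / real (Suc n)} x * v x = 0"
    unfolding AE_all_countable by (intro allI ae) auto
  then have "AE x in lebesgue. x \<in> {-L<..<L} \<longrightarrow> v x = 0"
  proof eventually_elim
    case (elim x)
    show ?case
    proof
      assume x: "x \<in> {-L<..<L}"
      then have "0 < min (x + L) (L - x)" by auto
      then obtain n where "1 / real (Suc n) < min (x + L) (L - x)"
        using nat_approx_posE by blast
      then show "v x = 0" using elim[rule_format, of n] by (auto simp: indicator_def split: if_splits)
    qed
  qed
  then show ?thesis by (subst AE_restrict_space_iff) auto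
qed

lemma weak_deriv_unique:
  assumes "0 < L" "has_weak_deriv L u v" "has_weak_deriv L u v'"
  shows "AE x in Om L. v x = v' x"
proof -
  have "AE x in Om L. v x - v' x = 0"
  proof (rule AE_zero_if_test_zero[OF assms(1)])
    show "(\<lambda>x. v x - v' x) \<in> L1_loc L" using assms by (auto simp: has_weak_deriv_def intro: L1_loc_diff)
    fix \<phi> assume \<phi>: "test_fun L \<phi>"
    have "integrable (Om L) (\<lambda>x. v x * \<phi> x)" "integrable (Om L) (\<lambda>x. v' x * \<phi> x)"
      using assms \<phi> by (auto simp: has_weak_deriv_def intro: L1_loc_mult_test)
    then show "(LINT x|Om L. (v x - v' x) * \<phi> x) = 0"
      using assms \<phi> by (simp add: has_weak_deriv_def left_diff_distrib)
  qed
  then show ?thesis by simp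
qed

lemma test_fun_as_prim:
  assumes "test_fun L \<phi>" "0 < L"
  shows "x \<in> {-L..L} \<Longrightarrow> \<phi> x = prim L (deriv \<phi>) x" "prim L (deriv \<phi>) L = 0"
    "integrable (Om L) (deriv \<phi>)"
proof -
  obtain a b where ab: "-L < a" "a \<le> b" "b < L" "\<And>x. x \<notin> {a<..<b} \<Longrightarrow> \<phi> x = 0"
    using test_fun_support[OF assms] by metis
  have c: "continuous_on {-L..L} (deriv \<phi>)"
    by (rule test_fun_continuous[OF test_fun_deriv[OF assms]])
  have *: "\<phi> x = prim L (deriv \<phi>) x" if "x \<in> {-L..L}" for x
    using prim_of_derivative[OF has_field_derivative_at_within[OF test_fun_derivative[OF assms(1)]] c that]
      ab(4)[of "-L"] ab by simp
  then show "x \<in> {-L..L} \<Longrightarrow> \<phi> x = prim L (deriv \<phi>) x" .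
  show "prim L (deriv \<phi>) L = 0" using *[of L] ab(4)[of L] ab assms(2) by simp
  show "integrable (Om L) (deriv \<phi>)" by (rule L2_integrable[OF continuous_on_L2[OF c]])
qed

lemma has_weak_deriv_prim:
  assumes L: "0 < L" and q: "integrable (Om L) q" and u: "u \<in> borel_measurable (Om L)"
    and eq: "AE x in Om L. u x = c + prim L q x"
  shows "has_weak_deriv L u q"
  unfolding has_weak_deriv_def
proof (intro conjI allI impI)
  have m: "(\<lambda>x. c + prim L q x) \<in> borel_measurable (Om L)"
    using prim_borel_measurable[OF q] by simp
  have "integrable (Om L) (\<lambda>x. c + prim L q x)"
    by (rule L2_integrable[OF continuous_on_L2]) (intro continuous_intros continuous_on_prim q)
  then have "integrable (Om L) u" using integrable_cong_AE[OF u m eq] by simp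
  then show "u \<in> L1_loc L" by (rule L1_loc_integrable_Om)
  show "q \<in> L1_loc L" by (rule L1_loc_integrable_Om[OF q])
  fix \<phi> assume \<phi>: "test_fun L \<phi>"
  note t = test_fun_as_prim[OF \<phi> L]
  have [measurable]: "deriv \<phi> \<in> borel_measurable (Om L)" using t(3) by auto
  have "(LINT x|Om L. u x * deriv \<phi> x) = (LINT x|Om L. deriv \<phi> x * (c + prim L q x))"
    by (rule integral_cong_AE) (use u m eq in auto)
  also have "\<dots> = - (LINT x|Om L. prim L (deriv \<phi>) x * q x)"
    by (rule integral_by_parts[OF q t(3,2)])
  also have "(LINT x|Om L. prim L (deriv \<phi>) x * q x) = (LINT x|Om L. q x * \<phi> x)"
    by (rule Bochner_Integration.integral_cong) (auto simp: t(1))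
  finally show "(LINT x|Om L. u x * deriv \<phi> x) = - (LINT x|Om L. q x * \<phi> x)" .
qed

text \<open>The du Bois-Reymond lemma: subtracting a multiple of a fixed bump makes a test function have
  mean zero, hence the derivative of a test function.\<close>

lemma AE_const_if_weak_deriv_zero:
  assumes L: "0 < L" and w: "w \<in> L1_loc L"
    and zero: "\<And>\<phi>. test_fun L \<phi> \<Longrightarrow> (LINT x|Om L. w x * deriv \<phi> x) = 0"
  obtains c where "AE x in Om L. w x = c"
proof -
  define \<beta> where "\<beta> = bump 0 (- L / 2) (L / 2)"
  have \<beta>: "test_fun L \<beta>" unfolding \<beta>_def using L by (intro test_fun_bump) auto
  have i: "integrable (Om L) \<phi>" if "test_fun L \<phi>" for \<phi>
    by (intro L2_integrable continuous_on_L2 test_fun_continuous[OF that])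
  define m where "m = (LINT x|Om L. \<beta> x)"
  have "m \<noteq> 0"
  proof
    assume "m = 0"
    then have "AE x in Om L. \<beta> x = 0"
      using integral_nonneg_eq_0_iff_AE[OF i[OF \<beta>]] bump_bounds by (auto simp: m_def \<beta>_def)
    then have "AE x in Om L. x \<notin> {- L / 2<..<L / 2}"
    proof eventually_elim
      case (elim x)
      then show ?case using bump_pos[of x "- L / 2" "L / 2" 0] unfolding \<beta>_def by linarith
    qed
    then have "AE x in lebesgue. x \<in> {-L<..<L} \<longrightarrow> x \<notin> {- L / 2<..<L / 2}"
      by (subst (asm) AE_restrict_space_iff) auto
    then have "AE x in lebesgue. x \<notin> {- L / 2<..<L / 2}"
      by eventually_elim (use L in auto)
    then have "{- L / 2<..<L / 2} \<in> null_sets lebesgue"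
      by (subst AE_iff_null_sets) auto
    then show False using L by (auto simp: null_sets_def)
  qed
  define c where "c = (LINT x|Om L. w x * \<beta> x) / m"
  have "AE x in Om L. w x - c = 0"
  proof (rule AE_zero_if_test_zero[OF L])
    show "(\<lambda>x. w x - c) \<in> L1_loc L"
      by (intro L1_loc_diff w L1_loc_integrable_Om integrable_const_Om)
    fix \<phi> assume \<phi>: "test_fun L \<phi>"
    \<comment> \<open>With this \<open>k\<close> the function \<open>\<phi> - k \<beta>\<close> has mean zero.\<close>
    define k where "k = (LINT x|Om L. \<phi> x) / m"
    define \<psi> where "\<psi> x = \<phi> x + (- k) * \<beta> x" for x
    obtain a b where ab: "-L < a" "a \<le> b" "b < L" "\<And>x. x \<notin> {a<..<b} \<Longrightarrow> \<phi> x = 0"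
      using test_fun_support[OF \<phi> L] by metis
    define a' b' where "a' = min a (- L / 2)" and "b' = max b (L / 2)"
    have ab': "-L < a'" "b' < L" using ab L by (auto simp: a'_def b'_def)
    have \<psi>0: "\<psi> x = 0" if "x \<notin> {a'<..<b'}" for x
      using that ab(4)[of x] bump_outside[of x "- L / 2" "L / 2" 0]
      by (auto simp: \<psi>_def \<beta>_def a'_def b'_def min_def max_def split: if_splits)
    have sm: "Ck j \<psi>" for j
      unfolding \<psi>_def using \<phi> \<beta> by (intro smooth_linear) (auto simp: test_fun_def)
    have \<psi>: "test_fun L \<psi>" by (rule test_funI[OF sm ab']) (use \<psi>0 in auto)
    have "(LINT x|Om L. \<psi> x) = 0"
      using i[OF \<phi>] i[OF \<beta>] \<open>m \<noteq> 0\<close> by (simp add: \<psi>_def k_def m_def[symmetric])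
    then have pL: "prim L \<psi> L = 0" by (simp add: prim_right)
    have c: "continuous_on S \<psi>" for S by (rule test_fun_continuous[OF \<psi>])
    note i\<psi> = i[OF \<psi>]
    have left: "prim L \<psi> x = 0" if "x \<le> a'" for x
    proof -
      have "prim L \<psi> x = (LINT y|Om L. 0)"
        unfolding prim_def by (rule Bochner_Integration.integral_cong)
          (use that \<psi>0 in \<open>auto simp: indicator_def\<close>)
      then show ?thesis by simp
    qed
    have right: "prim L \<psi> x = 0" if "b' \<le> x" for x
    proof -
      have "prim L \<psi> x = prim L \<psi> L"
        unfolding prim_right[OF order_refl, of L \<psi>] unfolding prim_def
        by (rule Bochner_Integration.integral_cong) (use that \<psi>0 in \<open>auto simp: indicator_def\<close>)
      then show ?thesis using pL by simp
    qed
    have D: "(prim L \<psi> has_real_derivative \<psi> x) (at x)" for x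
    proof -
      consider "x < a'" | "b' < x" | "x \<in> {-L<..<L}" using ab' by force
      then show ?thesis
      proof cases
        case 1
        have "((\<lambda>x. 0) has_real_derivative 0) (at x)" by simp
        then have "(prim L \<psi> has_real_derivative 0) (at x)"
          by (rule has_field_derivative_transform_within_open[where S = "{..<a'}"]) (use 1 left in auto)
        then show ?thesis using \<psi>0[of x] 1 by simp
      next
        case 2
        have "((\<lambda>x. 0) has_real_derivative 0) (at x)" by simp
        then have "(prim L \<psi> has_real_derivative 0) (at x)"
          by (rule has_field_derivative_transform_within_open[where S = "{b'<..}"]) (use 2 right in auto)
        then show ?thesis using \<psi>0[of x] 2 by simp
      next
        case 3
        then have "at x within {-L..L} = at x" by (intro at_within_interior) auto
        then show ?thesis using prim_has_derivative_continuous[OF c[of "{-L..L}"], of x] 3 by auto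
      qed
    qed
    have "test_fun L (prim L \<psi>)"
      by (rule test_funI[OF _ ab']) (use smooth_antideriv[OF D sm] left right in auto)
    from zero[OF this] have "(LINT x|Om L. w x * \<psi> x) = 0"
      using D by (simp add: DERIV_imp_deriv[OF D])
    moreover have "(LINT x|Om L. w x * \<psi> x) = (LINT x|Om L. w x * \<phi> x) - k * (LINT x|Om L. w x * \<beta> x)"
      using L1_loc_mult_test[OF w \<phi> L] L1_loc_mult_test[OF w \<beta> L]
      by (simp add: \<psi>_def right_diff_distrib mult.left_commute)
    moreover have "(LINT x|Om L. (w x - c) * \<phi> x) = (LINT x|Om L. w x * \<phi> x) - c * (LINT x|Om L. \<phi> x)"
      using L1_loc_mult_test[OF w \<phi> L] i[OF \<phi>] by (simp add: left_diff_distrib)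
    ultimately show "(LINT x|Om L. (w x - c) * \<phi> x) = 0"
      using \<open>m \<noteq> 0\<close> by (simp add: k_def c_def)
  qed
  then show ?thesis using that[of c] by simp
qed

lemma weak_deriv_imp_prim:
  assumes L: "0 < L" and d: "has_weak_deriv L u v" and v: "integrable (Om L) v"
  obtains c where "AE x in Om L. u x = c + prim L v x"
proof -
  have p: "has_weak_deriv L (prim L v) v"
    by (rule has_weak_deriv_prim[OF L v prim_borel_measurable[OF v], of 0]) simp
  obtain c where "AE x in Om L. u x - prim L v x = c"
  proof (rule AE_const_if_weak_deriv_zero[OF L])
    show "(\<lambda>x. u x - prim L v x) \<in> L1_loc L"
      using d p by (auto simp: has_weak_deriv_def intro: L1_loc_diff)
    fix \<phi> assume \<phi>: "test_fun L \<phi>"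
    have "integrable (Om L) (\<lambda>x. u x * deriv \<phi> x)" "integrable (Om L) (\<lambda>x. prim L v x * deriv \<phi> x)"
      using d p by (auto simp: has_weak_deriv_def intro: L1_loc_mult_test[OF _ test_fun_deriv[OF \<phi> L] L])
    then show "(LINT x|Om L. (u x - prim L v x) * deriv \<phi> x) = 0"
      using d p \<phi> by (simp add: has_weak_deriv_def left_diff_distrib)
  qed
  then have "AE x in Om L. u x = c + prim L v x" by eventually_elim simp
  then show ?thesis by (rule that)
qed

text \<open>Completeness of the Lebesgue measure; it makes the arbitrary representative \<open>Dx L u\<close> measurable.\<close>

lemma borel_measurable_Om_cong_AE:
  assumes u: "u \<in> borel_measurable (Om L)" and eq: "AE x in Om L. u x = v x"
  shows "(v :: real \<Rightarrow> real) \<in> borel_measurable (Om L)"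
proof -
  have "(\<lambda>x. indicator {-L<..<L} x *\<^sub>R u x) \<in> borel_measurable lebesgue"
    using u by (subst (asm) borel_measurable_restrict_space_iff) auto
  moreover have "AE x in lebesgue. indicator {-L<..<L} x *\<^sub>R u x = indicator {-L<..<L} x *\<^sub>R v x"
    using eq by (subst (asm) AE_restrict_space_iff) (auto simp: indicator_def elim!: eventually_mono)
  ultimately have "(\<lambda>x. indicator {-L<..<L} x *\<^sub>R v x) \<in> borel_measurable lebesgue"
    by (rule borel_measurable_AE)
  then show ?thesis by (subst borel_measurable_restrict_space_iff) auto
qed

text \<open>The du Bois-Reymond lemma gives one direction and integration by parts the other.\<close>

lemma H1_iff_prim:
  assumes L: "0 < L"
  shows "u \<in> H1 L \<longleftrightarrow>
    u \<in> borel_measurable (Om L) \<and> (\<exists>c. \<exists>q\<in>L2 L. AE x in Om L. u x = c + prim L q x)"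
proof
  assume "u \<in> H1 L"
  then obtain q where "u \<in> L2 L" "q \<in> L2 L" "has_weak_deriv L u q" by (auto simp: H1_def)
  then show "u \<in> borel_measurable (Om L) \<and> (\<exists>c. \<exists>q\<in>L2 L. AE x in Om L. u x = c + prim L q x)"
    using weak_deriv_imp_prim[OF L _ L2_integrable] L2_meas by metis
next
  assume "u \<in> borel_measurable (Om L) \<and> (\<exists>c. \<exists>q\<in>L2 L. AE x in Om L. u x = c + prim L q x)"
  then obtain c q where *: "u \<in> borel_measurable (Om L)" "q \<in> L2 L" "AE x in Om L. u x = c + prim L q x"
    by auto
  have "(\<lambda>x. c + prim L q x) \<in> L2 L"
    using L2_integrable[OF *(2)] by (intro continuous_on_L2 continuous_intros continuous_on_prim)
  then show "u \<in> H1 L"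
    using * L2_cong_AE[OF _ *(1,3)] has_weak_deriv_prim[OF L L2_integrable[OF *(2)] *(1,3)]
    by (auto simp: H1_def)
qed

text \<open>Weak derivatives are unique almost everywhere, so the choice in \<open>Dx\<close> does no harm.\<close>

lemma Dx_AE_eq:
  assumes L: "0 < L" and u: "u \<in> borel_measurable (Om L)" and q: "q \<in> L2 L"
    and eq: "AE x in Om L. u x = c + prim L q x"
  shows "AE x in Om L. Dx L u x = q x" and "Dx L u \<in> L2 L"
proof -
  have d: "has_weak_deriv L u q" by (rule has_weak_deriv_prim[OF L L2_integrable[OF q] u eq])
  have "has_weak_deriv L u (Dx L u)" unfolding Dx_def by (rule someI[of "\<lambda>v. has_weak_deriv L u v", OF d])
  from weak_deriv_unique[OF L this d] show *: "AE x in Om L. Dx L u x = q x" .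
  have "AE x in Om L. q x = Dx L u x" using * by eventually_elim simp
  from borel_measurable_Om_cong_AE[OF L2_meas[OF q] this] show "Dx L u \<in> L2 L"
    by (rule L2_cong_AE[OF q _ *])
qed

section \<open>Strictly convex potentials on the line\<close>

definition subgrad :: "(real \<Rightarrow> real) \<Rightarrow> real \<Rightarrow> real \<Rightarrow> bool" where
  "subgrad f p s \<longleftrightarrow> (\<forall>y. f p + s * (y - p) \<le> f y)"

lemma subgrad_mono:
  assumes "subgrad f p s" "subgrad f p' s'"
  shows "0 \<le> (s - s') * (p - p')"
  using assms[unfolded subgrad_def, THEN spec, of p'] assms(2)[unfolded subgrad_def, THEN spec, of p]
    assms(1)[unfolded subgrad_def, THEN spec, of p']
  by (simp add: algebra_simps)

text \<open>The growth condition covers \<open>\<bar>r\<bar>\<close> and all functions whose derivative grows at most linearly; it makes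
  \<open>q \<mapsto> \<integral> f(q)\<close> finite and continuous on \<open>L\<^sup>2\<close>.\<close>

locale diffusion =
  fixes f :: "real \<Rightarrow> real" and \<nu> C\<^sub>f :: real
  assumes \<nu>: "0 < \<nu>" and f_convex: "convex_on UNIV f" and f_0: "f 0 = 0" and f_nonneg: "0 \<le> f r"
    and f_lip: "\<bar>f a - f b\<bar> \<le> C\<^sub>f * (1 + \<bar>a\<bar> + \<bar>b\<bar>) * \<bar>a - b\<bar>"
begin

definition h :: "real \<Rightarrow> real" where "h r = f r + \<nu>\<^sup>2 / 2 * r\<^sup>2"

lemma f_continuous: "continuous_on UNIV f"
  by (rule convex_on_continuous[OF open_UNIV f_convex])

lemma h_continuous: "continuous_on S h"
  unfolding h_def using continuous_on_subset[OF f_continuous, of S]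
  by (auto intro!: continuous_intros)

lemma f_segment: "0 \<le> t \<Longrightarrow> t \<le> 1 \<Longrightarrow> f (a + t * (b - a)) \<le> f a + t * (f b - f a)"
  using convex_onD[OF f_convex, of t a b] by (simp add: algebra_simps)

lemma h_segment:
  assumes "0 \<le> t" "t \<le> 1"
  shows "h (a + t * (b - a)) \<le> h a + t * (h b - h a)"
proof -
  have "(a + t * (b - a))\<^sup>2 = a\<^sup>2 + t * (b\<^sup>2 - a\<^sup>2) - t * (1 - t) * (b - a)\<^sup>2"
    by (simp add: power2_eq_square algebra_simps)
  then have "(a + t * (b - a))\<^sup>2 \<le> a\<^sup>2 + t * (b\<^sup>2 - a\<^sup>2)" using assms by simp
  then have "\<nu>\<^sup>2 / 2 * (a + t * (b - a))\<^sup>2 \<le> \<nu>\<^sup>2 / 2 * (a\<^sup>2 + t * (b\<^sup>2 - a\<^sup>2))"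
    by (intro mult_left_mono) auto
  then show ?thesis using f_segment[OF assms, of a b] by (simp add: h_def algebra_simps)
qed

lemma h_midpoint: "h ((a + b) / 2) \<le> (h a + h b) / 2 - \<nu>\<^sup>2 / 8 * (a - b)\<^sup>2"
  using f_segment[of "1/2" a b] by (simp add: h_def power2_eq_square field_simps)

lemma h_nonneg: "0 \<le> h r"
  using f_nonneg by (simp add: h_def)

lemma h_0: "h 0 = 0" by (simp add: h_def f_0)

text \<open>The quadratic part of \<open>h\<close> is differentiable, so it contributes exactly \<open>\<nu>\<^sup>2 p\<close> to every
  subgradient at \<open>p\<close>.\<close>

lemma subgrad_h_imp_f:
  assumes "subgrad h p s"
  shows "subgrad f p (s - \<nu>\<^sup>2 * p)"
  unfolding subgrad_def
proof
  fix y
  have ineq: "(s - \<nu>\<^sup>2 * p) * (y - p) \<le> f y - f p + t * (\<nu>\<^sup>2 / 2 * (y - p)\<^sup>2)" if t: "0 < t" "t \<le> 1" for t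
  proof -
    have "h p + s * (t * (y - p)) \<le> h (p + t * (y - p))"
      using assms[unfolded subgrad_def, THEN spec, of "p + t * (y - p)"] by simp
    moreover have "f (p + t * (y - p)) \<le> f p + t * (f y - f p)" using f_segment t by simp
    moreover have "h (p + t * u) = f (p + t * u) + \<nu>\<^sup>2 / 2 * p\<^sup>2 + t * (\<nu>\<^sup>2 * p * u) + t * (t * (\<nu>\<^sup>2 / 2 * u\<^sup>2))" for u
      by (simp add: h_def power2_eq_square field_simps)
    from this[of "y - p"]
    have "h (p + t * (y - p)) = f (p + t * (y - p)) + \<nu>\<^sup>2 / 2 * p\<^sup>2 + t * (\<nu>\<^sup>2 * p * (y - p))
        + t * (t * (\<nu>\<^sup>2 / 2 * (y - p)\<^sup>2))" .
    moreover have "t * ((s - \<nu>\<^sup>2 * p) * (y - p)) = s * (t * (y - p)) - t * (\<nu>\<^sup>2 * p * (y - p))"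
      by (simp add: algebra_simps)
    moreover have "t * (f y - f p + t * (\<nu>\<^sup>2 / 2 * (y - p)\<^sup>2)) = t * (f y - f p) + t * (t * (\<nu>\<^sup>2 / 2 * (y - p)\<^sup>2))"
      by (rule distrib_left)
    ultimately have "t * ((s - \<nu>\<^sup>2 * p) * (y - p)) \<le> t * (f y - f p + t * (\<nu>\<^sup>2 / 2 * (y - p)\<^sup>2))"
      unfolding h_def[of p] by linarith
    then show ?thesis using t by simp
  qed
  have "((\<lambda>t. f y - f p + t * (\<nu>\<^sup>2 / 2 * (y - p)\<^sup>2)) \<longlongrightarrow> f y - f p + 0 * (\<nu>\<^sup>2 / 2 * (y - p)\<^sup>2)) (at_right 0)"
    by (intro tendsto_intros)
  moreover have "\<forall>\<^sub>F t in at_right 0. (s - \<nu>\<^sup>2 * p) * (y - p) \<le> f y - f p + t * (\<nu>\<^sup>2 / 2 * (y - p)\<^sup>2)"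
    by (rule eventually_mono[OF eventually_at_right_real[of 0 1]]) (simp, rule ineq, auto)
  ultimately have "(s - \<nu>\<^sup>2 * p) * (y - p) \<le> f y - f p + 0 * (\<nu>\<^sup>2 / 2 * (y - p)\<^sup>2)"
    by (rule tendsto_lowerbound) simp
  then show "f p + (s - \<nu>\<^sup>2 * p) * (y - p) \<le> f y" by simp
qed

lemma subgrad_f_imp_h:
  assumes "subgrad f p (s - \<nu>\<^sup>2 * p)"
  shows "subgrad h p s"
  unfolding subgrad_def
proof
  fix y
  have "0 \<le> \<nu>\<^sup>2 / 2 * (y - p)\<^sup>2" by simp
  then show "h p + s * (y - p) \<le> h y"
    using assms[unfolded subgrad_def, THEN spec, of y]
    by (simp add: h_def power2_eq_square algebra_simps)
qed

text \<open>The inverse of the subdifferential of \<open>h\<close>; it is single-valued and Lipschitz because \<open>h\<close> is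
  uniformly convex, even where \<open>f\<close> has a kink.\<close>

definition \<beta> :: "real \<Rightarrow> real" where "\<beta> s = (SOME p. subgrad f p (s - \<nu>\<^sup>2 * p))"

lemma subgrad_\<beta>: "subgrad f (\<beta> s) (s - \<nu>\<^sup>2 * \<beta> s)"
proof -
  \<comment> \<open>Outside \<open>[-R, R]\<close> the quadratic part of \<open>h\<close> dominates \<open>s y\<close>, so the minimum of \<open>h y - s y\<close> lies inside.\<close>
  define R where "R = 2 * \<bar>s\<bar> / \<nu>\<^sup>2 + 1"
  have R: "R \<ge> 0" by (simp add: R_def)
  have "continuous_on {-R..R} (\<lambda>p. h p - s * p)"
    by (intro continuous_intros h_continuous)
  then have "\<exists>p\<in>{-R..R}. \<forall>y\<in>{-R..R}. h p - s * p \<le> h y - s * y"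
    by (intro continuous_attains_inf) (use R in auto)
  then obtain p where p: "\<And>y. y \<in> {-R..R} \<Longrightarrow> h p - s * p \<le> h y - s * y" by blast
  have "h p - s * p \<le> h y - s * y" for y
  proof (cases "y \<in> {-R..R}")
    case False
    then have "R < \<bar>y\<bar>" by auto
    then have "2 * \<bar>s\<bar> / \<nu>\<^sup>2 \<le> \<bar>y\<bar>" by (simp add: R_def)
    then have "\<bar>s\<bar> \<le> \<nu>\<^sup>2 / 2 * \<bar>y\<bar>" using \<nu> by (simp add: field_simps)
    then have "\<bar>s\<bar> * \<bar>y\<bar> \<le> \<nu>\<^sup>2 / 2 * \<bar>y\<bar> * \<bar>y\<bar>" by (intro mult_right_mono) auto
    moreover have "s * y \<le> \<bar>s\<bar> * \<bar>y\<bar>" using abs_ge_self[of "s * y"] by (simp add: abs_mult)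
    moreover have "\<bar>y\<bar> * \<bar>y\<bar> = y\<^sup>2" by (simp add: power2_eq_square)
    ultimately have "s * y \<le> h y" using f_nonneg[of y] by (simp add: h_def mult.assoc)
    moreover have "h p - s * p \<le> 0" using p[of 0] R by (simp add: h_0)
    ultimately show ?thesis by simp
  qed (rule p)
  then have "subgrad h p s" by (auto simp: subgrad_def algebra_simps)
  then have "subgrad f p (s - \<nu>\<^sup>2 * p)" by (rule subgrad_h_imp_f)
  then show ?thesis unfolding \<beta>_def by (rule someI[where P = "\<lambda>p. subgrad f p (s - \<nu>\<^sup>2 * p)"])
qed

lemma subgrad_strong_mono:
  assumes "subgrad f p (s - \<nu>\<^sup>2 * p)" "subgrad f p' (s' - \<nu>\<^sup>2 * p')"
  shows "\<nu>\<^sup>2 * (p - p')\<^sup>2 \<le> (s - s') * (p - p')"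
  using subgrad_mono[OF assms] by (simp add: power2_eq_square algebra_simps)

lemma \<beta>_strong_mono: "\<nu>\<^sup>2 * (\<beta> s - \<beta> s')\<^sup>2 \<le> (s - s') * (\<beta> s - \<beta> s')"
  by (rule subgrad_strong_mono) (rule subgrad_\<beta>)+

lemma subgrad_unique:
  assumes "subgrad f p (s - \<nu>\<^sup>2 * p)"
  shows "p = \<beta> s"
  using subgrad_strong_mono[OF assms subgrad_\<beta>[of s]] \<nu> by (simp add: mult_le_0_iff)

lemma \<beta>_0: "\<beta> 0 = 0"
  by (rule subgrad_unique[symmetric]) (use f_0 f_nonneg in \<open>simp add: subgrad_def\<close>)

lemma \<beta>_lipschitz: "\<bar>\<beta> s - \<beta> s'\<bar> \<le> \<bar>s - s'\<bar> / \<nu>\<^sup>2"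
proof (cases "\<beta> s = \<beta> s'")
  case False
  have "\<nu>\<^sup>2 * \<bar>\<beta> s - \<beta> s'\<bar> * \<bar>\<beta> s - \<beta> s'\<bar> \<le> \<bar>s - s'\<bar> * \<bar>\<beta> s - \<beta> s'\<bar>"
    using \<beta>_strong_mono[of s s'] abs_ge_self[of "(s - s') * (\<beta> s - \<beta> s')"]
    by (simp add: abs_mult power2_eq_square mult.assoc)
  then have "\<nu>\<^sup>2 * \<bar>\<beta> s - \<beta> s'\<bar> \<le> \<bar>s - s'\<bar>" using False by simp
  then show ?thesis using \<nu> by (simp add: field_simps)
qed simp

lemma \<beta>_continuous: "continuous_on S \<beta>"
proof (rule lipschitz_on_continuous_on[where L = "1 / \<nu>\<^sup>2"])
  show "lipschitz_on (1 / \<nu>\<^sup>2) S \<beta>"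
    using \<beta>_lipschitz by (intro lipschitz_onI) (auto simp: dist_real_def)
qed

lemma \<beta>_sign: "0 \<le> s * \<beta> s"
  using \<beta>_strong_mono[of s 0] by (simp add: \<beta>_0) (smt (verit) mult_nonneg_nonneg zero_le_power2)

lemma \<beta>_prim_continuous: "integrable (Om L) r \<Longrightarrow> continuous_on S (\<lambda>x. \<beta> (prim L r x))"
  by (rule continuous_on_compose2[OF \<beta>_continuous[of UNIV] continuous_on_prim]) auto

lemma \<beta>_prim_L2: "r \<in> L2 L \<Longrightarrow> (\<lambda>y. \<beta> (prim L r y)) \<in> L2 L"
  by (rule continuous_on_L2[OF \<beta>_prim_continuous[OF L2_integrable]])

lemma f_integrable:
  assumes "q \<in> L2 L"
  shows "integrable (Om L) (\<lambda>x. f (q x))"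
proof (rule Bochner_Integration.integrable_bound)
  show "integrable (Om L) (\<lambda>x. C\<^sub>f * ((1 + \<bar>q x\<bar>) * \<bar>q x\<bar>))"
    by (intro integrable_mult_right impI L2_mult_integrable L2_add L2_abs assms L2_const)
  show "(\<lambda>x. f (q x)) \<in> borel_measurable (Om L)"
    by (rule measurable_compose[OF L2_meas[OF assms] borel_measurable_continuous_onI[OF f_continuous]])
  show "AE x in Om L. norm (f (q x)) \<le> norm (C\<^sub>f * ((1 + \<bar>q x\<bar>) * \<bar>q x\<bar>))"
    using f_lip[of _ 0] by (intro AE_I2) (auto simp: f_0 mult.assoc intro: order_trans[OF _ abs_ge_self])
qed

lemma h_integrable: "q \<in> L2 L \<Longrightarrow> integrable (Om L) (\<lambda>x. h (q x))"
  unfolding h_def using f_integrable L2_sq by simp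

end

text \<open>In dimension one an \<open>H\<^sup>1\<close> bound is a uniform bound, so dominated convergence passes through every
  continuous nonlinearity.\<close>

lemma integral_continuous_comp_tendsto:
  assumes \<phi>: "continuous_on UNIV (\<phi> :: real \<Rightarrow> real)"
    and z: "\<And>n. continuous_on {-L..L} (z n)" "continuous_on {-L..L} y"
    and bd: "\<And>n x. x \<in> {-L..L} \<Longrightarrow> \<bar>z n x\<bar> \<le> B"
    and lim: "\<And>x. x \<in> {-L..L} \<Longrightarrow> (\<lambda>n. z n x) \<longlonglongrightarrow> y x"
    and v: "integrable (Om L) v"
  shows "(\<lambda>n. LINT x|Om L. \<phi> (z n x) * v x) \<longlonglongrightarrow> (LINT x|Om L. \<phi> (y x) * v x)"
proof -
  have "continuous_on {-B..B} \<phi>" using \<phi> by (rule continuous_on_subset) simp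
  then have "bounded (\<phi> ` {-B..B})"
    by (intro compact_imp_bounded compact_continuous_image) auto
  then obtain K where K: "\<forall>a\<in>{-B..B}. \<bar>\<phi> a\<bar> \<le> K" by (auto simp: bounded_iff)
  have m: "(\<lambda>x. \<phi> (a x)) \<in> borel_measurable (Om L)" if "continuous_on {-L..L} a" for a
    by (rule continuous_on_borel_measurable_Om[OF continuous_on_compose2[OF \<phi> that]]) simp
  show ?thesis
  proof (rule integral_dominated_convergence[where w = "\<lambda>x. \<bar>K * v x\<bar>"])
    show "AE x in Om L. (\<lambda>n. \<phi> (z n x) * v x) \<longlonglongrightarrow> \<phi> (y x) * v x"
    proof (rule AE_I2)
      fix x assume "x \<in> space (Om L)"
      then have "(\<lambda>n. z n x) \<longlonglongrightarrow> y x" by (intro lim) auto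
      then have "(\<lambda>n. \<phi> (z n x)) \<longlonglongrightarrow> \<phi> (y x)"
        using continuous_on_tendsto_compose[OF \<phi>, of "\<lambda>n. z n x"] by simp
      then show "(\<lambda>n. \<phi> (z n x) * v x) \<longlonglongrightarrow> \<phi> (y x) * v x" by (intro tendsto_intros)
    qed
    show "AE x in Om L. norm (\<phi> (z n x) * v x) \<le> \<bar>K * v x\<bar>" for n
    proof (rule AE_I2)
      fix x assume "x \<in> space (Om L)"
      then have "z n x \<in> {-B..B}" using bd[of x n] by (auto simp: abs_le_iff)
      then have "\<bar>\<phi> (z n x)\<bar> \<le> \<bar>K\<bar>" using K by force
      then show "norm (\<phi> (z n x) * v x) \<le> \<bar>K * v x\<bar>" by (simp add: abs_mult mult_right_mono)
    qed
  qed (use v m[OF z(1)] m[OF z(2)] in auto)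
qed

lemma continuous_on_affine_prim:
  "q \<in> L2 L \<Longrightarrow> continuous_on S (\<lambda>x. c + prim L q x)"
  by (intro continuous_on_add continuous_on_const continuous_on_prim L2_integrable)

lemma affine_prim_L2: "q \<in> L2 L \<Longrightarrow> (\<lambda>x. c + prim L q x) \<in> L2 L"
  by (rule continuous_on_L2[OF continuous_on_affine_prim])

lemma affine_prim_diff:
  "q \<in> L2 L \<Longrightarrow> q' \<in> L2 L \<Longrightarrow>
    (c + prim L q x) - (c' + prim L q' x) = (c - c') + prim L (\<lambda>y. q y - q' y) x"
  by (simp add: prim_diff L2_integrable)

lemma affine_prim_abs_diff:
  assumes "0 < L" "q \<in> L2 L" "q' \<in> L2 L"
  shows "\<bar>(c + prim L q x) - (c' + prim L q' x)\<bar> \<le> \<bar>c - c'\<bar> + sqrt (2 * L * sqn L (\<lambda>y. q y - q' y))"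
  unfolding affine_prim_diff[OF assms(2,3)]
  using abs_prim_le_sqn[OF assms(1) L2_diff[OF assms(2,3)], of x] by linarith

lemma sqn_prim_le:
  assumes "0 < L" "q \<in> L2 L"
  shows "sqn L (prim L q) \<le> 4 * L\<^sup>2 * sqn L q"
proof -
  have "sqn L (prim L q) \<le> (LINT x|Om L. 2 * L * sqn L q)"
  proof (rule integral_mono)
    show "integrable (Om L) (\<lambda>x. (prim L q x)\<^sup>2)"
      using L2_sq[OF affine_prim_L2[OF assms(2), of 0]] by simp
    fix x
    have "\<bar>prim L q x\<bar>\<^sup>2 \<le> (sqrt (2 * L * sqn L q))\<^sup>2"
      by (rule power_mono[OF abs_prim_le_sqn[OF assms]]) simp
    then show "(prim L q x)\<^sup>2 \<le> 2 * L * sqn L q" using assms sqn_nonneg[of L q] by simp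
  qed simp
  also have "\<dots> = 4 * L\<^sup>2 * sqn L q"
    unfolding integral_const_Om[OF assms(1)] by (simp add: power2_eq_square)
  finally show ?thesis .
qed

text \<open>Completeness of \<open>H\<^sup>1\<close> in terms of the pair (boundary value, derivative): the oscillating part
  is controlled by the derivative, and then the constant by the \<open>L\<^sup>2\<close> norm.\<close>

lemma affine_prim_complete:
  assumes L: "0 < L" and q: "\<And>n. q n \<in> L2 L"
    and C: "\<And>e. 0 < e \<Longrightarrow> \<exists>N. \<forall>m\<ge>N. \<forall>n\<ge>N. sqn L (\<lambda>x. q m x - q n x) < e \<and>
      sqn L (\<lambda>x. (c m + prim L (q m) x) - (c n + prim L (q n) x)) < e"
  obtains c0 l s where "l \<in> L2 L" "(\<lambda>n. sqn L (\<lambda>x. q n x - l x)) \<longlonglongrightarrow> 0" "c \<longlonglongrightarrow> c0"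
    "strict_mono s" "AE x in Om L. (\<lambda>n. q (s n) x) \<longlonglongrightarrow> l x"
proof -
  have Cq: "\<exists>N. \<forall>m\<ge>N. \<forall>n\<ge>N. sqn L (\<lambda>x. q m x - q n x) < e" if "0 < e" for e
    using C[OF that] by fast
  obtain l s where l: "l \<in> L2 L" "(\<lambda>n. sqn L (\<lambda>x. q n x - l x)) \<longlonglongrightarrow> 0"
    "strict_mono s" "AE x in Om L. (\<lambda>n. q (s n) x) \<longlonglongrightarrow> l x"
    by (rule L2_complete[OF L q Cq])
  have cb: "2 * L * (c m - c n)\<^sup>2 \<le> 2 * sqn L (\<lambda>x. (c m + prim L (q m) x) - (c n + prim L (q n) x))
      + 8 * L\<^sup>2 * sqn L (\<lambda>x. q m x - q n x)" for m n
  proof -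
    let ?z = "\<lambda>x. (c m + prim L (q m) x) - (c n + prim L (q n) x)" and ?q = "\<lambda>x. q m x - q n x"
    have z: "?z \<in> L2 L" by (intro L2_diff affine_prim_L2 q)
    have pq: "(\<lambda>x. (- 1) * prim L ?q x) \<in> L2 L"
      using L2_cmult[OF affine_prim_L2[OF L2_diff[OF q q], of 0], of "-1"] by simp
    have "2 * L * (c m - c n)\<^sup>2 = sqn L (\<lambda>x. ?z x + (- 1) * prim L ?q x)"
      using L by (simp add: affine_prim_diff[OF q q] measure_Om)
    also have "\<dots> \<le> 2 * sqn L ?z + 2 * sqn L (\<lambda>x. (- 1) * prim L ?q x)"
      by (rule sqn_add_le[OF z pq])
    also have "sqn L (\<lambda>x. (- 1) * prim L ?q x) = sqn L (prim L ?q)" by simp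
    finally show ?thesis using sqn_prim_le[OF L L2_diff[OF q q], of m n] by simp
  qed
  have "Cauchy c"
  proof (rule metric_CauchyI)
    fix e :: real assume e: "0 < e"
    define d where "d = L * e\<^sup>2 / (1 + 4 * L\<^sup>2)"
    have "0 < 1 + 4 * L\<^sup>2" by (simp add: add_pos_nonneg)
    then have d: "d > 0" "(1 + 4 * L\<^sup>2) * d = L * e\<^sup>2" using L e by (simp_all add: d_def)
    obtain N where N: "\<And>m n. m \<ge> N \<Longrightarrow> n \<ge> N \<Longrightarrow> sqn L (\<lambda>x. q m x - q n x) < d \<and>
      sqn L (\<lambda>x. (c m + prim L (q m) x) - (c n + prim L (q n) x)) < d" using C[OF d(1)] by auto
    have "dist (c m) (c n) < e" if "m \<ge> N" "n \<ge> N" for m n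
    proof -
      have "8 * L\<^sup>2 * sqn L (\<lambda>x. q m x - q n x) \<le> 8 * L\<^sup>2 * d"
        using N[OF that] by (intro mult_left_mono) auto
      then have "2 * L * (c m - c n)\<^sup>2 < 2 * d + 8 * L\<^sup>2 * d"
        using cb[of m n] N[OF that] by linarith
      also have "\<dots> = 2 * L * e\<^sup>2" using d(2) by (simp add: algebra_simps)
      finally have "(c m - c n)\<^sup>2 < e\<^sup>2" using L by simp
      then have "\<bar>c m - c n\<bar>\<^sup>2 < e\<^sup>2" by simp
      then have "\<bar>c m - c n\<bar> < e" by (rule power_less_imp_less_base) (use e in simp)
      then show ?thesis by (simp add: dist_real_def)
    qed
    then show "\<exists>M. \<forall>m\<ge>M. \<forall>n\<ge>M. dist (c m) (c n) < e" by blast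
  qed
  then obtain c0 where "c \<longlonglongrightarrow> c0" using Cauchy_convergent convergent_def by blast
  from that[OF l(1,2) this l(3,4)] show ?thesis .
qed

lemma affine_prim_tendsto:
  assumes L: "0 < L" and q: "\<And>n. q n \<in> L2 L" "l \<in> L2 L"
    and lim: "(\<lambda>n. sqn L (\<lambda>x. q n x - l x)) \<longlonglongrightarrow> 0" "c \<longlonglongrightarrow> c0"
  shows "(\<lambda>n. c n + prim L (q n) x) \<longlonglongrightarrow> c0 + prim L l x"
    and "\<exists>B. \<forall>n x. \<bar>c n + prim L (q n) x\<bar> \<le> B"
proof -
  define b where "b n = \<bar>c n - c0\<bar> + sqrt (2 * L * sqn L (\<lambda>y. q n y - l y))" for n
  have "b \<longlonglongrightarrow> \<bar>c0 - c0\<bar> + sqrt (2 * L * 0)"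
    unfolding b_def by (intro tendsto_intros lim)
  then have b: "b \<longlonglongrightarrow> 0" by simp
  have le: "\<bar>(c n + prim L (q n) x) - (c0 + prim L l x)\<bar> \<le> b n" for n x
    unfolding b_def by (rule affine_prim_abs_diff[OF L q])
  show "(\<lambda>n. c n + prim L (q n) x) \<longlonglongrightarrow> c0 + prim L l x"
    by (rule LIM_zero_cancel, rule tendsto_0_le[OF b, of _ 1])
       (use le in \<open>auto intro!: always_eventually order_trans[OF _ abs_ge_self]\<close>)
  obtain B where B: "\<And>n. \<bar>b n\<bar> \<le> B"
    using convergent_imp_bounded[OF b] by (auto simp: bounded_iff)
  have "\<bar>c n + prim L (q n) x\<bar> \<le> B + (\<bar>c0\<bar> + sqrt (2 * L * sqn L l))" for n x
    using le[of n x] B[of n] abs_prim_le_sqn[OF L q(2), of x] by linarith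
  then show "\<exists>B. \<forall>n x. \<bar>c n + prim L (q n) x\<bar> \<le> B" by blast
qed

lemma tendsto_if_abs_diff_le:
  fixes a b :: "nat \<Rightarrow> real"
  assumes le: "\<And>n. \<bar>a n - x\<bar> \<le> b n" and lim: "b \<longlonglongrightarrow> 0"
  shows "a \<longlonglongrightarrow> x"
proof (rule LIM_zero_cancel, rule tendsto_0_le[OF lim, of _ 1])
  show "\<forall>\<^sub>F n in sequentially. norm (a n - x) \<le> norm (b n) * 1"
    using le by (intro always_eventually allI) (metis abs_ge_self mult.right_neutral order_trans real_norm_def)
qed

section \<open>The semilinear problem with a smooth monotone reaction\<close>

locale reaction =
  fixes k \<kappa> :: "real \<Rightarrow> real" and c :: real
  assumes c: "0 < c" and k_continuous: "continuous_on UNIV k" and k_mono: "mono (\<lambda>r. k r - c * r)"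
    and \<kappa>_deriv: "(\<kappa> has_real_derivative k r) (at r)"
begin

lemma \<kappa>_tangent: "\<kappa> a + k a * (b - a) + c / 2 * (b - a)\<^sup>2 \<le> \<kappa> b"
proof -
  let ?\<psi> = "\<lambda>x. \<kappa> x - c / 2 * x\<^sup>2"
  have d: "(?\<psi> has_real_derivative k x - c * x) (at x)" for x
    by (auto intro!: derivative_eq_intros \<kappa>_deriv)
  have "convex_on UNIV ?\<psi>"
    by (rule convex_on_realI[of UNIV ?\<psi> "\<lambda>x. k x - c * x"]) (use d k_mono in \<open>auto simp: mono_def\<close>)
  then have "?\<psi> b - ?\<psi> a \<ge> (k a - c * a) * (b - a)"
    by (rule convex_on_imp_above_tangent[of UNIV]) (use d in auto)
  then show ?thesis by (simp add: power2_eq_square field_simps)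
qed

lemma \<kappa>_midpoint: "\<kappa> ((a + b) / 2) \<le> (\<kappa> a + \<kappa> b) / 2 - c / 8 * (a - b)\<^sup>2"
  using \<kappa>_tangent[of "(a + b) / 2" a] \<kappa>_tangent[of "(a + b) / 2" b]
  by (simp add: power2_eq_square field_simps)

lemma \<kappa>_continuous: "continuous_on UNIV \<kappa>"
  by (rule DERIV_continuous_on) (use \<kappa>_deriv in auto)

lemma k_strong_mono: "c * (a - b)\<^sup>2 \<le> (k a - k b) * (a - b)"
  using \<kappa>_tangent[of a b] \<kappa>_tangent[of b a] by (simp add: power2_eq_square field_simps)

end

locale semilinear = diffusion f \<nu> C\<^sub>f + reaction k \<kappa> c
  for f \<nu> C\<^sub>f k \<kappa> c +
  fixes L :: real and F :: "real \<Rightarrow> real"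
  assumes L: "0 < L" and F: "F \<in> L2 L"
begin

text \<open>The energy of \<open>z = d + prim L q\<close>, written in terms of its value \<open>d\<close> at \<open>-L\<close> and its
  derivative \<open>q\<close>.\<close>

definition J :: "real \<Rightarrow> (real \<Rightarrow> real) \<Rightarrow> real" where
  "J d q = (LINT x|Om L. h (q x))
    + (LINT x|Om L. \<kappa> (d + prim L q x) - F x * (d + prim L q x))"

lemma continuous_comp_integrable:
  assumes "continuous_on UNIV \<phi>" "continuous_on {-L..L} z"
  shows "integrable (Om L) (\<lambda>x. \<phi> (z x) :: real)"
  by (intro L2_integrable continuous_on_L2 continuous_on_compose2[OF assms]) simp

lemma reaction_integrable:
  assumes "q \<in> L2 L"
  shows "integrable (Om L) (\<lambda>x. \<kappa> (d + prim L q x) - F x * (d + prim L q x))"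
  using continuous_comp_integrable[OF \<kappa>_continuous continuous_on_affine_prim[OF assms]]
    L2_mult_integrable[OF F affine_prim_L2[OF assms]] by simp

text \<open>Uniform convexity, quantitatively: the gap controls the full \<open>H\<^sup>1\<close> distance.\<close>

lemma J_midpoint:
  assumes q: "q \<in> L2 L" "q' \<in> L2 L"
  shows "J ((d + d') / 2) (\<lambda>x. (q x + q' x) / 2) \<le> (J d q + J d' q') / 2
    - \<nu>\<^sup>2 / 8 * sqn L (\<lambda>x. q x - q' x)
    - c / 8 * sqn L (\<lambda>x. (d + prim L q x) - (d' + prim L q' x))"
proof -
  let ?m = "\<lambda>x. (q x + q' x) / 2"
  have m: "?m \<in> L2 L" using L2_cmult[OF L2_add[OF q], of "1/2"] by simp
  have pm: "(d + d') / 2 + prim L ?m x = ((d + prim L q x) + (d' + prim L q' x)) / 2" for x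
    using prim_cmult[of L "1/2" "\<lambda>x. q x + q' x" x] prim_add[OF L2_integrable[OF q(1)] L2_integrable[OF q(2)], of x]
    by (simp add: field_simps)
  have "(LINT x|Om L. h (?m x)) \<le> (LINT x|Om L. (h (q x) + h (q' x)) / 2 - \<nu>\<^sup>2 / 8 * (q x - q' x)\<^sup>2)"
    by (rule integral_mono) (use q m h_midpoint in \<open>simp_all add: h_integrable L2_sq L2_diff\<close>)
  also have "\<dots> = ((LINT x|Om L. h (q x)) + (LINT x|Om L. h (q' x))) / 2 - \<nu>\<^sup>2 / 8 * sqn L (\<lambda>x. q x - q' x)"
    using q by (simp add: h_integrable L2_sq L2_diff)
  finally have 1: "(LINT x|Om L. h (?m x)) \<le> \<dots>" .
  define z z' where "z x = d + prim L q x" and "z' x = d' + prim L q' x" for x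
  have zz: "z \<in> L2 L" "z' \<in> L2 L" using affine_prim_L2 q by (auto simp: z_def[abs_def] z'_def[abs_def])
  note i = reaction_integrable[OF q(1), of d, folded z_def] reaction_integrable[OF q(2), of d', folded z'_def]
  have "(LINT x|Om L. \<kappa> ((d + d') / 2 + prim L ?m x) - F x * ((d + d') / 2 + prim L ?m x))
     \<le> (LINT x|Om L. ((\<kappa> (z x) - F x * z x) + (\<kappa> (z' x) - F x * z' x)) / 2 - c / 8 * (z x - z' x)\<^sup>2)"
  proof (rule integral_mono[OF reaction_integrable[OF m]])
    fix x
    have "\<kappa> ((z x + z' x) / 2) - F x * ((z x + z' x) / 2)
       \<le> ((\<kappa> (z x) - F x * z x) + (\<kappa> (z' x) - F x * z' x)) / 2 - c / 8 * (z x - z' x)\<^sup>2"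
      using \<kappa>_midpoint[of "z x" "z' x"] by (simp add: field_simps)
    then show "\<kappa> ((d + d') / 2 + prim L ?m x) - F x * ((d + d') / 2 + prim L ?m x)
       \<le> ((\<kappa> (z x) - F x * z x) + (\<kappa> (z' x) - F x * z' x)) / 2 - c / 8 * (z x - z' x)\<^sup>2"
      unfolding pm by (simp add: z_def z'_def)
  qed (use i zz in \<open>simp_all add: L2_sq L2_diff\<close>)
  also have "\<dots> = ((LINT x|Om L. \<kappa> (z x) - F x * z x) + (LINT x|Om L. \<kappa> (z' x) - F x * z' x)) / 2
      - c / 8 * sqn L (\<lambda>x. z x - z' x)"
    using i L2_sq[OF L2_diff[OF zz]] by (simp del: Bochner_Integration.integral_diff add: Bochner_Integration.integral_diff[of _ "\<lambda>x. (_ x + _ x) / 2"])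
  finally have 2: "(LINT x|Om L. \<kappa> ((d + d') / 2 + prim L ?m x) - F x * ((d + d') / 2 + prim L ?m x)) \<le> \<dots>" .
  from 1 2 show ?thesis by (simp add: J_def z_def z'_def field_simps)
qed

text \<open>Strong monotonicity makes \<open>\<kappa>(z) - F z\<close> a quadratic with positive leading coefficient up to an error
  of the right sign; completing the square gives a bound independent of \<open>z\<close>.\<close>

lemma J_bounded_below:
  assumes q: "q \<in> L2 L"
  shows "(LINT x|Om L. \<kappa> 0 - (k 0 - F x)\<^sup>2 / (2 * c)) \<le> J d q"
proof -
  have "(LINT x|Om L. \<kappa> 0 - (k 0 - F x)\<^sup>2 / (2 * c))
      \<le> (LINT x|Om L. \<kappa> (d + prim L q x) - F x * (d + prim L q x))"
  proof (rule integral_mono[OF _ reaction_integrable[OF q]])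
    show "integrable (Om L) (\<lambda>x. \<kappa> 0 - (k 0 - F x)\<^sup>2 / (2 * c))"
      using L2_sq[OF L2_diff[OF L2_const F, of "k 0"]] by simp
    fix x
    let ?z = "d + prim L q x"
    have "0 \<le> (c * ?z + (k 0 - F x))\<^sup>2 / (2 * c)" using c by simp
    also have "\<dots> = c / 2 * ?z\<^sup>2 + (k 0 - F x) * ?z + (k 0 - F x)\<^sup>2 / (2 * c)"
      using c by (simp add: power2_eq_square field_simps)
    finally show "\<kappa> 0 - (k 0 - F x)\<^sup>2 / (2 * c) \<le> \<kappa> ?z - F x * ?z"
      using \<kappa>_tangent[of 0 ?z] by (simp add: left_diff_distrib)
  qed
  moreover have "0 \<le> (LINT x|Om L. h (q x))" by (simp add: h_nonneg)
  ultimately show ?thesis by (simp add: J_def)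
qed

lemma J_tendsto:
  assumes q: "\<And>n. q n \<in> L2 L" "l \<in> L2 L"
    and lim: "(\<lambda>n. sqn L (\<lambda>x. q n x - l x)) \<longlonglongrightarrow> 0" "d \<longlonglongrightarrow> d0"
  shows "(\<lambda>n. J (d n) (q n)) \<longlonglongrightarrow> J d0 l"
proof -
  let ?e = "\<lambda>n. sqn L (\<lambda>x. q n x - l x)"
  define v where "v x = 1 + 2 * \<bar>l x\<bar>" for x
  have v: "v \<in> L2 L" unfolding v_def by (intro L2_add L2_const L2_cmult L2_abs q)
  have hl: "\<bar>h a - h b\<bar> \<le> (\<bar>C\<^sub>f\<bar> + \<nu>\<^sup>2) * ((1 + 2 * \<bar>b\<bar>) * \<bar>a - b\<bar> + (a - b)\<^sup>2)" for a b
  proof -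
    have "1 + \<bar>a\<bar> + \<bar>b\<bar> \<le> 1 + 2 * \<bar>b\<bar> + \<bar>a - b\<bar>" by simp
    then have w: "(1 + \<bar>a\<bar> + \<bar>b\<bar>) * \<bar>a - b\<bar> \<le> (1 + 2 * \<bar>b\<bar>) * \<bar>a - b\<bar> + (a - b)\<^sup>2"
      using mult_right_mono[of "1 + \<bar>a\<bar> + \<bar>b\<bar>" "1 + 2 * \<bar>b\<bar> + \<bar>a - b\<bar>" "\<bar>a - b\<bar>"]
      by (simp add: distrib_right power2_eq_square abs_mult_self_eq)
    have "\<bar>f a - f b\<bar> \<le> \<bar>C\<^sub>f\<bar> * ((1 + \<bar>a\<bar> + \<bar>b\<bar>) * \<bar>a - b\<bar>)"
      using f_lip[of a b] mult_right_mono[OF abs_ge_self[of C\<^sub>f], of "(1 + \<bar>a\<bar> + \<bar>b\<bar>) * \<bar>a - b\<bar>"]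
      by (simp add: mult.assoc)
    moreover have "\<bar>\<nu>\<^sup>2 / 2 * a\<^sup>2 - \<nu>\<^sup>2 / 2 * b\<^sup>2\<bar> \<le> \<nu>\<^sup>2 * ((1 + \<bar>a\<bar> + \<bar>b\<bar>) * \<bar>a - b\<bar>)"
    proof -
      have factor: "\<nu>\<^sup>2 / 2 * a\<^sup>2 - \<nu>\<^sup>2 / 2 * b\<^sup>2 = \<nu>\<^sup>2 / 2 * ((a + b) * (a - b))"
        by (simp add: power2_eq_square algebra_simps)
      have "\<bar>\<nu>\<^sup>2 / 2 * a\<^sup>2 - \<nu>\<^sup>2 / 2 * b\<^sup>2\<bar> = \<nu>\<^sup>2 * (\<bar>a + b\<bar> / 2 * \<bar>a - b\<bar>)"
        unfolding factor by (simp add: abs_mult)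
      also have "\<dots> \<le> \<nu>\<^sup>2 * ((1 + \<bar>a\<bar> + \<bar>b\<bar>) * \<bar>a - b\<bar>)"
        by (intro mult_left_mono mult_right_mono) auto
      finally show ?thesis .
    qed
    ultimately have "\<bar>h a - h b\<bar> \<le> (\<bar>C\<^sub>f\<bar> + \<nu>\<^sup>2) * ((1 + \<bar>a\<bar> + \<bar>b\<bar>) * \<bar>a - b\<bar>)"
      unfolding h_def distrib_right[of "\<bar>C\<^sub>f\<bar>"] by linarith
    also have "\<dots> \<le> (\<bar>C\<^sub>f\<bar> + \<nu>\<^sup>2) * ((1 + 2 * \<bar>b\<bar>) * \<bar>a - b\<bar> + (a - b)\<^sup>2)"
      by (intro mult_left_mono w) auto
    finally show ?thesis .
  qed
  have est: "\<bar>(LINT x|Om L. h (q n x)) - (LINT x|Om L. h (l x))\<bar>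
      \<le> (\<bar>C\<^sub>f\<bar> + \<nu>\<^sup>2) * (sqrt (sqn L v * ?e n) + ?e n)" for n
  proof -
    have d: "(\<lambda>x. q n x - l x) \<in> L2 L" by (intro L2_diff q)
    have i: "integrable (Om L) (\<lambda>x. v x * \<bar>q n x - l x\<bar>)" by (intro L2_mult_integrable v L2_abs d)
    have "\<bar>(LINT x|Om L. h (q n x)) - (LINT x|Om L. h (l x))\<bar> = \<bar>LINT x|Om L. h (q n x) - h (l x)\<bar>"
      using q by (simp add: h_integrable)
    also have "\<dots> \<le> (LINT x|Om L. \<bar>h (q n x) - h (l x)\<bar>)"
      using integral_norm_bound[of "Om L" "\<lambda>x. h (q n x) - h (l x)"] by simp
    also have "\<dots> \<le> (LINT x|Om L. (\<bar>C\<^sub>f\<bar> + \<nu>\<^sup>2) * (v x * \<bar>q n x - l x\<bar> + (q n x - l x)\<^sup>2))"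
      by (rule integral_mono) (use q i L2_sq[OF d] hl in \<open>simp_all add: v_def h_integrable\<close>)
    also have "\<dots> = (\<bar>C\<^sub>f\<bar> + \<nu>\<^sup>2) * ((LINT x|Om L. v x * \<bar>q n x - l x\<bar>) + ?e n)"
      using i L2_sq[OF d] by simp
    also have "(LINT x|Om L. v x * \<bar>q n x - l x\<bar>) \<le> sqrt (sqn L v * ?e n)"
      using L2_Cauchy_Schwarz[OF v L2_abs[OF d]] by (simp add: real_le_rsqrt)
    finally show ?thesis by (simp add: mult_left_mono)
  qed
  have "(\<lambda>n. (\<bar>C\<^sub>f\<bar> + \<nu>\<^sup>2) * (sqrt (sqn L v * ?e n) + ?e n)) \<longlonglongrightarrow> (\<bar>C\<^sub>f\<bar> + \<nu>\<^sup>2) * (sqrt (sqn L v * 0) + 0)"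
    by (intro tendsto_intros lim)
  then have 1: "(\<lambda>n. LINT x|Om L. h (q n x)) \<longlonglongrightarrow> (LINT x|Om L. h (l x))"
    by (intro tendsto_if_abs_diff_le[OF est]) simp
  obtain B where B: "\<And>n x. \<bar>d n + prim L (q n) x\<bar> \<le> B"
    using affine_prim_tendsto(2)[OF L q lim] by auto
  note cc = integral_continuous_comp_tendsto[OF _ continuous_on_affine_prim[OF q(1)]
    continuous_on_affine_prim[OF q(2)] B affine_prim_tendsto(1)[OF L q lim]]
  have "(\<lambda>n. (LINT x|Om L. \<kappa> (d n + prim L (q n) x) * 1) - (LINT x|Om L. (d n + prim L (q n) x) * F x))
      \<longlonglongrightarrow> (LINT x|Om L. \<kappa> (d0 + prim L l x) * 1) - (LINT x|Om L. (d0 + prim L l x) * F x)"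
    by (intro tendsto_diff cc \<kappa>_continuous continuous_on_id integrable_const_Om L2_integrable[OF F])
  moreover have "(LINT x|Om L. \<kappa> (d + prim L q x) * 1) - (LINT x|Om L. (d + prim L q x) * F x)
      = (LINT x|Om L. \<kappa> (d + prim L q x) - F x * (d + prim L q x))" if "q \<in> L2 L" for d q
    using continuous_comp_integrable[OF \<kappa>_continuous continuous_on_affine_prim[OF that]]
      L2_mult_integrable[OF F affine_prim_L2[OF that]] by (simp add: mult.commute)
  ultimately show ?thesis
    unfolding J_def using q by (intro tendsto_add 1) simp
qed

text \<open>By uniform convexity every minimising sequence is Cauchy in \<open>H\<^sup>1\<close>.\<close>

lemma J_has_minimizer:
  obtains d q where "q \<in> L2 L" "\<And>d' q'. q' \<in> L2 L \<Longrightarrow> J d q \<le> J d' q'"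
proof -
  define S where "S = {J d q | d q. q \<in> L2 L}"
  have "J 0 (\<lambda>x. 0) \<in> S" unfolding S_def using L2_const by blast
  then have ne: "S \<noteq> {}" by blast
  have bd: "bdd_below S" using J_bounded_below by (auto simp: S_def intro!: bdd_belowI)
  define m where "m = Inf S"
  have low: "m \<le> J d q" if "q \<in> L2 L" for d q
    unfolding m_def by (rule cInf_lower[OF _ bd]) (use that in \<open>auto simp: S_def\<close>)
  have "\<exists>p. snd p \<in> L2 L \<and> J (fst p) (snd p) < m + inverse (real (Suc n))" for n
  proof -
    have "Inf S < m + inverse (real (Suc n))" by (simp add: m_def)
    from cInf_lessD[OF ne this] show ?thesis by (auto simp: S_def)
  qed
  then obtain p where p: "\<And>n. snd (p n) \<in> L2 L" "\<And>n. J (fst (p n)) (snd (p n)) < m + inverse (real (Suc n))"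
    by metis
  define d q where "d n = fst (p n)" and "q n = snd (p n)" for n
  have q: "q n \<in> L2 L" and Jn: "J (d n) (q n) < m + inverse (real (Suc n))" for n
    using p by (auto simp: d_def q_def)
  have chain: "x < y" if "u \<le> w" "v \<le> w" "x \<le> (u + v) / 2" "w < y" for x y u v w :: real
    using that by (simp add: field_simps)
  have combine: "A + B \<le> (u + v) / 2"
    if "m \<le> x" "x \<le> (y + z) / 2 - A - B" "y < m + u" "z < m + v" for A B u v x y z :: real
    using that by (simp add: field_simps)
  have est: "\<nu>\<^sup>2 / 8 * sqn L (\<lambda>x. q i x - q j x)
      + c / 8 * sqn L (\<lambda>x. (d i + prim L (q i) x) - (d j + prim L (q j) x))
      \<le> (inverse (real (Suc i)) + inverse (real (Suc j))) / 2" for i j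
  proof -
    have "(\<lambda>x. (q i x + q j x) / 2) \<in> L2 L" using L2_cmult[OF L2_add[OF q q], of "1/2"] by simp
    from low[OF this, of "(d i + d j) / 2"] J_midpoint[OF q q, of "d i" "d j" i j] Jn[of i] Jn[of j]
    show ?thesis
      by (rule combine)
  qed
  have C: "\<exists>N. \<forall>i\<ge>N. \<forall>j\<ge>N. sqn L (\<lambda>x. q i x - q j x) < e \<and>
      sqn L (\<lambda>x. (d i + prim L (q i) x) - (d j + prim L (q j) x)) < e" if e: "0 < e" for e
  proof -
    define \<mu> where "\<mu> = min (\<nu>\<^sup>2 / 8) (c / 8)"
    have \<mu>: "0 < \<mu>" using \<nu> c by (simp add: \<mu>_def)
    obtain N where N: "inverse (real (Suc N)) < \<mu> * e"
      using reals_Archimedean[of "\<mu> * e"] e \<mu> by auto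
    have "sqn L (\<lambda>x. q i x - q j x) < e \<and>
      sqn L (\<lambda>x. (d i + prim L (q i) x) - (d j + prim L (q j) x)) < e" if "i \<ge> N" "j \<ge> N" for i j
    proof -
      define a where "a = sqn L (\<lambda>x. q i x - q j x)"
      define b where "b = sqn L (\<lambda>x. (d i + prim L (q i) x) - (d j + prim L (q j) x))"
      have ab: "0 \<le> a" "0 \<le> b" by (simp_all add: a_def b_def)
      have "inverse (real (Suc i)) \<le> inverse (real (Suc N))" "inverse (real (Suc j)) \<le> inverse (real (Suc N))"
        using that by (auto intro!: le_imp_inverse_le)
      then have "\<nu>\<^sup>2 / 8 * a + c / 8 * b < \<mu> * e"
        using est[of i j, folded a_def b_def] N by (rule chain)
      moreover have "\<mu> * a \<le> \<nu>\<^sup>2 / 8 * a" "\<mu> * b \<le> c / 8 * b"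
        by (rule mult_right_mono[OF _ ab(1)], simp add: \<mu>_def, rule mult_right_mono[OF _ ab(2)], simp add: \<mu>_def)
      moreover have "0 \<le> \<mu> * a" "0 \<le> \<mu> * b"
        using \<mu> ab by simp_all
      ultimately have "\<mu> * a < \<mu> * e" "\<mu> * b < \<mu> * e" by linarith+
      then show ?thesis using \<mu> by (simp add: a_def b_def)
    qed
    then show ?thesis by blast
  qed
  obtain d0 l s where l: "l \<in> L2 L" "(\<lambda>n. sqn L (\<lambda>x. q n x - l x)) \<longlonglongrightarrow> 0" "d \<longlonglongrightarrow> d0"
    and "strict_mono s" "AE x in Om L. (\<lambda>n. q (s n) x) \<longlonglongrightarrow> l x"
    by (rule affine_prim_complete[OF L q C])
  have "(\<lambda>n. m + inverse (real (Suc n))) \<longlonglongrightarrow> m + 0"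
    by (intro tendsto_intros LIMSEQ_inverse_real_of_nat)
  then have "J d0 l \<le> m"
    using LIMSEQ_le[OF J_tendsto[OF q l]] Jn by (fastforce intro: less_imp_le)
  then show ?thesis using that[OF l(1)] low by (meson order_trans)
qed

text \<open>Testing minimality on arbitrary measurable subsets localises the integrated subgradient
  inequality; rational comparison values suffice by continuity.\<close>

lemma AE_subgrad_if_integrated:
  assumes q: "q \<in> L2 L" and H: "continuous_on {-L..L} H"
    and ineq: "\<And>\<phi>. \<phi> \<in> L2 L \<Longrightarrow> 0 \<le> (LINT x|Om L. h (q x + \<phi> x) - h (q x) - H x * \<phi> x)"
  shows "AE x in Om L. subgrad h (q x) (H x)"
proof -
  have HL: "H \<in> L2 L" by (rule continuous_on_L2[OF H])
  have [measurable]: "q \<in> borel_measurable (Om L)" "H \<in> borel_measurable (Om L)"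
    using q HL L2_meas by auto
  have [measurable]: "h \<in> borel_measurable borel"
    by (rule borel_measurable_continuous_onI[OF h_continuous])
  have point: "AE x in Om L. h (q x) + H x * (y - q x) \<le> h y" for y
  proof -
    define a where "a x = h y - h (q x) - H x * (y - q x)" for x
    \<comment> \<open>Moving \<open>q\<close> to \<open>y\<close> exactly where the subgradient inequality at \<open>y\<close> fails.\<close>
    define A where "A = {x \<in> space (Om L). a x < 0}"
    have am[measurable]: "a \<in> borel_measurable (Om L)" unfolding a_def by measurable
    have A[measurable]: "A \<in> sets (Om L)" unfolding A_def by measurable
    define \<phi> where "\<phi> x = indicator A x * (y - q x)" for x
    have \<phi>: "\<phi> \<in> L2 L" unfolding \<phi>_def by (intro L2_indicator A L2_diff L2_const q)
    have eq: "h (q x + \<phi> x) - h (q x) - H x * \<phi> x = indicator A x * a x" for x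
      by (auto simp: \<phi>_def a_def indicator_def)
    have i: "integrable (Om L) (\<lambda>x. indicator A x * a x)"
      unfolding eq[symmetric]
      by (intro Bochner_Integration.integrable_diff h_integrable L2_add L2_mult_integrable HL q \<phi>)
    \<comment> \<open>The integrand is nonpositive by the choice of \<open>A\<close>, so it vanishes almost everywhere.\<close>
    have np: "indicator A x * a x \<le> 0" for x by (auto simp: A_def indicator_def)
    have "0 \<le> (LINT x|Om L. indicator A x * a x)" using ineq[OF \<phi>] by (simp add: eq)
    moreover have "0 \<le> (LINT x|Om L. - (indicator A x * a x))"
      using np by (intro Bochner_Integration.integral_nonneg) simp
    ultimately have "(LINT x|Om L. - (indicator A x * a x)) = 0" by simp
    then have "AE x in Om L. - (indicator A x * a x) = 0"
      using integral_nonneg_eq_0_iff_AE[of "Om L" "\<lambda>x. - (indicator A x * a x)"] i np by auto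
    then show ?thesis
      using AE_space by eventually_elim (auto simp: A_def a_def indicator_def split: if_splits)
  qed
  have "AE x in Om L. \<forall>y\<in>\<rat>. h (q x) + H x * (y - q x) \<le> h y"
    unfolding AE_ball_countable[OF countable_rat] using point by blast
  then show ?thesis
  proof eventually_elim
    case (elim x)
    show ?case
      unfolding subgrad_def
    proof
      fix y
      have "y \<in> closure (\<rat> :: real set)" using Rats_closure_real by simp
      then obtain s where s: "\<And>n. s n \<in> \<rat>" "s \<longlonglongrightarrow> y" by (auto simp: closure_sequential)
      have "(\<lambda>n. h (q x) + H x * (s n - q x)) \<longlonglongrightarrow> h (q x) + H x * (y - q x)"
        by (intro tendsto_intros s)
      moreover have "(\<lambda>n. h (s n)) \<longlonglongrightarrow> h y"
        using continuous_on_tendsto_compose[OF h_continuous[of UNIV] s(2)] by simp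
      ultimately show "h (q x) + H x * (y - q x) \<le> h y"
        by (rule LIMSEQ_le) (use elim s(1) in blast)
    qed
  qed
qed

lemma k_comp_minus_F_L2: "continuous_on {-L..L} z \<Longrightarrow> (\<lambda>x. k (z x) - F x) \<in> L2 L"
  by (intro L2_diff F continuous_on_L2 continuous_on_compose2[OF k_continuous]) auto

text \<open>Convexity replaces differentiation of the kinked part: along \<open>q + t \<phi>\<close> the increment of \<open>h\<close> is at
  most \<open>t\<close> times the full increment. Only the reaction term is differentiated, by \<open>t \<rightarrow> 0\<close>.\<close>

lemma minimizer_variation:
  assumes q: "q \<in> L2 L" and min: "\<And>d' q'. q' \<in> L2 L \<Longrightarrow> J d q \<le> J d' q'" and \<phi>: "\<phi> \<in> L2 L"
  shows "0 \<le> (LINT x|Om L. h (q x + \<phi> x) - h (q x))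
    + (LINT x|Om L. (k (d + prim L q x) - F x) * (e + prim L \<phi> x))"
proof -
  define z \<zeta> where "z x = d + prim L q x" and "\<zeta> x = e + prim L \<phi> x" for x
  have z: "continuous_on S z" for S unfolding z_def by (rule continuous_on_affine_prim[OF q])
  have \<zeta>: "continuous_on S \<zeta>" for S unfolding \<zeta>_def by (rule continuous_on_affine_prim[OF \<phi>])
  have q\<phi>: "(\<lambda>x. q x + \<phi> x) \<in> L2 L" by (intro L2_add q \<phi>)
  define t where "t n = inverse (real (Suc n))" for n
  have t: "0 < t n" "t n \<le> 1" for n by (auto simp: t_def field_simps)
  have t0: "t \<longlonglongrightarrow> 0" unfolding t_def by (rule LIMSEQ_inverse_real_of_nat)
  have zt: "continuous_on S (\<lambda>x. z x + t n * \<zeta> x)" for S n by (intro continuous_intros z \<zeta>)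
  have ik: "integrable (Om L) (\<lambda>x. k (z x + t n * \<zeta> x) * \<zeta> x)" for n
    by (intro L2_mult_integrable continuous_on_L2 \<zeta> continuous_on_compose2[OF k_continuous zt]) simp
  have iF: "integrable (Om L) (\<lambda>x. F x * \<zeta> x)"
    by (intro L2_mult_integrable F continuous_on_L2 \<zeta>)
  have step: "0 \<le> (LINT x|Om L. h (q x + \<phi> x) - h (q x)) + (LINT x|Om L. k (z x + t n * \<zeta> x) * \<zeta> x)
      - (LINT x|Om L. F x * \<zeta> x)" for n
  proof -
    let ?q = "\<lambda>x. q x + t n * \<phi> x"
    have q': "?q \<in> L2 L" by (intro L2_add L2_cmult q \<phi>)
    have pz: "(d + t n * e) + prim L ?q x = z x + t n * \<zeta> x" for x
    proof -
      have "prim L ?q x = prim L q x + t n * prim L \<phi> x"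
        using prim_add[OF L2_integrable[OF q] L2_integrable[OF L2_cmult[OF \<phi>]], of "t n" x]
        unfolding prim_cmult .
      then show ?thesis by (simp add: z_def \<zeta>_def distrib_left)
    qed
    have "(LINT x|Om L. h (?q x)) \<le> (LINT x|Om L. h (q x) + t n * (h (q x + \<phi> x) - h (q x)))"
    proof (rule integral_mono)
      show "h (?q x) \<le> h (q x) + t n * (h (q x + \<phi> x) - h (q x))" for x
        using h_segment[of "t n" "q x" "q x + \<phi> x"] t[of n] by simp
    qed (use q q' q\<phi> in \<open>simp_all add: h_integrable\<close>)
    also have "\<dots> = (LINT x|Om L. h (q x)) + t n * (LINT x|Om L. h (q x + \<phi> x) - h (q x))"
      using q q\<phi> by (simp add: h_integrable)
    finally have 1: "(LINT x|Om L. h (?q x)) \<le> \<dots>" .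
    have iz: "integrable (Om L) (\<lambda>x. \<kappa> (z x) - F x * z x)"
      unfolding z_def by (rule reaction_integrable[OF q])
    have "(LINT x|Om L. \<kappa> (z x + t n * \<zeta> x) - F x * (z x + t n * \<zeta> x))
        \<le> (LINT x|Om L. (\<kappa> (z x) - F x * z x) + t n * (k (z x + t n * \<zeta> x) * \<zeta> x - F x * \<zeta> x))"
    proof (rule integral_mono)
      show "integrable (Om L) (\<lambda>x. \<kappa> (z x + t n * \<zeta> x) - F x * (z x + t n * \<zeta> x))"
        unfolding pz[symmetric] by (rule reaction_integrable[OF q'])
      show "integrable (Om L) (\<lambda>x. (\<kappa> (z x) - F x * z x) + t n * (k (z x + t n * \<zeta> x) * \<zeta> x - F x * \<zeta> x))"
        by (rule Bochner_Integration.integrable_add[OF iz]) (use ik iF in simp)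
      fix x
      have "0 \<le> c / 2 * (t n * \<zeta> x)\<^sup>2" using c by simp
      then show "\<kappa> (z x + t n * \<zeta> x) - F x * (z x + t n * \<zeta> x)
          \<le> (\<kappa> (z x) - F x * z x) + t n * (k (z x + t n * \<zeta> x) * \<zeta> x - F x * \<zeta> x)"
        using \<kappa>_tangent[of "z x + t n * \<zeta> x" "z x"] by (simp add: algebra_simps)
    qed
    also have "\<dots> = (LINT x|Om L. \<kappa> (z x) - F x * z x)
        + t n * ((LINT x|Om L. k (z x + t n * \<zeta> x) * \<zeta> x) - (LINT x|Om L. F x * \<zeta> x))"
      using ik iF by (subst Bochner_Integration.integral_add[OF iz]) auto
    finally have 2: "(LINT x|Om L. \<kappa> (z x + t n * \<zeta> x) - F x * (z x + t n * \<zeta> x)) \<le> \<dots>" .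
    have "J d q \<le> J (d + t n * e) ?q" by (rule min[OF q'])
    with 1 2 have "0 \<le> t n * ((LINT x|Om L. h (q x + \<phi> x) - h (q x))
        + (LINT x|Om L. k (z x + t n * \<zeta> x) * \<zeta> x) - (LINT x|Om L. F x * \<zeta> x))"
      unfolding J_def pz by (simp add: algebra_simps z_def)
    then show ?thesis using t[of n] by (simp add: zero_le_mult_iff)
  qed
  have "bounded (z ` {-L..L})" "bounded (\<zeta> ` {-L..L})"
    by (intro compact_imp_bounded compact_continuous_image z \<zeta>; simp)+
  then obtain B1 B2 where B: "\<forall>x\<in>{-L..L}. \<bar>z x\<bar> \<le> B1" "\<forall>x\<in>{-L..L}. \<bar>\<zeta> x\<bar> \<le> B2"
    by (auto simp: bounded_iff)
  have "(\<lambda>n. LINT x|Om L. k (z x + t n * \<zeta> x) * \<zeta> x) \<longlonglongrightarrow> (LINT x|Om L. k (z x) * \<zeta> x)"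
  proof (rule integral_continuous_comp_tendsto[OF k_continuous zt z, where B = "B1 + B2"])
    show "\<bar>z x + t n * \<zeta> x\<bar> \<le> B1 + B2" if "x \<in> {-L..L}" for n x
    proof -
      have "\<bar>t n * \<zeta> x\<bar> \<le> 1 * \<bar>\<zeta> x\<bar>" unfolding abs_mult using t[of n] by (intro mult_right_mono) auto
      then show ?thesis using B that by fastforce
    qed
    show "(\<lambda>n. z x + t n * \<zeta> x) \<longlonglongrightarrow> z x" for x
      using tendsto_add[OF tendsto_const tendsto_mult[OF t0 tendsto_const], of "z x" "\<zeta> x"] by simp
  qed (rule L2_integrable[OF continuous_on_L2[OF \<zeta>]])
  then have "0 \<le> (LINT x|Om L. h (q x + \<phi> x) - h (q x)) + (LINT x|Om L. k (z x) * \<zeta> x)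
      - (LINT x|Om L. F x * \<zeta> x)"
    by (intro LIMSEQ_le_const[OF tendsto_diff[OF tendsto_add[OF tendsto_const]]] tendsto_const)
       (use step in auto)
  moreover have "integrable (Om L) (\<lambda>x. k (z x) * \<zeta> x)"
    by (intro L2_mult_integrable continuous_on_L2 \<zeta> continuous_on_compose2[OF k_continuous z]) simp
  ultimately show ?thesis using iF unfolding z_def \<zeta>_def by (simp add: left_diff_distrib)
qed

text \<open>The flux \<open>H\<close>, an indefinite integral vanishing at both ends, determines the gradient of the
  solution through \<open>\<beta>\<close>; so the solution is \<open>C\<^sup>1\<close> with Neumann boundary values.\<close>

lemma solution_exists:
  obtains d r where "r \<in> L2 L" "prim L r L = 0"
    "AE x in Om L. r x = k (d + prim L (\<lambda>y. \<beta> (prim L r y)) x) - F x"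
proof -
  obtain d q where q: "q \<in> L2 L" and min: "\<And>d' q'. q' \<in> L2 L \<Longrightarrow> J d q \<le> J d' q'"
    using J_has_minimizer by metis
  define r where "r x = k (d + prim L q x) - F x" for x
  have r: "r \<in> L2 L" unfolding r_def by (intro k_comp_minus_F_L2 continuous_on_affine_prim q)
  have var: "0 \<le> (LINT x|Om L. h (q x + \<phi> x) - h (q x)) + (LINT x|Om L. r x * (e + prim L \<phi> x))"
    if "\<phi> \<in> L2 L" for \<phi> e
    unfolding r_def by (rule minimizer_variation[OF q min that])
  have "0 \<le> (LINT x|Om L. r x) * e" for e
    using var[OF L2_const[of 0 L], of e] by (simp add: prim_def)
  from this[of 1] this[of "-1"] have rL: "prim L r L = 0" by (simp add: prim_right)
  have "AE x in Om L. subgrad h (q x) (prim L r x)"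
  proof (rule AE_subgrad_if_integrated[OF q continuous_on_prim[OF L2_integrable[OF r]]])
    fix \<phi> assume \<phi>: "\<phi> \<in> L2 L"
    have "(LINT x|Om L. r x * (0 + prim L \<phi> x)) = - (LINT x|Om L. prim L r x * \<phi> x)"
      by (rule integral_by_parts[OF L2_integrable[OF \<phi>] L2_integrable[OF r] rL])
    then have "0 \<le> (LINT x|Om L. h (q x + \<phi> x) - h (q x)) - (LINT x|Om L. prim L r x * \<phi> x)"
      using var[OF \<phi>, of 0] by simp
    also have "\<dots> = (LINT x|Om L. h (q x + \<phi> x) - h (q x) - prim L r x * \<phi> x)"
      using affine_prim_L2[OF r, of 0] q \<phi>
      by (intro Bochner_Integration.integral_diff[symmetric] Bochner_Integration.integrable_diff
        h_integrable L2_add L2_mult_integrable) auto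
    finally show "0 \<le> (LINT x|Om L. h (q x + \<phi> x) - h (q x) - prim L r x * \<phi> x)" .
  qed
  then have "AE x in Om L. q x = \<beta> (prim L r x)"
    by eventually_elim (rule subgrad_unique[OF subgrad_h_imp_f])
  then have "prim L q x = prim L (\<lambda>y. \<beta> (prim L r y)) x" for x
    by (rule prim_cong_AE)
       (use L2_meas[OF q] \<beta>_prim_continuous[OF L2_integrable[OF r]] in
         \<open>auto intro!: continuous_on_borel_measurable_Om\<close>)
  then show ?thesis by (intro that[OF r rL, of d]) (simp add: r_def)
qed

end

section \<open>Weak limits through convex combinations\<close>

text \<open>Closure under midpoints is all the convexity that the parallelogram law uses, and it gives a simple
  induction principle for convex conditions.\<close>

inductive_set midhull :: "(real \<Rightarrow> real) set \<Rightarrow> (real \<Rightarrow> real) set" for A where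
  base: "a \<in> A \<Longrightarrow> a \<in> midhull A"
| mid: "a \<in> midhull A \<Longrightarrow> b \<in> midhull A \<Longrightarrow> (\<lambda>x. (a x + b x) / 2) \<in> midhull A"

lemma midhull_mono: "A \<subseteq> B \<Longrightarrow> a \<in> midhull A \<Longrightarrow> a \<in> midhull B"
  by (rotate_tac 1, induction rule: midhull.induct) (auto intro: midhull.intros)

lemma midhull_L2: "a \<in> midhull A \<Longrightarrow> A \<subseteq> L2 L \<Longrightarrow> a \<in> L2 L"
proof (induction rule: midhull.induct)
  case (mid a b)
  then show ?case using L2_cmult[OF L2_add[of a L b], of "1/2"] by simp
qed auto

lemma sqn_parallelogram:
  assumes "u \<in> L2 L" "v \<in> L2 L"
  shows "sqn L (\<lambda>x. u x - v x) = 2 * sqn L u + 2 * sqn L v - 4 * sqn L (\<lambda>x. (u x + v x) / 2)"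
proof -
  have "sqn L (\<lambda>x. u x - v x) + 4 * sqn L (\<lambda>x. (u x + v x) / 2)
      = (LINT x|Om L. (u x - v x)\<^sup>2 + 4 * ((u x + v x) / 2)\<^sup>2)"
    using L2_sq[OF L2_diff[OF assms]] L2_sq[OF L2_cmult[OF L2_add[OF assms], of "1/2"]] by simp
  also have "\<dots> = (LINT x|Om L. 2 * (u x)\<^sup>2 + 2 * (v x)\<^sup>2)"
    by (intro Bochner_Integration.integral_cong) (auto simp: power2_eq_square field_simps)
  also have "\<dots> = 2 * sqn L u + 2 * sqn L v"
    using assms by (simp add: L2_sq)
  finally show ?thesis by simp
qed

text \<open>Mazur's lemma: elements of almost minimal norm in the midpoint
  hulls of the tails form a Cauchy sequence by the parallelogram law. This replaces weak
  compactness, since every closed convex condition satisfied by the tails passes to the limit.\<close>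

lemma mazur:
  assumes L: "0 < L" and r: "\<And>n. r n \<in> L2 L" and bd: "\<And>n. sqn L (r n) \<le> C"
  obtains \<rho> l where "\<And>k. \<rho> k \<in> midhull (r ` {k..})" "l \<in> L2 L"
    "(\<lambda>k. sqn L (\<lambda>x. \<rho> k x - l x)) \<longlonglongrightarrow> 0" "AE x in Om L. (\<lambda>k. \<rho> k x) \<longlonglongrightarrow> l x"
proof -
  define M where "M k = midhull (r ` {k..})" for k :: nat
  have ML2: "a \<in> L2 L" if "a \<in> M k" for a k
    using that midhull_L2[of a "r ` {k..}" L] r by (auto simp: M_def)
  have Mmono: "a \<in> M i" if "i \<le> j" "a \<in> M j" for a i j
  proof -
    have "r ` {j..} \<subseteq> r ` {i..}" using that by (intro image_mono) auto
    then show ?thesis using that midhull_mono unfolding M_def by blast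
  qed
  have rM: "r k \<in> M k" for k by (auto simp: M_def intro: midhull.base)
  define a where "a k = Inf (sqn L ` M k)" for k
  have bdd: "bdd_below (sqn L ` M k)" for k
    by (rule bdd_belowI[of _ 0]) auto
  have low: "a k \<le> sqn L \<eta>" if "\<eta> \<in> M k" for k \<eta>
    unfolding a_def by (rule cInf_lower[OF _ bdd]) (use that in auto)
  have inc: "incseq a"
    unfolding a_def incseq_def
  proof (intro allI impI cInf_superset_mono bdd)
    fix m n :: nat assume "m \<le> n"
    then show "sqn L ` M n \<subseteq> sqn L ` M m" using Mmono by blast
    show "sqn L ` M n \<noteq> {}" using rM by blast
  qed
  have "a k \<le> C" for k using low[OF rM] bd by (rule order_trans)
  then obtain A where A: "a \<longlonglongrightarrow> A" "\<And>k. a k \<le> A"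
    using incseq_convergent[OF inc, of C] by auto
  have "\<exists>\<eta>\<in>M k. sqn L \<eta> < a k + inverse (real (Suc k))" for k
  proof -
    have "Inf (sqn L ` M k) < a k + inverse (real (Suc k))" by (simp add: a_def)
    from cInf_lessD[OF _ this] rM show ?thesis by auto
  qed
  then obtain \<rho> where \<rho>: "\<And>k. \<rho> k \<in> M k" "\<And>k. sqn L (\<rho> k) < a k + inverse (real (Suc k))" by metis
  have \<rho>L: "\<rho> k \<in> L2 L" for k using ML2 \<rho> by blast
  have combine: "d \<le> 2 * (t - ai) + 4 * u"
    if "ai \<le> m" "v \<le> u" "d = 2 * x + 2 * y - 4 * m" "x < ai + u" "y < aj + v" "aj \<le> t"
    for d t ai aj m u v x y :: real
    using that by (simp add: field_simps)
  have est: "sqn L (\<lambda>x. \<rho> i x - \<rho> j x) \<le> 2 * (A - a i) + 4 * inverse (real (Suc i))" if "i \<le> j" for i j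
  proof -
    have "(\<lambda>x. (\<rho> i x + \<rho> j x) / 2) \<in> M i"
      using \<rho>(1)[of i] Mmono[OF that \<rho>(1)] by (auto simp: M_def intro: midhull.mid)
    then have "a i \<le> sqn L (\<lambda>x. (\<rho> i x + \<rho> j x) / 2)" by (rule low)
    moreover have "inverse (real (Suc j)) \<le> inverse (real (Suc i))"
      using that by (intro le_imp_inverse_le) auto
    ultimately show ?thesis
      using sqn_parallelogram[OF \<rho>L \<rho>L, of i j] \<rho>(2)[of i] \<rho>(2)[of j] A(2)[of j] by (rule combine)
  qed
  have b0: "(\<lambda>i. 2 * (A - a i) + 4 * inverse (real (Suc i))) \<longlonglongrightarrow> 2 * (A - A) + 4 * 0"
    by (intro tendsto_intros A LIMSEQ_inverse_real_of_nat)
  have Cau: "\<exists>N. \<forall>i\<ge>N. \<forall>j\<ge>N. sqn L (\<lambda>x. \<rho> i x - \<rho> j x) < e" if "0 < e" for e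
  proof -
    have "\<forall>\<^sub>F i in sequentially. 2 * (A - a i) + 4 * inverse (real (Suc i)) < e"
      using order_tendstoD(2)[OF b0, of e] that by simp
    then obtain N where N: "\<And>i. i \<ge> N \<Longrightarrow> 2 * (A - a i) + 4 * inverse (real (Suc i)) < e"
      by (auto simp: eventually_sequentially)
    have "sqn L (\<lambda>x. \<rho> i x - \<rho> j x) < e" if "i \<ge> N" "j \<ge> N" for i j
    proof (cases "i \<le> j")
      case True
      show ?thesis using est[OF True] N[OF that(1)] by linarith
    next
      case False
      then have "sqn L (\<lambda>x. \<rho> j x - \<rho> i x) < e" using est[of j i] N[OF that(2)] by linarith
      then show ?thesis by (simp add: power2_commute)
    qed
    then show ?thesis by blast
  qed
  obtain l s where l: "l \<in> L2 L" "(\<lambda>n. sqn L (\<lambda>x. \<rho> n x - l x)) \<longlonglongrightarrow> 0"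
    "strict_mono s" "AE x in Om L. (\<lambda>n. \<rho> (s n) x) \<longlonglongrightarrow> l x"
    by (rule L2_complete[OF L \<rho>L Cau])
  show ?thesis
  proof (rule that[of "\<lambda>k. \<rho> (s k)" l])
    show "\<rho> (s k) \<in> midhull (r ` {k..})" for k
      using Mmono[OF seq_suble[OF l(3)] \<rho>(1)] by (simp add: M_def)
    show "(\<lambda>k. sqn L (\<lambda>x. \<rho> (s k) x - l x)) \<longlonglongrightarrow> 0"
      using LIMSEQ_subseq_LIMSEQ[OF l(2,3)] by (simp add: o_def)
  qed (use l in auto)
qed

lemma midhull_prim_bounds:
  assumes "\<rho> \<in> midhull A" "A \<subseteq> L2 L" "\<And>a. a \<in> A \<Longrightarrow> \<bar>prim L a x - y\<bar> \<le> e"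
  shows "\<bar>prim L \<rho> x - y\<bar> \<le> e"
  using assms(1)
proof induction
  case (mid a b)
  have "prim L (\<lambda>x. (a x + b x) / 2) x = (prim L a x + prim L b x) / 2"
    using prim_cmult[of L "1/2" "\<lambda>x. a x + b x" x]
      prim_add[OF L2_integrable[OF midhull_L2[OF mid(1) assms(2)]] L2_integrable[OF midhull_L2[OF mid(2) assms(2)]], of x]
    by simp
  then show ?case using mid by (simp add: abs_if split: if_splits)
qed (rule assms(3))

lemma midhull_prim_tendsto:
  assumes r: "\<And>n. r n \<in> L2 L" and lim: "(\<lambda>n. prim L (r n) x) \<longlonglongrightarrow> y"
    and \<rho>: "\<And>k. \<rho> k \<in> midhull (r ` {k..})"
  shows "(\<lambda>k. prim L (\<rho> k) x) \<longlonglongrightarrow> y"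
proof (rule LIMSEQ_I)
  fix e :: real assume e: "0 < e"
  obtain N where N: "\<And>n. n \<ge> N \<Longrightarrow> \<bar>prim L (r n) x - y\<bar> < e / 2"
    using LIMSEQ_D[OF lim, of "e / 2"] e by auto
  have "\<bar>prim L (\<rho> k) x - y\<bar> \<le> e / 2" if "k \<ge> N" for k
    by (rule midhull_prim_bounds[OF \<rho>]) (use r N that in \<open>auto intro: less_imp_le\<close>)
  then show "\<exists>no. \<forall>n\<ge>no. norm (prim L (\<rho> n) x - y) < e"
    using e by (intro exI[of _ N]) force
qed

lemma prim_tendsto:
  assumes L: "0 < L" and \<rho>: "\<And>k. \<rho> k \<in> L2 L" "l \<in> L2 L"
    and lim: "(\<lambda>k. sqn L (\<lambda>x. \<rho> k x - l x)) \<longlonglongrightarrow> 0"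
  shows "(\<lambda>k. prim L (\<rho> k) x) \<longlonglongrightarrow> prim L l x"
  using affine_prim_tendsto(1)[OF L \<rho> lim tendsto_const, of 0 x] by simp

text \<open>The \<open>L\<^sup>2\<close> bound excludes concentration in the limit: \<open>prim\<close> is linear, so the pointwise limit is also
  that of the convex combinations supplied by Mazur's lemma, whose densities converge strongly.\<close>

lemma prim_closed:
  assumes L: "0 < L" and q: "\<And>n. q n \<in> L2 L" and bd: "\<And>n. sqn L (q n) \<le> C"
    and lim: "\<And>x. x \<in> {-L..L} \<Longrightarrow> (\<lambda>n. c n + prim L (q n) x) \<longlonglongrightarrow> y x"
  obtains l where "l \<in> L2 L" "\<And>x. x \<in> {-L..L} \<Longrightarrow> y x = y (-L) + prim L l x"
proof -
  obtain \<rho> l where l: "\<And>k. \<rho> k \<in> midhull (q ` {k..})" "l \<in> L2 L"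
    "(\<lambda>k. sqn L (\<lambda>x. \<rho> k x - l x)) \<longlonglongrightarrow> 0" "AE x in Om L. (\<lambda>k. \<rho> k x) \<longlonglongrightarrow> l x"
    by (rule mazur[where r = q and C = C, OF L q bd]) (rule that)
  have \<rho>: "\<rho> k \<in> L2 L" for k using midhull_L2[OF l(1)] q by blast
  have "c \<longlonglongrightarrow> y (-L)" using lim[of "-L"] L by (simp add: prim_left)
  show ?thesis
  proof (rule that[OF l(2)])
    fix x assume x: "x \<in> {-L..L}"
    have "(\<lambda>n. (c n + prim L (q n) x) - c n) \<longlonglongrightarrow> y x - y (-L)"
      by (intro tendsto_diff lim[OF x] \<open>c \<longlonglongrightarrow> y (-L)\<close>)
    then have "(\<lambda>n. prim L (q n) x) \<longlonglongrightarrow> y x - y (-L)" by simp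
    from midhull_prim_tendsto[OF q this l(1)] prim_tendsto[OF L \<rho> l(2,3), of x]
    show "y x = y (-L) + prim L l x" using LIMSEQ_unique by fastforce
  qed
qed

section \<open>Lipschitz functions of an indefinite integral\<close>

text \<open>On a short interval the mean value theorem replaces \<open>\<phi> \<circ> prim L r\<close> by a linear function of
  \<open>prim L r\<close>; the error is the oscillation of \<open>\<phi>'\<close> times the variation of \<open>prim L r\<close>.\<close>

lemma C1_chain_increment:
  assumes r: "integrable (Om L) r" and ab: "-L \<le> a" "a \<le> b" "b \<le> L"
    and d: "\<And>s. (\<phi> has_real_derivative \<phi>' s) (at s)" and \<phi>': "continuous_on UNIV \<phi>'"
    and osc: "\<And>s y. y \<in> {a..b} \<Longrightarrow> \<bar>s - prim L r y\<bar> < \<eta> \<Longrightarrow> \<bar>\<phi>' s - \<phi>' (prim L r y)\<bar> \<le> e"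
    and near: "\<And>y y'. y \<in> {a..b} \<Longrightarrow> y' \<in> {a..b} \<Longrightarrow> \<bar>prim L r y - prim L r y'\<bar> < \<eta> / 2"
  shows "\<bar>(\<phi> (prim L r b) - \<phi> (prim L r a))
      - (prim L (\<lambda>y. \<phi>' (prim L r y) * r y) b - prim L (\<lambda>y. \<phi>' (prim L r y) * r y) a)\<bar>
    \<le> e * (prim L (\<lambda>y. \<bar>r y\<bar>) b - prim L (\<lambda>y. \<bar>r y\<bar>) a)"
proof -
  let ?H = "prim L r"
  obtain s where s: "\<phi> (?H b) - \<phi> (?H a) = \<phi>' s * (?H b - ?H a)" "\<bar>s - ?H a\<bar> \<le> \<bar>?H b - ?H a\<bar>"
  proof (cases "?H a" "?H b" rule: linorder_cases)
    case less
    from MVT2[OF less d] obtain z where "?H a < z" "z < ?H b" "\<phi> (?H b) - \<phi> (?H a) = (?H b - ?H a) * \<phi>' z"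
      by blast
    then show ?thesis by (intro that[of z]) (auto simp: algebra_simps)
  next
    case equal
    then show ?thesis using that[of "?H a"] by simp
  next
    case greater
    from MVT2[OF greater d] obtain z where "?H b < z" "z < ?H a" "\<phi> (?H a) - \<phi> (?H b) = (?H a - ?H b) * \<phi>' z"
      by blast
    then show ?thesis by (intro that[of z]) (auto simp: algebra_simps)
  qed
  have c: "continuous_on S (\<lambda>y. \<phi>' (?H y))" for S
    by (rule continuous_on_compose2[OF \<phi>' continuous_on_prim[OF r]]) simp
  have "bounded ((\<lambda>y. \<phi>' (?H y)) ` {-L..L})"
    by (intro compact_imp_bounded compact_continuous_image c) simp
  then obtain K where K: "\<forall>y\<in>{-L..L}. \<bar>\<phi>' (?H y)\<bar> \<le> K" by (auto simp: bounded_iff)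
  have i: "integrable (Om L) (\<lambda>y. \<phi>' (?H y) * r y)"
    by (rule integrable_mult_AE_bounded[where C = K, OF r continuous_on_borel_measurable_Om[OF c]])
       (use K in auto)
  let ?I = "indicator {a<..b} :: real \<Rightarrow> real"
  note ii = integrable_indicator_Om[of L _ "{a<..b}"]
  have eq: "(\<phi> (?H b) - \<phi> (?H a)) - (prim L (\<lambda>y. \<phi>' (?H y) * r y) b - prim L (\<lambda>y. \<phi>' (?H y) * r y) a)
      = (LINT y|Om L. \<phi>' s * (?I y * r y) - ?I y * (\<phi>' (?H y) * r y))"
    unfolding s(1) prim_increment[OF r ab(2)] prim_increment[OF i ab(2)]
    using ii[OF r] ii[OF i] by simp
  have "\<bar>LINT y|Om L. \<phi>' s * (?I y * r y) - ?I y * (\<phi>' (?H y) * r y)\<bar> \<le> (LINT y|Om L. \<bar>\<phi>' s * (?I y * r y) - ?I y * (\<phi>' (?H y) * r y)\<bar>)"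
    using integral_norm_bound[of "Om L" "\<lambda>y. \<phi>' s * (?I y * r y) - ?I y * (\<phi>' (?H y) * r y)"] by simp
  also have "\<dots> \<le> (LINT y|Om L. e * (?I y * \<bar>r y\<bar>))"
  proof (rule integral_mono)
    show "integrable (Om L) (\<lambda>y. \<bar>\<phi>' s * (?I y * r y) - ?I y * (\<phi>' (?H y) * r y)\<bar>)"
      using ii[OF r] ii[OF i] by simp
    show "integrable (Om L) (\<lambda>y. e * (?I y * \<bar>r y\<bar>))"
      using ii[of "\<lambda>y. \<bar>r y\<bar>"] r by simp
    fix y
    show "\<bar>\<phi>' s * (?I y * r y) - ?I y * (\<phi>' (?H y) * r y)\<bar> \<le> e * (?I y * \<bar>r y\<bar>)"
    proof (cases "y \<in> {a<..b}")
      case True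
      have "\<bar>s - ?H y\<bar> < \<eta>"
      proof -
        have "\<bar>?H b - ?H a\<bar> < \<eta> / 2" "\<bar>?H a - ?H y\<bar> < \<eta> / 2" using near[of b a] near[of a y] True ab by simp_all
        then show ?thesis using s(2) by linarith
      qed
      then have "\<bar>\<phi>' s - \<phi>' (?H y)\<bar> \<le> e" using osc True by auto
      then have "\<bar>(\<phi>' s - \<phi>' (?H y)) * r y\<bar> \<le> e * \<bar>r y\<bar>"
        unfolding abs_mult by (rule mult_right_mono) simp
      then show ?thesis using True by (simp add: left_diff_distrib)
    qed simp
  qed
  also have "\<dots> = e * (prim L (\<lambda>y. \<bar>r y\<bar>) b - prim L (\<lambda>y. \<bar>r y\<bar>) a)"
    using prim_increment[of L "\<lambda>y. \<bar>r y\<bar>" a b] r ab by simp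
  finally show ?thesis unfolding eq .
qed

text \<open>The chain rule, by summing the increments over a fine partition.\<close>

lemma C1_chain:
  assumes r: "integrable (Om L) r" and x: "x \<in> {-L..L}"
    and d: "\<And>s. (\<phi> has_real_derivative \<phi>' s) (at s)" and \<phi>': "continuous_on UNIV \<phi>'"
  shows "\<phi> (prim L r x) = \<phi> 0 + prim L (\<lambda>y. \<phi>' (prim L r y) * r y) x"
proof -
  define E R where "E y = \<phi> (prim L r y) - prim L (\<lambda>y. \<phi>' (prim L r y) * r y) y"
    and "R y = prim L (\<lambda>y. \<bar>r y\<bar>) y" for y
  have "\<bar>E x - E (-L)\<bar> \<le> e * (R x - R (-L))" if e: "0 < e" for e
  proof -
    define B where "B = (LINT y|Om L. \<bar>r y\<bar>) + 1"
    have "uniformly_continuous_on {-B..B} \<phi>'"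
      by (intro compact_uniformly_continuous continuous_on_subset[OF \<phi>']) auto
    then obtain \<eta>0 where \<eta>0: "0 < \<eta>0" "\<And>s t. s \<in> {-B..B} \<Longrightarrow> t \<in> {-B..B} \<Longrightarrow> \<bar>s - t\<bar> < \<eta>0 \<Longrightarrow> \<bar>\<phi>' s - \<phi>' t\<bar> < e"
      using e unfolding uniformly_continuous_on_def dist_real_def by metis
    define \<eta> where "\<eta> = min \<eta>0 1"
    have \<eta>: "0 < \<eta>" "\<eta> \<le> \<eta>0" "\<eta> \<le> 1" using \<eta>0 by (auto simp: \<eta>_def)
    have osc: "\<bar>\<phi>' s - \<phi>' (prim L r y)\<bar> \<le> e" if "\<bar>s - prim L r y\<bar> < \<eta>" for s y
    proof (rule less_imp_le, rule \<eta>0(2))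
      have "\<bar>prim L r y\<bar> \<le> B - 1" using abs_prim_le[OF r] by (simp add: B_def)
      then show "s \<in> {-B..B}" "prim L r y \<in> {-B..B}" using that \<eta> by auto
    qed (use that \<eta> in linarith)
    have "uniformly_continuous_on {-L..L} (prim L r)"
      by (intro compact_uniformly_continuous continuous_on_prim r) auto
    then obtain d0 where d0: "0 < d0" "\<And>y y'. y \<in> {-L..L} \<Longrightarrow> y' \<in> {-L..L} \<Longrightarrow> \<bar>y - y'\<bar> < d0 \<Longrightarrow> \<bar>prim L r y - prim L r y'\<bar> < \<eta> / 2"
      using \<eta>(1) unfolding uniformly_continuous_on_def dist_real_def by (metis half_gt_zero)
    obtain n :: nat where n: "(x + L) / d0 < real n" using reals_Archimedean2 by blast
    have "0 \<le> (x + L) / d0" using x d0(1) by auto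
    then have n0: "n \<noteq> 0" using n by linarith
    define p where "p i = -L + real i * ((x + L) / real n)" for i
    have dn: "0 \<le> (x + L) / real n" "(x + L) / real n < d0"
      using n n0 x d0(1) by (auto simp: field_simps)
    have p: "-L \<le> p i" "p i \<le> p (Suc i)" "p (Suc i) - p i < d0" for i
    proof -
      have "0 \<le> real i * ((x + L) / real n)" using dn by (intro mult_nonneg_nonneg) auto
      moreover have "p (Suc i) = p i + (x + L) / real n" by (simp add: p_def distrib_right add_divide_distrib)
      ultimately show "-L \<le> p i" "p i \<le> p (Suc i)" "p (Suc i) - p i < d0"
        using dn by (auto simp: p_def)
    qed
    have pn: "p n = x" using n0 by (simp add: p_def)
    have px: "p i \<le> x" if "i \<le> n" for i
    proof -
      have "real i * ((x + L) / real n) \<le> real n * ((x + L) / real n)"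
        using that dn by (intro mult_right_mono) auto
      then show ?thesis using n0 by (simp add: p_def)
    qed
    have "\<bar>E (p i) - E (-L)\<bar> \<le> e * (R (p i) - R (-L))" if "i \<le> n" for i
      using that
    proof (induction i)
      case 0
      then show ?case by (simp add: p_def)
    next
      case (Suc i)
      have pL: "p (Suc i) \<le> L" using px[OF Suc.prems] x by simp
      have "\<bar>(\<phi> (prim L r (p (Suc i))) - \<phi> (prim L r (p i)))
          - (prim L (\<lambda>y. \<phi>' (prim L r y) * r y) (p (Suc i)) - prim L (\<lambda>y. \<phi>' (prim L r y) * r y) (p i))\<bar>
          \<le> e * (R (p (Suc i)) - R (p i))"
        unfolding R_def
      proof (rule C1_chain_increment[OF r p(1) p(2) pL d \<phi>' osc])
        fix y y' assume y: "y \<in> {p i..p (Suc i)}" "y' \<in> {p i..p (Suc i)}"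
        show "\<bar>prim L r y - prim L r y'\<bar> < \<eta> / 2"
          by (rule d0(2)) (use y p[of i] pL in \<open>auto simp: abs_less_iff\<close>)
      qed
      then have "\<bar>E (p (Suc i)) - E (p i)\<bar> \<le> e * (R (p (Suc i)) - R (p i))"
        by (simp add: E_def algebra_simps)
      moreover have "\<bar>E (p i) - E (-L)\<bar> \<le> e * (R (p i) - R (-L))" using Suc by simp
      moreover have "e * (R (p (Suc i)) - R (-L)) = e * (R (p (Suc i)) - R (p i)) + e * (R (p i) - R (-L))"
        by (simp add: algebra_simps)
      ultimately show ?case by linarith
    qed
    from this[of n] show ?thesis by (simp add: pn)
  qed
  note small = this
  have "\<bar>E x - E (-L)\<bar> \<le> 0"
  proof (rule field_le_epsilon)
    fix e :: real assume e: "0 < e"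
    define D where "D = \<bar>R x - R (-L)\<bar> + 1"
    have "\<bar>E x - E (-L)\<bar> \<le> e / D * (R x - R (-L))" by (rule small) (use e in \<open>simp add: D_def\<close>)
    also have "\<dots> \<le> e / D * D" using e by (intro mult_left_mono) (auto simp: D_def)
    finally show "\<bar>E x - E (-L)\<bar> \<le> 0 + e" by (simp add: D_def)
  qed
  then show ?thesis by (simp add: E_def prim_left)
qed

context diffusion
begin

text \<open>The Legendre transform of \<open>h\<close> is a primitive of \<open>\<beta>\<close>.\<close>

definition conj_h :: "real \<Rightarrow> real" where "conj_h s = s * \<beta> s - h (\<beta> s)"

lemma conj_h_tangent: "conj_h s + \<beta> s * (t - s) \<le> conj_h t"
  using subgrad_f_imp_h[OF subgrad_\<beta>[of t], unfolded subgrad_def, THEN spec, of "\<beta> s"]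
  by (simp add: conj_h_def algebra_simps)

lemma conj_h_deriv: "(conj_h has_real_derivative \<beta> s) (at s)"
proof -
  have quot: "norm ((conj_h t - conj_h s) / (t - s) - \<beta> s) \<le> norm (t - s) * (1 / \<nu>\<^sup>2)" if "t \<noteq> s" for t
  proof -
    let ?A = "conj_h t - conj_h s - \<beta> s * (t - s)"
    have "0 \<le> ?A" "?A \<le> (\<beta> t - \<beta> s) * (t - s)"
      using conj_h_tangent[of s t] conj_h_tangent[of t s] by (simp_all add: algebra_simps)
    then have "\<bar>?A\<bar> \<le> \<bar>\<beta> t - \<beta> s\<bar> * \<bar>t - s\<bar>"
      using abs_ge_self[of "(\<beta> t - \<beta> s) * (t - s)"] by (simp add: abs_mult)
    also have "\<dots> \<le> (\<bar>t - s\<bar> / \<nu>\<^sup>2) * \<bar>t - s\<bar>" by (intro mult_right_mono \<beta>_lipschitz) simp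
    finally have "\<bar>?A\<bar> / \<bar>t - s\<bar> \<le> \<bar>t - s\<bar> / \<nu>\<^sup>2" using that by (simp add: divide_le_eq)
    moreover have "(conj_h t - conj_h s) / (t - s) - \<beta> s = ?A / (t - s)" using that by (simp add: field_simps)
    ultimately show ?thesis by simp
  qed
  have "((\<lambda>t. (conj_h t - conj_h s) / (t - s)) \<longlongrightarrow> \<beta> s) (at s)"
  proof (rule LIM_zero_cancel, rule tendsto_0_le[where K = "1 / \<nu>\<^sup>2"])
    show "((\<lambda>t. t - s) \<longlongrightarrow> 0) (at s)"
      using tendsto_diff[OF tendsto_ident_at tendsto_const, of s s UNIV] by simp
    show "\<forall>\<^sub>F t in at s. norm ((conj_h t - conj_h s) / (t - s) - \<beta> s) \<le> norm (t - s) * (1 / \<nu>\<^sup>2)"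
      using quot by (auto simp: eventually_at intro!: exI[of _ 1])
  qed
  then show ?thesis by (simp add: has_field_derivative_iff)
qed

text \<open>Regularity of the gradient: the difference quotients of \<open>conj_h\<close> are \<open>C\<^sup>1\<close> approximations of
  \<open>\<beta>\<close> with the same Lipschitz constant.\<close>

lemma \<beta>_prim_is_prim:
  assumes L: "0 < L" and r: "r \<in> L2 L"
  obtains l where "l \<in> L2 L" "\<And>x. x \<in> {-L..L} \<Longrightarrow> \<beta> (prim L r x) = prim L l x"
proof -
  define t where "t n = inverse (real (Suc n))" for n
  have t: "0 < t n" for n by (simp add: t_def)
  have t0: "t \<longlonglongrightarrow> 0" unfolding t_def by (rule LIMSEQ_inverse_real_of_nat)
  define b b' where "b n s = (conj_h (s + t n) - conj_h s) / t n"
    and "b' n s = (\<beta> (s + t n) - \<beta> s) / t n" for n s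
  have db: "(b n has_real_derivative b' n s) (at s)" for n s
  proof -
    have "((\<lambda>s. conj_h (s + t n)) has_real_derivative \<beta> (s + t n)) (at s)"
      using conj_h_deriv DERIV_shift by blast
    then show ?thesis
      unfolding b_def b'_def by (intro DERIV_cdivide DERIV_diff conj_h_deriv)
  qed
  have b'_cont: "continuous_on S (b' n)" for S n
    unfolding b'_def
    by (intro continuous_on_divide continuous_on_diff continuous_on_const \<beta>_continuous
        continuous_on_compose2[OF \<beta>_continuous[of UNIV]] continuous_on_add continuous_on_id)
      (use t in \<open>auto simp: less_imp_neq[symmetric]\<close>)
  have b'_bd: "\<bar>b' n s\<bar> \<le> 1 / \<nu>\<^sup>2" for n s
    using \<beta>_lipschitz[of "s + t n" s] t[of n] by (simp add: b'_def abs_divide divide_le_eq)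
  have b_lim: "(\<lambda>n. b n s) \<longlonglongrightarrow> \<beta> s" for s
  proof -
    have "((\<lambda>u. (conj_h (s + u) - conj_h s) / u) \<longlongrightarrow> \<beta> s) (at 0)"
      using conj_h_deriv[of s] by (simp add: DERIV_def)
    moreover have "filterlim t (at 0) sequentially"
      using t0 t by (auto simp: filterlim_at less_imp_neq[symmetric])
    ultimately show ?thesis unfolding b_def by (rule filterlim_compose)
  qed
  define q where "q n y = b' n (prim L r y) * r y" for n y
  note ri = L2_integrable[OF r]
  have qm: "(\<lambda>y. b' n (prim L r y)) \<in> borel_measurable (Om L)" for n
    by (intro continuous_on_borel_measurable_Om continuous_on_compose2[OF b'_cont[of UNIV] continuous_on_prim[OF ri]]) simp
  have q: "q n \<in> L2 L" for n
    unfolding q_def by (rule L2_mult_bounded[OF r qm]) (use b'_bd in auto)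
  have qbd: "sqn L (q n) \<le> sqn L (\<lambda>y. (1 / \<nu>\<^sup>2) * r y)" for n
  proof (rule integral_mono[OF L2_sq[OF q] L2_sq[OF L2_cmult[OF r]]])
    fix y
    have "\<bar>q n y\<bar> \<le> 1 / \<nu>\<^sup>2 * \<bar>r y\<bar>"
      unfolding q_def abs_mult by (rule mult_right_mono[OF b'_bd]) simp
    also have "\<dots> = \<bar>(1 / \<nu>\<^sup>2) * r y\<bar>" by (simp add: abs_mult)
    finally show "(q n y)\<^sup>2 \<le> ((1 / \<nu>\<^sup>2) * r y)\<^sup>2" by (simp only: abs_le_square_iff)
  qed
  have lim: "(\<lambda>n. b n 0 + prim L (q n) x) \<longlonglongrightarrow> \<beta> (prim L r x)" if x: "x \<in> {-L..L}" for x
    using b_lim[of "prim L r x"] C1_chain[OF ri x db b'_cont] by (simp add: q_def[abs_def])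
  obtain l where l: "l \<in> L2 L" "\<And>x. x \<in> {-L..L} \<Longrightarrow> \<beta> (prim L r x) = \<beta> (prim L r (-L)) + prim L l x"
    using prim_closed[where y = "\<lambda>x. \<beta> (prim L r x)", OF L q qbd lim] by blast
  then show ?thesis by (intro that[OF l(1)]) (simp add: prim_left \<beta>_0)
qed

end

section \<open>The obstacle problem by penalisation\<close>

lemma pos_part_power_deriv:
  fixes u :: real
  shows "((\<lambda>u. (max 0 u) ^ Suc (Suc m)) has_real_derivative real (Suc (Suc m)) * (max 0 u) ^ Suc m) (at u)"
proof -
  consider "u < 0" | "u = 0" | "0 < u" by linarith
  then show ?thesis
  proof cases
    case 1
    have "((\<lambda>u. 0) has_real_derivative 0) (at u)" by simp
    then have "((\<lambda>u. (max 0 u) ^ Suc (Suc m)) has_real_derivative 0) (at u)"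
      by (rule has_field_derivative_transform_within_open[where S = "{..<0}"]) (use 1 in auto)
    then show ?thesis using 1 by (simp add: max_def)
  next
    case 2
    have "((\<lambda>h::real. (max 0 h) ^ Suc (Suc m) / h) \<longlongrightarrow> 0) (at 0)"
    proof (rule tendsto_0_le[where f = "\<lambda>h::real. \<bar>h\<bar> ^ Suc m" and K = 1])
      have "((\<lambda>h::real. \<bar>h\<bar> ^ Suc m) \<longlongrightarrow> \<bar>0\<bar> ^ Suc m) (at 0)" by (intro tendsto_intros)
      then show "((\<lambda>h::real. \<bar>h\<bar> ^ Suc m) \<longlongrightarrow> 0) (at 0)" by simp
      have "norm ((max 0 h) ^ Suc (Suc m) / h) \<le> norm (\<bar>h\<bar> ^ Suc m) * 1" for h :: real
        by (cases "0 < h") (auto simp: max_def)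
      then show "\<forall>\<^sub>F h in at 0. norm ((max 0 h) ^ Suc (Suc m) / h) \<le> norm (\<bar>h\<bar> ^ Suc m :: real) * 1"
        by (intro always_eventually) blast
    qed
    then show ?thesis using 2 by (simp add: has_field_derivative_iff)
  next
    case 3
    have "((\<lambda>u. u ^ Suc (Suc m)) has_real_derivative real (Suc (Suc m)) * u ^ Suc m) (at u)"
      by (rule derivative_eq_intros refl)+ simp
    then have "((\<lambda>u. (max 0 u) ^ Suc (Suc m)) has_real_derivative real (Suc (Suc m)) * u ^ Suc m) (at u)"
      by (rule has_field_derivative_transform_within_open[where S = "{0<..}"]) (use 3 in auto)
    then show ?thesis using 3 by (simp add: max_def)
  qed
qed

lemma pos_part_power_deriv_comp:
  fixes g :: "real \<Rightarrow> real"
  assumes "(g has_real_derivative D) (at z)"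
  shows "((\<lambda>z. (max 0 (g z)) ^ Suc (Suc m)) has_real_derivative
    real (Suc (Suc m)) * (max 0 (g z)) ^ Suc m * D) (at z)"
  by (rule DERIV_chain2[where f = "\<lambda>u. (max 0 u) ^ Suc (Suc m)", OF pos_part_power_deriv assms])

lemma DERIV_shift1: "((\<lambda>z::real. z - 1) has_real_derivative 1) (at z)"
  and DERIV_reflect1: "((\<lambda>z::real. - z - 1) has_real_derivative - 1) (at z)"
  by (auto intro!: derivative_eq_intros)

text \<open>The distance beyond the obstacle, with sign. The penalty is quadratic in it rather than linear, so
  that it is \<open>C\<^sup>1\<close> and the classical chain rule applies to it.\<close>

definition excess :: "real \<Rightarrow> real" where "excess z = max 0 (z - 1) - max 0 (- z - 1)"

definition pen :: "nat \<Rightarrow> real \<Rightarrow> real" where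
  "pen n z = (real (Suc n))\<^sup>2 * ((max 0 (z - 1))\<^sup>2 - (max 0 (- z - 1))\<^sup>2)"

definition pen_deriv :: "nat \<Rightarrow> real \<Rightarrow> real" where
  "pen_deriv n z = 2 * (real (Suc n))\<^sup>2 * (max 0 (z - 1) + max 0 (- z - 1))"

definition pen_prim :: "nat \<Rightarrow> real \<Rightarrow> real" where
  "pen_prim n z = (real (Suc n))\<^sup>2 / 3 * ((max 0 (z - 1)) ^ 3 + (max 0 (- z - 1)) ^ 3)"

lemma pen_has_deriv: "(pen n has_real_derivative pen_deriv n z) (at z)"
proof -
  have 1: "((\<lambda>z. (max 0 (z - 1))\<^sup>2) has_real_derivative 2 * max 0 (z - 1) * 1) (at z)"
    using pos_part_power_deriv_comp[of "\<lambda>z. z - 1" "1" z 0] DERIV_shift1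
    by (simp add: numeral_2_eq_2)
  have 2: "((\<lambda>z. (max 0 (- z - 1))\<^sup>2) has_real_derivative 2 * max 0 (- z - 1) * (- 1)) (at z)"
    using pos_part_power_deriv_comp[of "\<lambda>z. - z - 1" "-1" z 0] DERIV_reflect1
    by (simp add: numeral_2_eq_2)
  show ?thesis
    unfolding pen_def[abs_def] pen_deriv_def
    by (rule DERIV_cong[OF DERIV_cmult[OF DERIV_diff[OF 1 2]]]) (simp add: algebra_simps)
qed

lemma pen_prim_has_deriv: "(pen_prim n has_real_derivative pen n z) (at z)"
proof -
  have 1: "((\<lambda>z. (max 0 (z - 1)) ^ 3) has_real_derivative 3 * (max 0 (z - 1))\<^sup>2 * 1) (at z)"
    using pos_part_power_deriv_comp[of "\<lambda>z. z - 1" "1" z 1] DERIV_shift1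
    by (simp add: numeral_2_eq_2 numeral_3_eq_3)
  have 2: "((\<lambda>z. (max 0 (- z - 1)) ^ 3) has_real_derivative 3 * (max 0 (- z - 1))\<^sup>2 * (- 1)) (at z)"
    using pos_part_power_deriv_comp[of "\<lambda>z. - z - 1" "-1" z 1] DERIV_reflect1
    by (simp add: numeral_2_eq_2 numeral_3_eq_3)
  show ?thesis
    unfolding pen_prim_def[abs_def] pen_def
    by (rule DERIV_cong[OF DERIV_cmult[OF DERIV_add[OF 1 2]]]) (simp add: algebra_simps)
qed

lemma pen_continuous: "continuous_on UNIV (pen n)"
  by (rule DERIV_continuous_on) (use pen_has_deriv in auto)

lemma pen_deriv_continuous: "continuous_on S (pen_deriv n)"
  unfolding pen_deriv_def[abs_def] by (intro continuous_intros)

lemma pen_deriv_nonneg: "0 \<le> pen_deriv n z"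
  by (simp add: pen_deriv_def)

lemma pen_mono: "x \<le> y \<Longrightarrow> pen n x \<le> pen n y"
  by (rule DERIV_nonneg_imp_nondecreasing) (use pen_has_deriv pen_deriv_nonneg in blast)+

lemma pen_cases:
  "pen n z = (if 1 < z then (real (Suc n) * (z - 1))\<^sup>2 else if z < -1 then - (real (Suc n) * (z + 1))\<^sup>2 else 0)"
  and excess_cases: "excess z = (if 1 < z then z - 1 else if z < -1 then z + 1 else 0)"
proof -
  consider "1 < z" | "z < -1" | "-1 \<le> z \<and> z \<le> 1" by linarith
  note c = this
  from c show "excess z = (if 1 < z then z - 1 else if z < -1 then z + 1 else 0)"
    by cases (auto simp: excess_def)
  from c show "pen n z = (if 1 < z then (real (Suc n) * (z - 1))\<^sup>2 else if z < -1 then - (real (Suc n) * (z + 1))\<^sup>2 else 0)"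
  proof cases
    case 1
    then have "max 0 (z - 1) = z - 1" "max 0 (- z - 1) = 0" by auto
    then show ?thesis using 1 by (simp add: pen_def power_mult_distrib)
  next
    case 2
    then have "max 0 (z - 1) = 0" "max 0 (- z - 1) = - (z + 1)" by auto
    then show ?thesis using 2 by (simp only: pen_def power2_minus power_mult_distrib) auto
  next
    case 3
    then have "max 0 (z - 1) = 0" "max 0 (- z - 1) = 0" by auto
    then show ?thesis using 3 by (simp add: pen_def)
  qed
qed

lemma pen_sign: "pen n z \<noteq> 0 \<Longrightarrow> (0 < pen n z \<and> 1 < z) \<or> (pen n z < 0 \<and> z < -1)"
  by (auto simp: pen_cases split: if_splits)

lemma pen_excess: "\<bar>pen n z\<bar> = (real (Suc n) * \<bar>excess z\<bar>)\<^sup>2"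
  by (simp add: pen_cases excess_cases power_mult_distrib)

text \<open>Up to a small error the penalties of different strength are jointly monotone: beyond the
  obstacle the excess is only \<open>sqrt \<bar>pen n z\<bar> / (n + 1)\<close>.\<close>

lemma pen_cross:
  "- (inverse (real (Suc m)) + inverse (real (Suc n))) * (1 + (pen m x)\<^sup>2 + (pen n y)\<^sup>2)
    \<le> (pen m x - pen n y) * (x - y)"
proof -
  define A B where "A = pen m x" and "B = pen n y"
  define M N where "M = real (Suc m)" and "N = real (Suc n)"
  have MN: "0 < M" "0 < N" by (auto simp: M_def N_def)
  \<comment> \<open>The projections of \<open>x\<close> and \<open>y\<close> onto \<open>[-1, 1]\<close>.\<close>
  define u v where "u = x - excess x" and "v = y - excess y"
  have u: "-1 \<le> u" "u \<le> 1" "A > 0 \<Longrightarrow> u = 1" "A < 0 \<Longrightarrow> u = -1"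
    and v: "-1 \<le> v" "v \<le> 1" "B > 0 \<Longrightarrow> v = 1" "B < 0 \<Longrightarrow> v = -1"
    using pen_sign[of m x] pen_sign[of n y] by (auto simp: u_def v_def excess_def A_def B_def)
  have "0 \<le> A * (u - v)" using u v by (cases A "0::real" rule: linorder_cases) (auto intro: mult_nonpos_nonpos)
  moreover have "0 \<le> B * (v - u)" using u v by (cases B "0::real" rule: linorder_cases) (auto intro: mult_nonpos_nonpos)
  ultimately have 1: "0 \<le> (A - B) * (u - v)" by (simp add: algebra_simps)
  have small: "\<bar>P\<bar> * e \<le> inverse K * (1 + P\<^sup>2 + Q\<^sup>2)" if "\<bar>Q\<bar> = (K * e)\<^sup>2" "0 < K" "0 \<le> e" for P Q K e :: real
  proof -
    have "2 * (\<bar>P\<bar> * (K * e)) \<le> P\<^sup>2 + \<bar>Q\<bar>"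
      using sum_squares_bound[of "\<bar>P\<bar>" "K * e"] that(1) by (simp add: mult.assoc)
    moreover have "0 \<le> \<bar>P\<bar> * (K * e)" using that by simp
    ultimately have "\<bar>P\<bar> * (K * e) \<le> P\<^sup>2 + \<bar>Q\<bar>" by linarith
    also have "\<bar>Q\<bar> \<le> 1 + Q\<^sup>2"
      using sum_squares_bound[of "\<bar>Q\<bar>" 1] by simp
    finally have "\<bar>P\<bar> * (K * e) \<le> 1 + P\<^sup>2 + Q\<^sup>2" by simp
    then have "inverse K * (\<bar>P\<bar> * (K * e)) \<le> inverse K * (1 + P\<^sup>2 + Q\<^sup>2)"
      using that by (intro mult_left_mono) auto
    then show ?thesis using that by (simp add: field_simps)
  qed
  have ex: "0 \<le> A * excess x" "0 \<le> B * excess y"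
    by (auto simp: A_def B_def pen_cases excess_cases zero_le_mult_iff)
  have "A * excess y \<le> \<bar>A\<bar> * \<bar>excess y\<bar>" "B * excess x \<le> \<bar>B\<bar> * \<bar>excess x\<bar>"
    by (simp_all flip: abs_mult)
  moreover have "\<bar>A\<bar> * \<bar>excess y\<bar> \<le> inverse N * (1 + A\<^sup>2 + B\<^sup>2)"
    by (rule small) (use MN pen_excess[of n y] in \<open>auto simp: B_def N_def\<close>)
  moreover have "\<bar>B\<bar> * \<bar>excess x\<bar> \<le> inverse M * (1 + B\<^sup>2 + A\<^sup>2)"
    by (rule small) (use MN pen_excess[of m x] in \<open>auto simp: A_def M_def\<close>)
  ultimately have 2: "- (inverse M + inverse N) * (1 + A\<^sup>2 + B\<^sup>2) \<le> (A - B) * (excess x - excess y)"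
    using ex by (simp add: algebra_simps)
  have "(A - B) * (x - y) = (A - B) * (u - v) + (A - B) * (excess x - excess y)"
    by (simp add: u_def v_def algebra_simps)
  with 1 2 show ?thesis unfolding A_def B_def M_def N_def by simp
qed

lemma midhull_prim_le:
  assumes "\<rho> \<in> midhull A" "A \<subseteq> L2 L" "\<And>a. a \<in> A \<Longrightarrow> prim L a x * u \<le> b"
  shows "prim L \<rho> x * u \<le> b"
  using assms(1)
proof induction
  case (mid a a')
  have "prim L (\<lambda>x. (a x + a' x) / 2) x = (prim L a x + prim L a' x) / 2"
    using prim_cmult[of L "1/2" "\<lambda>x. a x + a' x" x]
      prim_add[OF L2_integrable[OF midhull_L2[OF mid(1) assms(2)]] L2_integrable[OF midhull_L2[OF mid(2) assms(2)]], of x]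
    by simp
  then have "prim L (\<lambda>x. (a x + a' x) / 2) x * u = (prim L a x * u + prim L a' x * u) / 2"
    by (simp only: distrib_right times_divide_eq_left)
  then show ?case using mid by simp
qed (rule assms(3))

lemma midhull_pointwise_le:
  assumes "\<rho> \<in> midhull A" "\<And>a. a \<in> A \<Longrightarrow> a x * u \<le> b"
  shows "\<rho> x * u \<le> b"
  using assms(1)
proof induction
  case (mid a a')
  have "(a x + a' x) / 2 * u = (a x * u + a' x * u) / 2" by (simp add: distrib_right)
  then show ?case using mid by simp
qed (rule assms(2))

context semilinear
begin

lemma penalised: "semilinear f \<nu> C\<^sub>f (\<lambda>z. k z + pen n z) (\<lambda>z. \<kappa> z + pen_prim n z) c L F"
proof unfold_locales
  show "continuous_on UNIV (\<lambda>z. k z + pen n z)"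
    by (intro continuous_on_add k_continuous pen_continuous)
  show "mono (\<lambda>r. k r + pen n r - c * r)"
  proof (rule monoI)
    fix x y :: real assume "x \<le> y"
    then show "k x + pen n x - c * x \<le> k y + pen n y - c * y"
      using monoD[OF k_mono \<open>x \<le> y\<close>] pen_mono[of x y n] by simp
  qed
  show "((\<lambda>z. \<kappa> z + pen_prim n z) has_real_derivative k r + pen n r) (at r)" for r
    by (intro DERIV_add \<kappa>_deriv pen_prim_has_deriv)
qed (rule c L F)+

abbreviation flux_path :: "real \<Rightarrow> (real \<Rightarrow> real) \<Rightarrow> real \<Rightarrow> real" where
  "flux_path d r x \<equiv> d + prim L (\<lambda>y. \<beta> (prim L r y)) x"

lemma flux_path_continuous: "r \<in> L2 L \<Longrightarrow> continuous_on S (flux_path d r)"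
  by (rule continuous_on_affine_prim[OF \<beta>_prim_L2])

lemma comp_flux_path_L2:
  "r \<in> L2 L \<Longrightarrow> continuous_on UNIV \<phi> \<Longrightarrow> (\<lambda>x. \<phi> (flux_path d r x)) \<in> L2 L"
  by (rule continuous_on_L2[OF continuous_on_compose2[OF _ flux_path_continuous]]) auto

text \<open>Testing the equation with the penalty itself: the diffusion contributes
  \<open>\<integral> H \<beta>(H) pen'(w) \<ge> 0\<close>, so the penalty is bounded in \<open>L\<^sup>2\<close> uniformly in its strength.\<close>

lemma penalty_bound:
  assumes r: "r \<in> L2 L" and rL: "prim L r L = 0"
    and eq: "AE x in Om L. r x = k (flux_path d r x) + pen n (flux_path d r x) - F x"
  shows "sqn L (\<lambda>x. pen n (flux_path d r x)) \<le> sqn L (\<lambda>x. F x - k 0)"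
proof -
  let ?w = "flux_path d r" and ?p = "\<lambda>y. \<beta> (prim L r y)"
  define P where "P x = pen n (?w x)" for x
  have PL: "P \<in> L2 L" unfolding P_def by (rule comp_flux_path_L2[OF r pen_continuous])
  have pc: "continuous_on S ?p" for S by (rule \<beta>_prim_continuous[OF L2_integrable[OF r]])
  define q where "q x = pen_deriv n (?w x) * ?p x" for x
  have qc: "continuous_on S q" for S
    unfolding q_def
    by (intro continuous_on_mult pc continuous_on_compose2[OF pen_deriv_continuous[of UNIV] flux_path_continuous[OF r]]) simp
  have PP: "P x = P (-L) + prim L q x" if x: "x \<in> {-L..L}" for x
  proof (rule prim_of_derivative[OF _ qc x])
    fix y assume y: "y \<in> {-L..L}"
    have "(?w has_real_derivative 0 + ?p y) (at y within {-L..L})"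
      by (intro DERIV_add DERIV_const prim_has_derivative_continuous pc y)
    then show "(P has_real_derivative q y) (at y within {-L..L})"
      unfolding P_def q_def using DERIV_chain2[OF pen_has_deriv] by fastforce
  qed
  have "(LINT x|Om L. r x * P x) = (LINT x|Om L. r x * (P (-L) + prim L q x))"
    by (rule Bochner_Integration.integral_cong[OF refl], rule arg_cong[OF PP]) simp
  also have "\<dots> = - (LINT x|Om L. prim L r x * q x)"
    by (rule integral_by_parts[OF L2_integrable[OF continuous_on_L2[OF qc]] L2_integrable[OF r] rL])
  also have "\<dots> \<le> 0"
  proof -
    have "0 \<le> prim L r x * q x" for x
      using mult_nonneg_nonneg[OF pen_deriv_nonneg[of n "?w x"] \<beta>_sign[of "prim L r x"]]
      by (simp add: q_def algebra_simps)
    then show ?thesis by (simp add: Bochner_Integration.integral_nonneg)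
  qed
  finally have neg: "(LINT x|Om L. r x * P x) \<le> 0" .
  have "sqn L P \<le> (LINT x|Om L. r x * P x + (F x - k 0) * P x)"
  proof (rule integral_mono_AE[OF L2_sq[OF PL]])
    show "integrable (Om L) (\<lambda>x. r x * P x + (F x - k 0) * P x)"
      by (intro Bochner_Integration.integrable_add L2_mult_integrable r PL L2_diff F L2_const)
    show "AE x in Om L. (P x)\<^sup>2 \<le> r x * P x + (F x - k 0) * P x"
      using eq
    proof eventually_elim
      case (elim x)
      have mono: "a \<le> b \<Longrightarrow> k a \<le> k b" for a b
      proof -
        assume "a \<le> b"
        then have "c * a \<le> c * b" using c by simp
        then show "k a \<le> k b" using monoD[OF k_mono \<open>a \<le> b\<close>] by linarith
      qed
      have "0 \<le> (k (?w x) - k 0) * P x"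
      proof (cases "P x = 0")
        case False
        from pen_sign[OF this[unfolded P_def]] show ?thesis
        proof
          assume *: "0 < pen n (?w x) \<and> 1 < ?w x"
          then have "k 0 \<le> k (?w x)" by (intro mono) linarith
          then show ?thesis using * unfolding P_def by (intro mult_nonneg_nonneg) linarith+
        next
          assume *: "pen n (?w x) < 0 \<and> ?w x < -1"
          then have "k (?w x) \<le> k 0" by (intro mono) linarith
          then show ?thesis using * unfolding P_def by (intro mult_nonpos_nonpos) linarith+
        qed
      qed simp
      moreover have "r x * P x + (F x - k 0) * P x = (k (?w x) - k 0) * P x + (P x)\<^sup>2"
      proof -
        have "r x + (F x - k 0) = (k (?w x) - k 0) + P x" using elim by (simp add: P_def)
        then show ?thesis by (simp only: distrib_right[symmetric] power2_eq_square)
      qed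
      ultimately show ?case by linarith
    qed
  qed
  also have "\<dots> = (LINT x|Om L. r x * P x) + (LINT x|Om L. (F x - k 0) * P x)"
    by (intro Bochner_Integration.integral_add L2_mult_integrable r PL L2_diff F L2_const)
  also have "\<dots> \<le> (LINT x|Om L. (F x - k 0) * P x)" using neg by simp
  finally have le: "sqn L P \<le> (LINT x|Om L. (F x - k 0) * P x)" .
  have "sqn L P * sqn L P \<le> (LINT x|Om L. (F x - k 0) * P x) * (LINT x|Om L. (F x - k 0) * P x)"
    by (rule mult_mono[OF le le order_trans[OF sqn_nonneg le] sqn_nonneg])
  also have "\<dots> = (LINT x|Om L. (F x - k 0) * P x)\<^sup>2" by (rule power2_eq_square[symmetric])
  also have "\<dots> \<le> sqn L (\<lambda>x. F x - k 0) * sqn L P"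
    by (rule L2_Cauchy_Schwarz[OF L2_diff[OF F L2_const] PL])
  finally have "sqn L P \<le> sqn L (\<lambda>x. F x - k 0)"
    using sqn_nonneg[of L P] sqn_nonneg[of L "\<lambda>x. F x - k 0"]
    by (cases "sqn L P = 0") (auto simp: mult_le_cancel_right)
  then show ?thesis by (simp add: P_def)
qed

text \<open>The difference of two penalised equations tested with the difference of the solutions. As the
  penalty strengths tend to infinity the right-hand side tends to zero, so the solutions are Cauchy in \<open>H\<^sup>1\<close>.\<close>

lemma penalised_difference:
  assumes r: "r \<in> L2 L" "prim L r L = 0"
    "AE x in Om L. r x = k (flux_path d r x) + pen m (flux_path d r x) - F x"
    and r': "r' \<in> L2 L" "prim L r' L = 0"
    "AE x in Om L. r' x = k (flux_path d' r' x) + pen n (flux_path d' r' x) - F x"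
  shows "\<nu>\<^sup>2 * sqn L (\<lambda>x. \<beta> (prim L r x) - \<beta> (prim L r' x))
      + c * sqn L (\<lambda>x. flux_path d r x - flux_path d' r' x)
    \<le> (inverse (real (Suc m)) + inverse (real (Suc n))) * (2 * L + 2 * sqn L (\<lambda>x. F x - k 0))"
proof -
  define w w' where "w = flux_path d r" and "w' = flux_path d' r'"
  define p p' where "p x = \<beta> (prim L r x)" and "p' x = \<beta> (prim L r' x)" for x
  define P P' where "P x = pen m (w x)" and "P' x = pen n (w' x)" for x
  define \<iota> where "\<iota> = inverse (real (Suc m)) + inverse (real (Suc n))"
  have \<iota>: "0 \<le> \<iota>" by (simp add: \<iota>_def)
  have pL: "p \<in> L2 L" "p' \<in> L2 L" unfolding p_def p'_def by (intro \<beta>_prim_L2 r r')+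
  have wL: "w \<in> L2 L" "w' \<in> L2 L"
    unfolding w_def w'_def by (intro continuous_on_L2[OF flux_path_continuous] r r')+
  have PL: "P \<in> L2 L" "P' \<in> L2 L"
    unfolding P_def P'_def w_def w'_def by (intro comp_flux_path_L2 pen_continuous r r')+
  have Hc: "prim L r \<in> L2 L" "prim L r' \<in> L2 L"
    using affine_prim_L2[OF r(1), of 0] affine_prim_L2[OF r'(1), of 0] by simp_all
  have rr: "(\<lambda>x. r x - r' x) \<in> L2 L" by (intro L2_diff r r')
  have pp: "(\<lambda>x. p x - p' x) \<in> L2 L" by (intro L2_diff pL)
  have ww: "w x - w' x = (d - d') + prim L (\<lambda>x. p x - p' x) x" for x
    unfolding w_def w'_def p_def p'_def by (rule affine_prim_diff[OF \<beta>_prim_L2[OF r(1)] \<beta>_prim_L2[OF r'(1)]])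
  have Hd: "prim L (\<lambda>x. r x - r' x) x = prim L r x - prim L r' x" for x
    by (rule prim_diff[OF L2_integrable[OF r(1)] L2_integrable[OF r'(1)]])
  have "(LINT x|Om L. c * (w x - w' x)\<^sup>2 - \<iota> * (1 + (P x)\<^sup>2 + (P' x)\<^sup>2)) \<le> (LINT x|Om L. (r x - r' x) * (w x - w' x))"
  proof (rule integral_mono_AE)
    show "integrable (Om L) (\<lambda>x. c * (w x - w' x)\<^sup>2 - \<iota> * (1 + (P x)\<^sup>2 + (P' x)\<^sup>2))"
      using L2_sq[OF L2_diff[OF wL]] L2_sq[OF PL(1)] L2_sq[OF PL(2)] by simp
    show "integrable (Om L) (\<lambda>x. (r x - r' x) * (w x - w' x))"
      by (intro L2_mult_integrable L2_diff r r' wL)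
    show "AE x in Om L. c * (w x - w' x)\<^sup>2 - \<iota> * (1 + (P x)\<^sup>2 + (P' x)\<^sup>2) \<le> (r x - r' x) * (w x - w' x)"
      using r(3) r'(3)
    proof eventually_elim
      case (elim x)
      have "(r x - r' x) * (w x - w' x)
          = (k (w x) - k (w' x)) * (w x - w' x) + (P x - P' x) * (w x - w' x)"
      proof -
        have "r x - r' x = (k (w x) - k (w' x)) + (P x - P' x)"
          using elim by (simp add: w_def w'_def P_def P'_def)
        then show ?thesis by (simp only: distrib_right)
      qed
      moreover have "c * (w x - w' x)\<^sup>2 \<le> (k (w x) - k (w' x)) * (w x - w' x)" by (rule k_strong_mono)
      moreover have "- \<iota> * (1 + (P x)\<^sup>2 + (P' x)\<^sup>2) \<le> (P x - P' x) * (w x - w' x)"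
        unfolding P_def P'_def \<iota>_def by (rule pen_cross)
      ultimately show ?case by simp
    qed
  qed
  also have "\<dots> = - (LINT x|Om L. prim L (\<lambda>x. r x - r' x) x * (p x - p' x))"
    unfolding ww by (rule integral_by_parts[OF L2_integrable[OF pp] L2_integrable[OF rr]]) (simp add: Hd r r')
  also have "\<dots> \<le> - (LINT x|Om L. \<nu>\<^sup>2 * (p x - p' x)\<^sup>2)"
  proof -
    have "(LINT x|Om L. \<nu>\<^sup>2 * (p x - p' x)\<^sup>2) \<le> (LINT x|Om L. prim L (\<lambda>x. r x - r' x) x * (p x - p' x))"
    proof (rule integral_mono)
      show "integrable (Om L) (\<lambda>x. \<nu>\<^sup>2 * (p x - p' x)\<^sup>2)" using L2_sq[OF pp] by simp
      show "integrable (Om L) (\<lambda>x. prim L (\<lambda>x. r x - r' x) x * (p x - p' x))"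
        unfolding Hd by (intro L2_mult_integrable L2_diff Hc pL)
      show "\<nu>\<^sup>2 * (p x - p' x)\<^sup>2 \<le> prim L (\<lambda>x. r x - r' x) x * (p x - p' x)" for x
        unfolding Hd p_def p'_def by (rule \<beta>_strong_mono)
    qed
    then show ?thesis by simp
  qed
  finally have main: "(LINT x|Om L. c * (w x - w' x)\<^sup>2 - \<iota> * (1 + (P x)\<^sup>2 + (P' x)\<^sup>2)) \<le> - (\<nu>\<^sup>2 * sqn L (\<lambda>x. p x - p' x))"
    by simp
  have "(LINT x|Om L. c * (w x - w' x)\<^sup>2 - \<iota> * (1 + (P x)\<^sup>2 + (P' x)\<^sup>2))
      = c * sqn L (\<lambda>x. w x - w' x) - \<iota> * (2 * L + sqn L P + sqn L P')"
    using L2_sq[OF L2_diff[OF wL]] L2_sq[OF PL(1)] L2_sq[OF PL(2)] L by (simp add: measure_Om)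
  moreover have "\<iota> * (2 * L + sqn L P + sqn L P') \<le> \<iota> * (2 * L + 2 * sqn L (\<lambda>x. F x - k 0))"
    using penalty_bound[OF r] penalty_bound[OF r']
    by (intro mult_left_mono \<iota>) (simp add: P_def[abs_def] P'_def[abs_def] w_def w'_def)
  ultimately show ?thesis
    using main unfolding \<iota>_def w_def w'_def p_def p'_def by linarith
qed

text \<open>Passage to the limit: the penalised solutions converge strongly in \<open>H\<^sup>1\<close>; their fluxes need not
  converge (the flux is not determined where the gradient sits at a kink of \<open>f\<close>), but convex
  combinations do, and the subgradient inclusions are closed convex conditions on the flux.\<close>

lemma obstacle_solution_exists:
  obtains d r where "r \<in> L2 L" "prim L r L = 0"
    "AE x in Om L. \<bar>flux_path d r x\<bar> \<le> 1"
    "AE x in Om L. flux_path d r x < 1 \<longrightarrow> r x - k (flux_path d r x) + F x \<le> 0"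
    "AE x in Om L. -1 < flux_path d r x \<longrightarrow> 0 \<le> r x - k (flux_path d r x) + F x"
proof -
  define Q where "Q n p \<longleftrightarrow> snd p \<in> L2 L \<and> prim L (snd p) L = 0 \<and> (AE x in Om L. snd p x
      = k (flux_path (fst p) (snd p) x) + pen n (flux_path (fst p) (snd p) x) - F x)" for n p
  have "\<exists>p. Q n p" for n
  proof -
    obtain d r where "r \<in> L2 L" "prim L r L = 0"
      "AE x in Om L. r x = k (flux_path d r x) + pen n (flux_path d r x) - F x"
      by (rule semilinear.solution_exists[OF penalised[of n]])
    then show ?thesis by (intro exI[of _ "(d, r)"]) (simp add: Q_def)
  qed
  then obtain pr where "\<And>n. Q n (pr n)" by metis
  note pr = this[unfolded Q_def]
  define d r where "d n = fst (pr n)" and "r n = snd (pr n)" for n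
  have r: "r n \<in> L2 L" "prim L (r n) L = 0"
    and eq: "AE x in Om L. r n x = k (flux_path (d n) (r n) x) + pen n (flux_path (d n) (r n) x) - F x" for n
    using pr[of n] by (simp_all add: d_def r_def)
  define w where "w n = flux_path (d n) (r n)" for n
  define p where "p n x = \<beta> (prim L (r n) x)" for n x
  have wp: "w n x = d n + prim L (p n) x" for n x by (simp add: w_def p_def[abs_def])
  have pL: "p n \<in> L2 L" for n unfolding p_def by (rule \<beta>_prim_L2[OF r(1)])
  define C where "C = sqn L (\<lambda>x. F x - k 0)"
  have PC: "sqn L (\<lambda>x. pen n (w n x)) \<le> C" for n
    unfolding C_def w_def by (rule penalty_bound[OF r eq])
  define K where "K = 2 * L + 2 * C"
  have "0 \<le> C" unfolding C_def by (rule sqn_nonneg)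
  then have K: "0 < K" using L by (simp add: K_def)
  have diff: "\<nu>\<^sup>2 * sqn L (\<lambda>x. p m x - p n x) + c * sqn L (\<lambda>x. w m x - w n x)
      \<le> (inverse (real (Suc m)) + inverse (real (Suc n))) * K" for m n
    unfolding K_def C_def w_def p_def by (rule penalised_difference[OF r eq r eq])
  define t where "t n = inverse (real (Suc n))" for n
  have t0: "t \<longlonglongrightarrow> 0" unfolding t_def by (rule LIMSEQ_inverse_real_of_nat)
  have Cau: "\<exists>N. \<forall>m\<ge>N. \<forall>n\<ge>N. sqn L (\<lambda>x. p m x - p n x) < e \<and>
      sqn L (\<lambda>x. (d m + prim L (p m) x) - (d n + prim L (p n) x)) < e" if e: "0 < e" for e
  proof -
    define \<mu> where "\<mu> = min (\<nu>\<^sup>2) c"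
    have \<mu>: "0 < \<mu>" using \<nu> c by (simp add: \<mu>_def)
    have "\<forall>\<^sub>F n in sequentially. t n < \<mu> * e / (2 * K)"
      using order_tendstoD(2)[OF t0] \<mu> e K by simp
    then obtain N where N: "\<And>n. n \<ge> N \<Longrightarrow> t n < \<mu> * e / (2 * K)" by (auto simp: eventually_sequentially)
    have "sqn L (\<lambda>x. p m x - p n x) < e \<and> sqn L (\<lambda>x. w m x - w n x) < e" if "m \<ge> N" "n \<ge> N" for m n
    proof -
      define a b where "a = sqn L (\<lambda>x. p m x - p n x)" and "b = sqn L (\<lambda>x. w m x - w n x)"
      have ab: "0 \<le> a" "0 \<le> b" by (simp_all add: a_def b_def)
      have "t m + t n < \<mu> * e / K" using N[OF that(1)] N[OF that(2)] by (simp add: field_simps)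
      then have "(t m + t n) * K < \<mu> * e" using K by (simp add: field_simps)
      then have "\<nu>\<^sup>2 * a + c * b < \<mu> * e"
        using diff[of m n, folded a_def b_def t_def] by (rule order.strict_trans1[rotated])
      moreover have "\<mu> * a \<le> \<nu>\<^sup>2 * a" "\<mu> * b \<le> c * b"
        by (rule mult_right_mono[OF _ ab(1)], simp add: \<mu>_def, rule mult_right_mono[OF _ ab(2)], simp add: \<mu>_def)
      moreover have "0 \<le> \<mu> * a" "0 \<le> \<mu> * b" using \<mu> ab by simp_all
      ultimately have "\<mu> * a < \<mu> * e" "\<mu> * b < \<mu> * e" by linarith+
      then show ?thesis using \<mu> by (simp add: a_def b_def)
    qed
    note this[unfolded wp]
    then show ?thesis by (intro exI[of _ N] allI impI)
  qed
  obtain d0 q s where q: "q \<in> L2 L" "(\<lambda>n. sqn L (\<lambda>x. p n x - q x)) \<longlonglongrightarrow> 0" "d \<longlonglongrightarrow> d0"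
    and s: "strict_mono s" "AE x in Om L. (\<lambda>n. p (s n) x) \<longlonglongrightarrow> q x"
    by (rule affine_prim_complete[OF L pL Cau])
  have wlim: "(\<lambda>n. w n x) \<longlonglongrightarrow> d0 + prim L q x" for x
    unfolding wp by (rule affine_prim_tendsto(1)[OF L pL q])
  obtain B where B: "\<And>n x. \<bar>w n x\<bar> \<le> B"
    using affine_prim_tendsto(2)[OF L pL q] unfolding wp by auto
  have "continuous_on {-B..B} k" using k_continuous by (rule continuous_on_subset) simp
  then have "bounded (k ` {-B..B})" by (intro compact_imp_bounded compact_continuous_image) auto
  then obtain Ka where "\<forall>a\<in>{-B..B}. \<bar>k a\<bar> \<le> Ka" by (auto simp: bounded_iff)
  then have Ka: "\<bar>k a\<bar> \<le> Ka" if "\<bar>a\<bar> \<le> B" for a using that by (simp add: abs_le_iff)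
  define C1 where "C1 = 2 * (2 * (2 * L * Ka\<^sup>2) + 2 * sqn L F) + 2 * C"
  have rbd: "sqn L (r n) \<le> C1" for n
  proof -
    have kw: "(\<lambda>x. k (w n x)) \<in> L2 L" "(\<lambda>x. pen n (w n x)) \<in> L2 L"
      unfolding w_def by (intro comp_flux_path_L2 r k_continuous pen_continuous)+
    have F': "(\<lambda>x. -1 * F x) \<in> L2 L" by (rule L2_cmult[OF F])
    have kF: "(\<lambda>x. k (w n x) + -1 * F x) \<in> L2 L" by (rule L2_add[OF kw(1) F'])
    have "sqn L (r n) = sqn L (\<lambda>x. (k (w n x) + -1 * F x) + pen n (w n x))"
    proof (rule integral_cong_AE)
      show "AE x in Om L. (r n x)\<^sup>2 = (k (w n x) + -1 * F x + pen n (w n x))\<^sup>2"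
        using eq[of n]
      proof eventually_elim
        case (elim x)
        then have "r n x = k (w n x) + -1 * F x + pen n (w n x)" by (simp add: w_def)
        then show ?case by (rule arg_cong)
      qed
    qed (use L2_meas[OF r(1)] L2_meas[OF L2_add[OF kF kw(2)]] in auto)
    also have "\<dots> \<le> 2 * sqn L (\<lambda>x. k (w n x) + -1 * F x) + 2 * sqn L (\<lambda>x. pen n (w n x))"
      by (rule sqn_add_le[OF kF kw(2)])
    also have "sqn L (\<lambda>x. k (w n x) + -1 * F x) \<le> 2 * sqn L (\<lambda>x. k (w n x)) + 2 * sqn L (\<lambda>x. -1 * F x)"
      by (rule sqn_add_le[OF kw(1) F'])
    also have "sqn L (\<lambda>x. k (w n x)) \<le> (LINT x|Om L. Ka\<^sup>2)"
    proof (rule integral_mono[OF L2_sq[OF kw(1)] integrable_const_Om])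
      fix x
      have "\<bar>k (w n x)\<bar>\<^sup>2 \<le> Ka\<^sup>2" by (rule power_mono[OF Ka[OF B]]) simp
      then show "(k (w n x))\<^sup>2 \<le> Ka\<^sup>2" by simp
    qed
    also have "(LINT x|Om L. Ka\<^sup>2) = 2 * L * Ka\<^sup>2" by (rule integral_const_Om[OF L])
    also have "sqn L (\<lambda>x. -1 * F x) = sqn L F" by simp
    finally show ?thesis using PC[of n] by (simp add: C1_def)
  qed
  \<comment> \<open>Strongly convergent convex combinations of the flux derivatives, along the subsequence on which the gradients converge pointwise.\<close>
  obtain \<rho> l where \<rho>: "\<And>k. \<rho> k \<in> midhull ((\<lambda>n. r (s n)) ` {k..})" "l \<in> L2 L"
    "(\<lambda>k. sqn L (\<lambda>x. \<rho> k x - l x)) \<longlonglongrightarrow> 0" "AE x in Om L. (\<lambda>k. \<rho> k x) \<longlonglongrightarrow> l x"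
    by (rule mazur[where r = "\<lambda>n. r (s n)" and C = C1, OF L r(1) rbd]) (rule that)
  have sub: "(\<lambda>n. r (s n)) ` {k..} \<subseteq> L2 L" for k using r(1) by blast
  have \<rho>L: "\<rho> k \<in> L2 L" for k by (rule midhull_L2[OF \<rho>(1) sub])
  have Hlim: "(\<lambda>k. prim L (\<rho> k) x) \<longlonglongrightarrow> prim L l x" for x
    by (rule prim_tendsto[OF L \<rho>L \<rho>(2,3)])
  have "prim L (\<rho> k) L = 0" for k
    using midhull_prim_bounds[OF \<rho>(1) sub, of k L 0 0] r(2) by auto
  then have lL: "prim L l L = 0" using Hlim[of L] by (simp add: LIMSEQ_const_iff)
  define BH where "BH = sqrt (2 * L * C1)"
  have BH: "\<bar>prim L (r n) x\<bar> \<le> BH" for n x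
  proof -
    have "sqrt (2 * L * sqn L (r n)) \<le> BH"
      unfolding BH_def using rbd[of n] L by (intro real_sqrt_le_mono mult_left_mono) auto
    then show ?thesis using abs_prim_le_sqn[OF L r(1), of n x] by linarith
  qed
  have "AE x in Om L. q x = \<beta> (prim L l x)"
    using s(2)
  proof eventually_elim
    case (elim x)
    have "subgrad h (q x) (prim L l x)"
      unfolding subgrad_def
    proof
      fix y
      have hl: "(\<lambda>n. h (p (s n) x)) \<longlonglongrightarrow> h (q x)"
        using continuous_on_tendsto_compose[OF h_continuous[of UNIV] elim] by simp
      have "prim L l x * (y - q x) \<le> h y - h (q x) + e" if e: "0 < e" for e
      proof -
        have "(\<lambda>n. h (p (s n) x) - BH * \<bar>p (s n) x - q x\<bar>) \<longlonglongrightarrow> h (q x) - BH * \<bar>q x - q x\<bar>"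
          by (intro tendsto_intros hl elim)
        then have "\<forall>\<^sub>F n in sequentially. h (q x) - e < h (p (s n) x) - BH * \<bar>p (s n) x - q x\<bar>"
          by (rule order_tendstoD(1)) (use e in simp)
        then obtain N where N: "\<And>n. n \<ge> N \<Longrightarrow> h (q x) - e < h (p (s n) x) - BH * \<bar>p (s n) x - q x\<bar>"
          by (auto simp: eventually_sequentially)
        have each: "prim L (r (s n)) x * (y - q x) \<le> h y - h (q x) + e" if "n \<ge> N" for n
        proof -
          let ?H = "prim L (r (s n)) x"
          have "h (p (s n) x) + ?H * (y - p (s n) x) \<le> h y"
            using subgrad_f_imp_h[OF subgrad_\<beta>, of ?H, unfolded subgrad_def] by (simp add: p_def)
          moreover have "?H * (y - q x) = ?H * (y - p (s n) x) + ?H * (p (s n) x - q x)"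
            by (simp add: algebra_simps)
          moreover have "?H * (p (s n) x - q x) \<le> BH * \<bar>p (s n) x - q x\<bar>"
            using abs_ge_self[of "?H * (p (s n) x - q x)"] mult_right_mono[OF BH, of "\<bar>p (s n) x - q x\<bar>" "s n" x]
            unfolding abs_mult by linarith
          ultimately show ?thesis using N[OF that] by linarith
        qed
        have "prim L (\<rho> k) x * (y - q x) \<le> h y - h (q x) + e" if "k \<ge> N" for k
          by (rule midhull_prim_le[OF \<rho>(1) sub]) (use each that in auto)
        then show ?thesis
          by (intro LIMSEQ_le_const2[OF tendsto_mult[OF Hlim tendsto_const]]) blast
      qed
      then have "prim L l x * (y - q x) \<le> h y - h (q x)" by (rule field_le_epsilon)
      then show "h (q x) + prim L l x * (y - q x) \<le> h y" by simp
    qed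
    then show "q x = \<beta> (prim L l x)" by (rule subgrad_unique[OF subgrad_h_imp_f])
  qed
  then have "prim L q x = prim L (\<lambda>y. \<beta> (prim L l y)) x" for x
    by (rule prim_cong_AE) (use L2_meas[OF q(1)] L2_meas[OF \<beta>_prim_L2[OF \<rho>(2)]] in auto)
  then have wlim: "(\<lambda>n. w n x) \<longlonglongrightarrow> flux_path d0 l x" for x using wlim[of x] by simp
  have swlim: "(\<lambda>n. w (s n) x) \<longlonglongrightarrow> flux_path d0 l x" for x
    using LIMSEQ_subseq_LIMSEQ[OF wlim s(1)] by (simp add: o_def)
  have sign: "AE x in Om L. (\<forall>n. r (s n) x = k (w (s n) x) + pen (s n) (w (s n) x) - F x)"
    unfolding AE_all_countable w_def using eq by blast
  \<comment> \<open>Used with \<open>\<sigma> = 1\<close> away from the upper obstacle and with \<open>\<sigma> = -1\<close> away from the lower one.\<close>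
  have limit_le: "l x * \<sigma> \<le> (k (flux_path d0 l x) - F x) * \<sigma>"
    if lim: "(\<lambda>k. \<rho> k x) \<longlonglongrightarrow> l x" and eqs: "\<forall>n. r (s n) x = k (w (s n) x) + pen (s n) (w (s n) x) - F x"
      and pen0: "\<forall>\<^sub>F n in sequentially. pen (s n) (w (s n) x) * \<sigma> \<le> 0" for x \<sigma>
  proof (rule field_le_epsilon)
    fix e :: real assume e: "0 < e"
    have "(\<lambda>n. k (w (s n) x)) \<longlonglongrightarrow> k (flux_path d0 l x)"
      using continuous_on_tendsto_compose[OF k_continuous swlim] by simp
    then have "(\<lambda>n. (k (w (s n) x) - F x) * \<sigma>) \<longlonglongrightarrow> (k (flux_path d0 l x) - F x) * \<sigma>"
      by (intro tendsto_intros)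
    then have "\<forall>\<^sub>F n in sequentially. (k (w (s n) x) - F x) * \<sigma> < (k (flux_path d0 l x) - F x) * \<sigma> + e"
      by (rule order_tendstoD(2)) (use e in simp)
    with pen0 have "\<forall>\<^sub>F n in sequentially. r (s n) x * \<sigma> \<le> (k (flux_path d0 l x) - F x) * \<sigma> + e"
    proof eventually_elim
      case (elim n)
      have "r (s n) x * \<sigma> = (k (w (s n) x) - F x) * \<sigma> + pen (s n) (w (s n) x) * \<sigma>"
      proof -
        have "r (s n) x = (k (w (s n) x) - F x) + pen (s n) (w (s n) x)" using eqs by simp
        then show ?thesis by (simp only: distrib_right)
      qed
      then show ?case using elim by linarith
    qed
    then obtain N where N: "\<And>n. n \<ge> N \<Longrightarrow> r (s n) x * \<sigma> \<le> (k (flux_path d0 l x) - F x) * \<sigma> + e"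
      by (auto simp: eventually_sequentially)
    have "\<rho> j x * \<sigma> \<le> (k (flux_path d0 l x) - F x) * \<sigma> + e" if "j \<ge> N" for j
      by (rule midhull_pointwise_le[OF \<rho>(1)]) (use N that in auto)
    then show "l x * \<sigma> \<le> (k (flux_path d0 l x) - F x) * \<sigma> + e"
      by (intro LIMSEQ_le_const2[OF tendsto_mult[OF lim tendsto_const]]) blast
  qed
  show ?thesis
  proof (rule that[of l d0])
    show "AE x in Om L. flux_path d0 l x < 1 \<longrightarrow> l x - k (flux_path d0 l x) + F x \<le> 0"
      using \<rho>(4) sign
    proof eventually_elim
      case (elim x)
      show ?case
      proof
        assume "flux_path d0 l x < 1"
        from order_tendstoD(2)[OF swlim this]
        have "\<forall>\<^sub>F n in sequentially. pen (s n) (w (s n) x) * 1 \<le> 0"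
          by (rule eventually_mono) (auto simp: pen_cases)
        from limit_le[OF elim this] show "l x - k (flux_path d0 l x) + F x \<le> 0" by simp
      qed
    qed
    show "AE x in Om L. -1 < flux_path d0 l x \<longrightarrow> 0 \<le> l x - k (flux_path d0 l x) + F x"
      using \<rho>(4) sign
    proof eventually_elim
      case (elim x)
      show ?case
      proof
        assume "-1 < flux_path d0 l x"
        from order_tendstoD(1)[OF swlim this]
        have "\<forall>\<^sub>F n in sequentially. pen (s n) (w (s n) x) * (-1) \<le> 0"
          by (rule eventually_mono) (auto simp: pen_cases)
        from limit_le[OF elim this] show "0 \<le> l x - k (flux_path d0 l x) + F x" by simp
      qed
    qed
    \<comment> \<open>The penalties are bounded in \<open>L\<^sup>2\<close>, and their modulus is the squared excess times \<open>(n + 1)\<^sup>2\<close>.\<close>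
    have exc: "continuous_on UNIV (\<lambda>z. (excess z)\<^sup>2 ^ 2)"
      unfolding excess_def by (intro continuous_intros)
    have "(\<lambda>n. LINT x|Om L. (excess (w n x))\<^sup>2 ^ 2 * 1) \<longlonglongrightarrow> (LINT x|Om L. (excess (flux_path d0 l x))\<^sup>2 ^ 2 * 1)"
      by (rule integral_continuous_comp_tendsto[OF exc _ flux_path_continuous[OF \<rho>(2)] B wlim])
        (use flux_path_continuous[OF r(1)] in \<open>auto simp: w_def\<close>)
    moreover have "(\<lambda>n. LINT x|Om L. (excess (w n x))\<^sup>2 ^ 2 * 1) \<longlonglongrightarrow> 0"
    proof (rule tendsto_if_abs_diff_le)
      show "(\<lambda>n. t n ^ 4 * C) \<longlonglongrightarrow> 0"
        using tendsto_mult[OF tendsto_power[OF t0, of 4] tendsto_const[of C]] by simp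
      fix n
      have pn: "pen n z ^ 2 = real (Suc n) ^ 4 * (excess z)\<^sup>2 ^ 2" for z
      proof -
        have "pen n z ^ 2 = \<bar>pen n z\<bar> ^ 2" by simp
        also have "\<dots> = real (Suc n) ^ 4 * (excess z)\<^sup>2 ^ 2"
          unfolding pen_excess by (simp add: power_mult_distrib flip: power_mult)
        finally show ?thesis .
      qed
      have "real (Suc n) ^ 4 * (LINT x|Om L. (excess (w n x))\<^sup>2 ^ 2) \<le> C"
        using PC[of n] unfolding pn by simp
      then have "(LINT x|Om L. (excess (w n x))\<^sup>2 ^ 2) \<le> t n ^ 4 * C"
        by (simp add: t_def power_inverse field_simps del: of_nat_Suc)
      then show "\<bar>(LINT x|Om L. (excess (w n x))\<^sup>2 ^ 2 * 1) - 0\<bar> \<le> t n ^ 4 * C"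
        by (simp add: abs_of_nonneg Bochner_Integration.integral_nonneg)
    qed
    ultimately have "(LINT x|Om L. (excess (flux_path d0 l x))\<^sup>2 ^ 2) = 0"
      using LIMSEQ_unique by fastforce
    moreover have "integrable (Om L) (\<lambda>x. (excess (flux_path d0 l x))\<^sup>2 ^ 2)"
      by (rule L2_integrable[OF comp_flux_path_L2[OF \<rho>(2) exc]])
    ultimately have "AE x in Om L. (excess (flux_path d0 l x))\<^sup>2 ^ 2 = 0"
      by (subst (asm) integral_nonneg_eq_0_iff_AE) auto
    then show "AE x in Om L. \<bar>flux_path d0 l x\<bar> \<le> 1"
      by eventually_elim (auto simp: excess_cases split: if_splits)
  qed (use \<rho>(2) lL in auto)
qed

end

section \<open>One time step\<close>

text \<open>The data of a single time step, with what is needed of \<open>K\<^sup>\<delta>\<close> restricted to \<open>\<delta> \<noteq> 0\<close>. The condition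
  \<open>2 C\<^sub>g \<tau> \<le> 1\<close> is the form of the step size restriction that enters the energy inequality.\<close>

locale allen_cahn_step = diffusion "f \<epsilon>" \<nu> C\<^sub>f for f :: "real \<Rightarrow> real \<Rightarrow> real" and \<epsilon> \<nu> C\<^sub>f +
  fixes L \<tau> C\<^sub>g \<delta> :: real and g G :: "real \<Rightarrow> real" and Kh K :: "real \<Rightarrow> real \<Rightarrow> real"
  assumes L: "0 < L" and \<tau>: "0 < \<tau>" and \<tau>_small: "2 * C\<^sub>g * \<tau> \<le> 1" and C\<^sub>g: "0 < C\<^sub>g"
    and g_continuous: "continuous_on UNIV g" and g_mono: "mono (\<lambda>r. g r + C\<^sub>g * r)"
    and G_nonneg: "0 \<le> G r" and G_deriv: "(G has_real_derivative g r) (at r)"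
    and K_continuous: "\<delta> \<noteq> 0 \<Longrightarrow> continuous_on UNIV (K \<delta>)" and K_mono: "\<delta> \<noteq> 0 \<Longrightarrow> mono (K \<delta>)"
    and Kh_deriv: "\<delta> \<noteq> 0 \<Longrightarrow> (Kh \<delta> has_real_derivative K \<delta> r) (at r)"
    and Kh_nonneg: "\<delta> \<noteq> 0 \<Longrightarrow> 0 \<le> Kh \<delta> r"
begin

definition c where "c = 1 / \<tau> - C\<^sub>g"

lemma c_pos: "0 < c"
proof -
  have "C\<^sub>g * \<tau> < 1" using \<tau>_small mult_pos_pos[OF C\<^sub>g \<tau>] by linarith
  then show ?thesis using \<tau> by (simp add: c_def field_simps)
qed

lemma g_strong_mono: "- C\<^sub>g * (a - b)\<^sup>2 \<le> (g a - g b) * (a - b)"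
proof -
  have "0 \<le> ((g a + C\<^sub>g * a) - (g b + C\<^sub>g * b)) * (a - b)"
    using monoD[OF g_mono, of a b] monoD[OF g_mono, of b a]
    by (cases "a \<le> b") (auto intro: mult_nonpos_nonpos)
  then show ?thesis by (simp add: power2_eq_square algebra_simps)
qed

lemma reaction_g: "reaction (\<lambda>r. r / \<tau> + g r) (\<lambda>r. r\<^sup>2 / (2 * \<tau>) + G r) c"
proof
  show "0 < c" by (rule c_pos)
  show "continuous_on UNIV (\<lambda>r. r / \<tau> + g r)"
    by (intro continuous_on_add g_continuous continuous_on_divide continuous_on_id continuous_on_const) (use \<tau> in auto)
  have eq: "(\<lambda>r. r / \<tau> + g r - c * r) = (\<lambda>r. g r + C\<^sub>g * r)"
    by (simp add: fun_eq_iff c_def algebra_simps)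
  show "mono (\<lambda>r. r / \<tau> + g r - c * r)" unfolding eq by (rule g_mono)
  show "((\<lambda>r. r\<^sup>2 / (2 * \<tau>) + G r) has_real_derivative r / \<tau> + g r) (at r)" for r
    using \<tau> by (auto intro!: derivative_eq_intros G_deriv)
qed

lemma reaction_gK:
  assumes "\<delta> \<noteq> 0"
  shows "reaction (\<lambda>r. r / \<tau> + g r + K \<delta> r) (\<lambda>r. r\<^sup>2 / (2 * \<tau>) + G r + Kh \<delta> r) c"
proof -
  interpret R: reaction "\<lambda>r. r / \<tau> + g r" "\<lambda>r. r\<^sup>2 / (2 * \<tau>) + G r" c by (rule reaction_g)
  show ?thesis
  proof
    show "0 < c" by (rule c_pos)
    show "continuous_on UNIV (\<lambda>r. r / \<tau> + g r + K \<delta> r)"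
      by (intro continuous_on_add[OF R.k_continuous] K_continuous assms)
    show "mono (\<lambda>r. r / \<tau> + g r + K \<delta> r - c * r)"
    proof (rule monoI)
      fix x y :: real assume "x \<le> y"
      then show "x / \<tau> + g x + K \<delta> x - c * x \<le> y / \<tau> + g y + K \<delta> y - c * y"
        using monoD[OF R.k_mono \<open>x \<le> y\<close>] monoD[OF K_mono[OF assms] \<open>x \<le> y\<close>] by simp
    qed
    show "((\<lambda>r. r\<^sup>2 / (2 * \<tau>) + G r + Kh \<delta> r) has_real_derivative r / \<tau> + g r + K \<delta> r) (at r)" for r
      by (intro DERIV_add[OF R.\<kappa>_deriv] Kh_deriv assms)
  qed
qed

lemma Kh_tangent:
  assumes "\<delta> \<noteq> 0"
  shows "Kh \<delta> a + K \<delta> a * (b - a) \<le> Kh \<delta> b"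
proof -
  have "convex_on UNIV (Kh \<delta>)"
    by (rule convex_on_realI[of UNIV "Kh \<delta>" "K \<delta>"]) (use Kh_deriv K_mono assms in \<open>auto simp: mono_def\<close>)
  then have "Kh \<delta> b - Kh \<delta> a \<ge> K \<delta> a * (b - a)"
    by (rule convex_on_imp_above_tangent[of UNIV]) (use Kh_deriv assms in auto)
  then show ?thesis by simp
qed

text \<open>The convexity of \<open>r\<^sup>2/(2\<tau>) + G r - c r\<^sup>2/2 = G r + C\<^sub>g r\<^sup>2/2\<close>, written as a tangent inequality.\<close>

lemma G_semiconvex: "G a - G b \<le> g a * (a - b) + C\<^sub>g / 2 * (a - b)\<^sup>2"
proof -
  interpret R: reaction "\<lambda>r. r / \<tau> + g r" "\<lambda>r. r\<^sup>2 / (2 * \<tau>) + G r" c by (rule reaction_g)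
  have "a\<^sup>2 / (2 * \<tau>) + G a + (a / \<tau> + g a) * (b - a) + c / 2 * (b - a)\<^sup>2 \<le> b\<^sup>2 / (2 * \<tau>) + G b"
    by (rule R.\<kappa>_tangent)
  moreover have "a\<^sup>2 / (2 * \<tau>) + (a / \<tau> + g a) * (b - a) + c / 2 * (b - a)\<^sup>2 - b\<^sup>2 / (2 * \<tau>)
      = - (g a * (a - b)) - C\<^sub>g / 2 * (a - b)\<^sup>2"
    using \<tau> by (simp add: c_def power2_eq_square field_simps)
  ultimately show ?thesis by linarith
qed

text \<open>\<open>adm\<close> is the effective domain of the extended-valued potential \<open>Khat\<close> and \<open>Kr\<close> its real value there,
  so that \<open>\<delta> = 0\<close> and \<open>\<delta> > 0\<close> can be treated together.\<close>

definition adm :: "real \<Rightarrow> bool" where "adm z \<longleftrightarrow> (\<delta> = 0 \<longrightarrow> \<bar>z\<bar> \<le> 1)"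

definition Kr :: "real \<Rightarrow> real" where "Kr z = (if \<delta> = 0 then 0 else Kh \<delta> z)"

lemma Khat_eq: "Khat Kh \<delta> z = (if adm z then ereal (Kr z) else \<infinity>)"
  by (auto simp: Khat_def convex_indicator_def adm_def Kr_def)

lemma Kr_nonneg: "0 \<le> Kr z"
  by (simp add: Kr_def Kh_nonneg)

lemma Kr_continuous: "continuous_on UNIV Kr"
proof (cases "\<delta> = 0")
  case False
  have "continuous_on UNIV (Kh \<delta>)" by (rule DERIV_continuous_on) (use Kh_deriv False in auto)
  then show ?thesis using False by (simp add: Kr_def[abs_def])
qed (unfold Kr_def[abs_def], simp)

lemma Kset_subgradient:
  assumes "\<xi> \<in> Kset K \<delta> a" "adm b"
  shows "\<xi> * (b - a) \<le> Kr b - Kr a"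
proof (cases "\<delta> = 0")
  case True
  then have "\<forall>y. convex_indicator {-1..1} a + ereal (\<xi> * (y - a)) \<le> convex_indicator {-1..1} y"
    and "\<bar>convex_indicator {-1..1} a\<bar> \<noteq> \<infinity>"
    using assms(1) by (simp_all add: Kset_def subdiff_def inner_real_def)
  note sub = this(1)[rule_format, of b] this(2)
  have Kr0: "Kr a = 0" "Kr b = 0" unfolding Kr_def using True by simp_all
  have "\<bar>b\<bar> \<le> 1" using assms(2) True unfolding adm_def by simp
  then show ?thesis
    unfolding Kr0 using sub
    by (auto simp: convex_indicator_def abs_le_iff zero_ereal_def split: if_splits)
next
  case False
  then show ?thesis using assms(1) Kh_tangent[of a b] by (simp add: Kset_def Kr_def)
qed

abbreviation "\<Psi> \<equiv> Psi L \<nu> f Kh \<epsilon> \<delta>"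
abbreviation "\<D> \<equiv> DPsi L \<nu> f Kh \<epsilon> \<delta>"

lemma continuous_prim_comp_L2:
  assumes "q \<in> L2 L" "continuous_on UNIV \<phi>"
  shows "(\<lambda>x. \<phi> (d + prim L q x)) \<in> L2 L"
  by (rule continuous_on_L2[OF continuous_on_compose2[OF assms(2) continuous_on_affine_prim[OF assms(1)]]]) simp

text \<open>On admissible functions the extended-valued functional is a real Lebesgue integral.\<close>

lemma Psi_prim:
  assumes z: "z \<in> borel_measurable (Om L)" and q: "q \<in> L2 L" and eq: "AE x in Om L. z x = d + prim L q x"
  shows "(AE x in Om L. adm (z x)) \<Longrightarrow>
      \<Psi> z = ereal ((LINT x|Om L. h (q x)) + (LINT x|Om L. Kr (d + prim L q x)))"
    and "\<Psi> z < \<infinity> \<Longrightarrow> AE x in Om L. adm (z x)"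
proof -
  have H1: "z \<in> H1 L" using H1_iff_prim[OF L] z q eq by auto
  note D = Dx_AE_eq[OF L z q eq]
  have m: "(\<lambda>x. d + prim L q x) \<in> L2 L" by (rule affine_prim_L2[OF q])
  have 1: "(\<integral>\<^sup>+x. ennreal (f \<epsilon> (Dx L z x)) \<partial>Om L) = ennreal (LINT x|Om L. f \<epsilon> (q x))"
  proof -
    have "(\<integral>\<^sup>+x. ennreal (f \<epsilon> (Dx L z x)) \<partial>Om L) = (\<integral>\<^sup>+x. ennreal (f \<epsilon> (q x)) \<partial>Om L)"
      by (rule nn_integral_cong_AE) (use D(1) in \<open>eventually_elim, simp\<close>)
    also have "\<dots> = ennreal (LINT x|Om L. f \<epsilon> (q x))"
      by (rule nn_integral_eq_integral[OF f_integrable[OF q]]) (simp add: f_nonneg)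
    finally show ?thesis .
  qed
  have 2: "(\<integral>\<^sup>+x. ennreal (\<bar>Dx L z x\<bar>\<^sup>2) \<partial>Om L) = ennreal (sqn L q)"
  proof -
    have "(\<integral>\<^sup>+x. ennreal (\<bar>Dx L z x\<bar>\<^sup>2) \<partial>Om L) = (\<integral>\<^sup>+x. ennreal ((q x)\<^sup>2) \<partial>Om L)"
      by (rule nn_integral_cong_AE) (use D(1) in \<open>eventually_elim, simp\<close>)
    also have "\<dots> = ennreal (sqn L q)"
      by (rule nn_integral_eq_integral[OF L2_sq[OF q]]) simp
    finally show ?thesis .
  qed
  have Psi: "\<Psi> z = ereal (LINT x|Om L. h (q x)) + enn2ereal (\<integral>\<^sup>+x. e2ennreal (Khat Kh \<delta> (z x)) \<partial>Om L)"
    unfolding Psi_def 1 2 using H1 f_integrable[OF q] L2_sq[OF q]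
    by (simp add: enn2ereal_ennreal Bochner_Integration.integral_nonneg f_nonneg h_def)
  show "\<Psi> z = ereal ((LINT x|Om L. h (q x)) + (LINT x|Om L. Kr (d + prim L q x)))"
    if adm: "AE x in Om L. adm (z x)"
  proof -
    have "(\<integral>\<^sup>+x. e2ennreal (Khat Kh \<delta> (z x)) \<partial>Om L) = (\<integral>\<^sup>+x. ennreal (Kr (d + prim L q x)) \<partial>Om L)"
      by (rule nn_integral_cong_AE) (use adm eq in \<open>eventually_elim, simp add: Khat_eq e2ennreal_ereal\<close>)
    also have "\<dots> = ennreal (LINT x|Om L. Kr (d + prim L q x))"
      by (rule nn_integral_eq_integral[OF L2_integrable[OF continuous_prim_comp_L2[OF q Kr_continuous]]])
        (simp add: Kr_nonneg)
    finally show ?thesis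
      unfolding Psi by (simp add: enn2ereal_ennreal Bochner_Integration.integral_nonneg Kr_nonneg)
  qed
  show "AE x in Om L. adm (z x)" if fin: "\<Psi> z < \<infinity>"
  proof (cases "\<delta> = 0")
    case True
    have "(\<integral>\<^sup>+x. e2ennreal (Khat Kh \<delta> (z x)) \<partial>Om L) \<noteq> \<infinity>"
      using fin unfolding Psi by auto
    moreover have "(\<lambda>x. e2ennreal (Khat Kh \<delta> (z x))) \<in> borel_measurable (Om L)"
    proof -
      have "(\<lambda>x. e2ennreal (Khat Kh \<delta> (z x))) = (\<lambda>x. if z x \<in> {-1..1} then 0 else \<infinity>)"
        using True by (auto simp: Khat_def convex_indicator_def fun_eq_iff e2ennreal_neg)
      then show ?thesis using z by simp
    qed
    ultimately have "AE x in Om L. e2ennreal (Khat Kh \<delta> (z x)) \<noteq> \<infinity>"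
      by (intro nn_integral_PInf_AE)
    then show ?thesis by eventually_elim (auto simp: Khat_eq split: if_splits)
  qed (simp add: adm_def)
qed

lemma DPsi_prim:
  assumes "z \<in> \<D>"
  obtains d q where "z \<in> borel_measurable (Om L)" "q \<in> L2 L" "AE x in Om L. z x = d + prim L q x"
    "AE x in Om L. adm (d + prim L q x)"
    "\<Psi> z = ereal ((LINT x|Om L. h (q x)) + (LINT x|Om L. Kr (d + prim L q x)))"
proof -
  have fin: "\<Psi> z < \<infinity>" using assms by (simp add: DPsi_def)
  then have "z \<in> H1 L" by (auto simp: Psi_def split: if_splits)
  then obtain d q where dq: "z \<in> borel_measurable (Om L)" "q \<in> L2 L" "AE x in Om L. z x = d + prim L q x"
    using H1_iff_prim[OF L] by auto
  have adm: "AE x in Om L. adm (z x)" by (rule Psi_prim(2)[OF dq fin])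
  then have "AE x in Om L. adm (d + prim L q x)" using dq(3) by eventually_elim simp
  then show ?thesis using that[OF dq] Psi_prim(1)[OF dq adm] by simp
qed

lemma DPsi_I:
  assumes z: "z \<in> borel_measurable (Om L)" and q: "q \<in> L2 L" and eq: "AE x in Om L. z x = d + prim L q x"
    and adm: "AE x in Om L. adm (z x)"
  shows "z \<in> \<D>"
  using Psi_prim(1)[OF assms] L2_cong_AE[OF affine_prim_L2[OF q] z eq] by (simp add: DPsi_def)

lemma comp_L2_of_DPsi:
  assumes "z \<in> \<D>" "continuous_on UNIV \<phi>"
  shows "(\<lambda>x. \<phi> (z x)) \<in> L2 L"
proof -
  obtain d q where z: "z \<in> borel_measurable (Om L)" "q \<in> L2 L" "AE x in Om L. z x = d + prim L q x"
    by (rule DPsi_prim[OF assms(1)])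
  show ?thesis
  proof (rule L2_cong_AE[OF continuous_prim_comp_L2[OF z(2) assms(2)]])
    show "(\<lambda>x. \<phi> (z x)) \<in> borel_measurable (Om L)"
      by (rule measurable_compose[OF z(1) borel_measurable_continuous_onI[OF assms(2)]])
    show "AE x in Om L. \<phi> (z x) = \<phi> (d + prim L q x)" using z(3) by eventually_elim simp
  qed
qed

lemma DPsi_L2: "z \<in> \<D> \<Longrightarrow> z \<in> L2 L"
  by (simp add: DPsi_def)

definition path :: "real \<Rightarrow> (real \<Rightarrow> real) \<Rightarrow> real \<Rightarrow> real" where
  "path d r x = d + prim L (\<lambda>y. \<beta> (prim L r y)) x"

text \<open>The pointwise form of one time step; \<open>r\<close> is the derivative of the flux \<open>prim L r\<close>.\<close>

definition strong_step ::
    "(real \<Rightarrow> real) \<Rightarrow> (real \<Rightarrow> real) \<Rightarrow> real \<Rightarrow> (real \<Rightarrow> real) \<Rightarrow> (real \<Rightarrow> real) \<Rightarrow> bool" where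
  "strong_step v u d r \<xi> \<longleftrightarrow> r \<in> L2 L \<and> \<xi> \<in> L2 L \<and> prim L r L = 0 \<and>
     (AE x in Om L. adm (path d r x)) \<and> (AE x in Om L. \<xi> x \<in> Kset K \<delta> (path d r x)) \<and>
     (AE x in Om L. r x = 1 / \<tau> * (path d r x - v x) + (g (path d r x) - u x) + \<xi> x)"

lemma path_continuous: "r \<in> L2 L \<Longrightarrow> continuous_on S (path d r)"
  unfolding path_def[abs_def] by (rule continuous_on_affine_prim[OF \<beta>_prim_L2])

lemma path_measurable: "r \<in> L2 L \<Longrightarrow> path d r \<in> borel_measurable (Om L)"
  by (rule continuous_on_borel_measurable_Om[OF path_continuous])

lemma path_comp_L2: "r \<in> L2 L \<Longrightarrow> continuous_on UNIV \<phi> \<Longrightarrow> (\<lambda>x. \<phi> (path d r x)) \<in> L2 L"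
  unfolding path_def by (rule continuous_prim_comp_L2[OF \<beta>_prim_L2])

text \<open>For \<open>\<delta> = 0\<close> the multiplier is read off from the limit of the penalised problems: its sign on the two
  contact sets is the subgradient condition for the indicator function.\<close>

lemma strong_step_exists:
  assumes v: "v \<in> L2 L" and u: "u \<in> L2 L"
  shows "\<exists>d r \<xi>. strong_step v u d r \<xi>"
proof -
  define F where "F x = u x + 1 / \<tau> * v x" for x
  have F: "F \<in> L2 L" unfolding F_def by (intro L2_add u L2_cmult v)
  show ?thesis
  proof (cases "\<delta> = 0")
    case True
    interpret R: reaction "\<lambda>r. r / \<tau> + g r" "\<lambda>r. r\<^sup>2 / (2 * \<tau>) + G r" c by (rule reaction_g)
    interpret S: semilinear "f \<epsilon>" \<nu> C\<^sub>f "\<lambda>r. r / \<tau> + g r" "\<lambda>r. r\<^sup>2 / (2 * \<tau>) + G r" c L F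
      by unfold_locales (rule L F)+
    obtain d r where r: "r \<in> L2 L" "prim L r L = 0"
      and w: "AE x in Om L. \<bar>path d r x\<bar> \<le> 1"
        "AE x in Om L. path d r x < 1 \<longrightarrow> r x - (path d r x / \<tau> + g (path d r x)) + F x \<le> 0"
        "AE x in Om L. -1 < path d r x \<longrightarrow> 0 \<le> r x - (path d r x / \<tau> + g (path d r x)) + F x"
      unfolding path_def by (rule S.obstacle_solution_exists)
    define \<xi> where "\<xi> x = (r x - (path d r x / \<tau> + g (path d r x))) + F x" for x
    have "\<xi> \<in> L2 L"
      unfolding \<xi>_def by (intro L2_add L2_diff r F path_comp_L2[OF r(1) R.k_continuous])
    moreover have "AE x in Om L. \<xi> x \<in> Kset K \<delta> (path d r x)"
      using w
    proof eventually_elim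
      case (elim x)
      have "\<xi> x * (y - path d r x) \<le> 0" if "y \<in> {-1..1}" for y
      proof -
        consider "path d r x = 1" | "path d r x = -1" | "\<bar>path d r x\<bar> < 1" using elim(1) by linarith
        then show ?thesis
        proof cases
          case 1
          then have "0 \<le> \<xi> x" using elim(3) by (simp add: \<xi>_def)
          then show ?thesis using 1 that by (intro mult_nonneg_nonpos) auto
        next
          case 2
          then have "\<xi> x \<le> 0" using elim(2) by (simp add: \<xi>_def)
          then show ?thesis using 2 that by (intro mult_nonpos_nonneg) auto
        next
          case 3
          then have "\<xi> x = 0" using elim(2,3) unfolding \<xi>_def by linarith
          then show ?thesis by simp
        qed
      qed
      then show ?case
        using True elim(1)
        by (auto simp: Kset_def subdiff_def convex_indicator_def inner_real_def abs_le_iff zero_ereal_def)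
    qed
    moreover have "AE x in Om L. adm (path d r x)" using w(1) by (simp add: adm_def)
    moreover have "r x = 1 / \<tau> * (path d r x - v x) + (g (path d r x) - u x) + \<xi> x" for x
      using \<tau> by (simp add: \<xi>_def F_def field_simps)
    ultimately have "strong_step v u d r \<xi>" unfolding strong_step_def using r by blast
    then show ?thesis by blast
  next
    case False
    interpret R: reaction "\<lambda>r. r / \<tau> + g r + K \<delta> r" "\<lambda>r. r\<^sup>2 / (2 * \<tau>) + G r + Kh \<delta> r" c
      by (rule reaction_gK[OF False])
    interpret S: semilinear "f \<epsilon>" \<nu> C\<^sub>f "\<lambda>r. r / \<tau> + g r + K \<delta> r" "\<lambda>r. r\<^sup>2 / (2 * \<tau>) + G r + Kh \<delta> r" c L F
      by unfold_locales (rule L F)+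
    obtain d r where r: "r \<in> L2 L" "prim L r L = 0"
      and eq: "AE x in Om L. r x = path d r x / \<tau> + g (path d r x) + K \<delta> (path d r x) - F x"
      unfolding path_def by (rule S.solution_exists)
    have "AE x in Om L. r x = 1 / \<tau> * (path d r x - v x) + (g (path d r x) - u x) + K \<delta> (path d r x)"
      using eq by eventually_elim (simp add: F_def diff_divide_distrib)
    then have "strong_step v u d r (\<lambda>x. K \<delta> (path d r x))"
      unfolding strong_step_def using r False path_comp_L2[OF r(1) K_continuous[OF False]]
      by (auto simp: adm_def Kset_def)
    then show ?thesis by blast
  qed
qed

text \<open>One line of \<open>AC_solution\<close>, with the factor \<open>M\<^sub>u\<close> absorbed into the forcing.\<close>

definition VI :: "(real \<Rightarrow> real) \<Rightarrow> (real \<Rightarrow> real) \<Rightarrow> (real \<Rightarrow> real) \<Rightarrow> bool" where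
  "VI v u w \<longleftrightarrow> w \<in> \<D> \<and> (\<forall>z\<in>\<D>.
     ereal (1 / \<tau> * L2_inner L (\<lambda>x. w x - v x) (\<lambda>x. w x - z x)
       + L2_inner L (\<lambda>x. g (w x) - u x) (\<lambda>x. w x - z x)) + \<Psi> w - \<Psi> z \<le> 0)"

lemma strong_step_DPsi:
  assumes "strong_step v u d r \<xi>"
  shows "path d r \<in> \<D>"
    and "\<Psi> (path d r) = ereal ((LINT x|Om L. h (\<beta> (prim L r x))) + (LINT x|Om L. Kr (path d r x)))"
proof -
  have r: "r \<in> L2 L" and adm: "AE x in Om L. adm (path d r x)" using assms by (auto simp: strong_step_def)
  have eq: "AE x in Om L. path d r x = d + prim L (\<lambda>y. \<beta> (prim L r y)) x" by (simp add: path_def)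
  show "path d r \<in> \<D>" by (rule DPsi_I[OF path_measurable[OF r] \<beta>_prim_L2[OF r] eq adm])
  show "\<Psi> (path d r) = ereal ((LINT x|Om L. h (\<beta> (prim L r x))) + (LINT x|Om L. Kr (path d r x)))"
    using Psi_prim(1)[OF path_measurable[OF r] \<beta>_prim_L2[OF r] eq adm] by (simp add: path_def[abs_def])
qed

text \<open>The flux term is integrated by parts and estimated by \<open>H (q - w') \<le> h q - h w'\<close>, the multiplier
  term by the subgradient inequality for the potential.\<close>

lemma strong_step_VI:
  assumes s: "strong_step v u d r \<xi>" and v: "v \<in> L2 L" and u: "u \<in> L2 L"
  shows "VI v u (path d r)"
  unfolding VI_def
proof (intro conjI ballI strong_step_DPsi(1)[OF s])
  fix z assume "z \<in> \<D>"
  then obtain dz q where z: "z \<in> borel_measurable (Om L)" "q \<in> L2 L" "AE x in Om L. z x = dz + prim L q x"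
    "AE x in Om L. adm (dz + prim L q x)"
    "\<Psi> z = ereal ((LINT x|Om L. h (q x)) + (LINT x|Om L. Kr (dz + prim L q x)))"
    by (rule DPsi_prim)
  have r: "r \<in> L2 L" and \<xi>: "\<xi> \<in> L2 L" and rL: "prim L r L = 0"
    and inc: "AE x in Om L. \<xi> x \<in> Kset K \<delta> (path d r x)"
    and eq: "AE x in Om L. r x = 1 / \<tau> * (path d r x - v x) + (g (path d r x) - u x) + \<xi> x"
    using s by (auto simp: strong_step_def)
  define w where "w = path d r"
  define y where "y x = dz + prim L q x" for x
  define p where "p x = \<beta> (prim L r x)" for x
  have p: "p \<in> L2 L" unfolding p_def by (rule \<beta>_prim_L2[OF r])
  have w: "w \<in> L2 L" unfolding w_def by (rule continuous_on_L2[OF path_continuous[OF r]])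
  have gw: "(\<lambda>x. g (w x)) \<in> L2 L" unfolding w_def by (rule path_comp_L2[OF r g_continuous])
  have y: "y \<in> L2 L" unfolding y_def by (rule affine_prim_L2[OF z(2)])
  have Hc: "prim L r \<in> L2 L" using affine_prim_L2[OF r, of 0] by simp
  have wy: "(\<lambda>x. w x - y x) \<in> L2 L" by (intro L2_diff w y)
  have wv: "(\<lambda>x. w x - v x) \<in> L2 L" by (intro L2_diff w v)
  have gu: "(\<lambda>x. g (w x) - u x) \<in> L2 L" by (intro L2_diff gw u)
  have Krw: "integrable (Om L) (\<lambda>x. Kr (w x))" "integrable (Om L) (\<lambda>x. Kr (y x))"
    unfolding w_def y_def
    by (intro L2_integrable path_comp_L2 continuous_prim_comp_L2 r z Kr_continuous)+
  have inner: "L2_inner L a (\<lambda>x. w x - z x) = (LINT x|Om L. a x * (w x - y x))" if "a \<in> L2 L" for a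
    unfolding L2_inner_def
  proof (rule integral_cong_AE)
    show "AE x in Om L. a x * (w x - z x) = a x * (w x - y x)"
      using z(3) by eventually_elim (simp add: y_def)
  qed (use L2_meas[OF that] L2_meas[OF w] L2_meas[OF y] z(1) in auto)
  have wyeq: "w x - y x = (d - dz) + prim L (\<lambda>x. p x - q x) x" for x
    unfolding w_def path_def y_def p_def by (rule affine_prim_diff[OF \<beta>_prim_L2[OF r] z(2)])
  have "(LINT x|Om L. r x * (w x - y x)) = - (LINT x|Om L. prim L r x * (p x - q x))"
    unfolding wyeq by (rule integral_by_parts[OF L2_integrable[OF L2_diff[OF p z(2)]] L2_integrable[OF r] rL])
  also have "\<dots> = (LINT x|Om L. prim L r x * (q x - p x))"
    by (simp add: right_diff_distrib flip: Bochner_Integration.integral_minus)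
  also have "\<dots> \<le> (LINT x|Om L. h (q x) - h (p x))"
  proof (rule integral_mono)
    show "integrable (Om L) (\<lambda>x. prim L r x * (q x - p x))" by (intro L2_mult_integrable Hc L2_diff z p)
    show "integrable (Om L) (\<lambda>x. h (q x) - h (p x))"
      by (intro Bochner_Integration.integrable_diff h_integrable z p)
    fix x
    show "prim L r x * (q x - p x) \<le> h (q x) - h (p x)"
      using subgrad_f_imp_h[OF subgrad_\<beta>, of "prim L r x", unfolded subgrad_def, THEN spec, of "q x"]
      by (simp add: p_def)
  qed
  also have "\<dots> = (LINT x|Om L. h (q x)) - (LINT x|Om L. h (p x))"
    using z p by (simp add: h_integrable)
  finally have flux: "(LINT x|Om L. r x * (w x - y x)) \<le> (LINT x|Om L. h (q x)) - (LINT x|Om L. h (p x))" .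
  have "(LINT x|Om L. r x * (w x - y x)) =
      (LINT x|Om L. 1 / \<tau> * ((w x - v x) * (w x - y x)) + (g (w x) - u x) * (w x - y x) + \<xi> x * (w x - y x))"
  proof (rule integral_cong_AE)
    show "AE x in Om L. r x * (w x - y x) =
        1 / \<tau> * ((w x - v x) * (w x - y x)) + (g (w x) - u x) * (w x - y x) + \<xi> x * (w x - y x)"
      using eq
    proof eventually_elim
      case (elim x)
      show ?case unfolding elim w_def by (simp only: distrib_right mult.assoc)
    qed
  qed (use L2_meas[OF r] L2_meas[OF wy] L2_meas[OF wv] L2_meas[OF gu] L2_meas[OF \<xi>] in auto)
  also have "\<dots> = 1 / \<tau> * (LINT x|Om L. (w x - v x) * (w x - y x))
      + (LINT x|Om L. (g (w x) - u x) * (w x - y x)) + (LINT x|Om L. \<xi> x * (w x - y x))"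
    using L2_mult_integrable[OF wv wy] L2_mult_integrable[OF gu wy] L2_mult_integrable[OF \<xi> wy] by simp
  finally have split: "(LINT x|Om L. r x * (w x - y x)) = \<dots>" .
  have "(LINT x|Om L. Kr (w x) - Kr (y x)) \<le> (LINT x|Om L. \<xi> x * (w x - y x))"
  proof (rule integral_mono_AE)
    show "AE x in Om L. Kr (w x) - Kr (y x) \<le> \<xi> x * (w x - y x)"
      using inc z(4)
    proof eventually_elim
      case (elim x)
      have "\<xi> x * (y x - w x) \<le> Kr (y x) - Kr (w x)"
        unfolding w_def y_def by (rule Kset_subgradient[OF elim])
      then show ?case by (simp add: right_diff_distrib)
    qed
  qed (use Krw L2_mult_integrable[OF \<xi> wy] in auto)
  then have "(LINT x|Om L. Kr (w x)) - (LINT x|Om L. Kr (y x)) \<le> (LINT x|Om L. \<xi> x * (w x - y x))"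
    using Krw by simp
  with flux split have "1 / \<tau> * (LINT x|Om L. (w x - v x) * (w x - y x))
      + (LINT x|Om L. (g (w x) - u x) * (w x - y x))
      + ((LINT x|Om L. h (p x)) + (LINT x|Om L. Kr (w x)))
      - ((LINT x|Om L. h (q x)) + (LINT x|Om L. Kr (y x))) \<le> 0"
    by linarith
  then show "ereal (1 / \<tau> * L2_inner L (\<lambda>x. path d r x - v x) (\<lambda>x. path d r x - z x)
       + L2_inner L (\<lambda>x. g (path d r x) - u x) (\<lambda>x. path d r x - z x)) + \<Psi> (path d r) - \<Psi> z \<le> 0"
    using inner[OF wv] inner[OF gu]
    unfolding strong_step_DPsi(2)[OF s] z(5) w_def y_def p_def by simp
qed

lemma VI_real:
  assumes "VI v u w" "z \<in> \<D>"
  obtains a b where "\<Psi> w = ereal a" "\<Psi> z = ereal b"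
    "1 / \<tau> * (LINT x|Om L. (w x - v x) * (w x - z x)) + (LINT x|Om L. (g (w x) - u x) * (w x - z x)) + a - b \<le> 0"
proof -
  have w: "w \<in> \<D>" using assms by (simp add: VI_def)
  obtain a where a: "\<Psi> w = ereal a" using DPsi_prim[OF w] by metis
  obtain b where b: "\<Psi> z = ereal b" using DPsi_prim[OF assms(2)] by metis
  have "ereal (1 / \<tau> * L2_inner L (\<lambda>x. w x - v x) (\<lambda>x. w x - z x)
       + L2_inner L (\<lambda>x. g (w x) - u x) (\<lambda>x. w x - z x)) + \<Psi> w - \<Psi> z \<le> 0"
    using assms by (simp add: VI_def)
  then show ?thesis using that[OF a b] unfolding a b L2_inner_def by simp
qed

text \<open>Each solution is tested with the other; the convex functionals cancel and the strong monotonicity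
  of \<open>r/\<tau> + g r\<close> remains.\<close>

lemma VI_unique:
  assumes w: "VI v u w" and w': "VI v' u w'" and vv: "AE x in Om L. v x = v' x"
    and v: "v \<in> L2 L" and v': "v' \<in> L2 L" and u: "u \<in> L2 L"
  shows "AE x in Om L. w x = w' x"
proof -
  have D: "w \<in> \<D>" "w' \<in> \<D>" using w w' by (auto simp: VI_def)
  have wL: "w \<in> L2 L" "w' \<in> L2 L" and gL: "(\<lambda>x. g (w x)) \<in> L2 L" "(\<lambda>x. g (w' x)) \<in> L2 L"
    using D DPsi_L2 comp_L2_of_DPsi[OF _ g_continuous] by auto
  have dL: "(\<lambda>x. w x - w' x) \<in> L2 L" "(\<lambda>x. w' x - w x) \<in> L2 L" by (intro L2_diff wL)+
  have vL: "(\<lambda>x. w x - v x) \<in> L2 L" "(\<lambda>x. w' x - v' x) \<in> L2 L" by (intro L2_diff wL v v')+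
  have uL: "(\<lambda>x. g (w x) - u x) \<in> L2 L" "(\<lambda>x. g (w' x) - u x) \<in> L2 L" by (intro L2_diff gL u)+
  obtain a b where 1: "\<Psi> w = ereal a" "\<Psi> w' = ereal b"
    "1 / \<tau> * (LINT x|Om L. (w x - v x) * (w x - w' x)) + (LINT x|Om L. (g (w x) - u x) * (w x - w' x)) + a - b \<le> 0"
    by (rule VI_real[OF w D(2)])
  obtain b' a' where 2: "\<Psi> w' = ereal b'" "\<Psi> w = ereal a'"
    "1 / \<tau> * (LINT x|Om L. (w' x - v' x) * (w' x - w x)) + (LINT x|Om L. (g (w' x) - u x) * (w' x - w x)) + b' - a' \<le> 0"
    by (rule VI_real[OF w' D(1)])
  note i = L2_mult_integrable[OF vL(1) dL(1)] L2_mult_integrable[OF vL(2) dL(2)]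
    L2_mult_integrable[OF uL(1) dL(1)] L2_mult_integrable[OF uL(2) dL(2)]
  have "(LINT x|Om L. c * (w x - w' x)\<^sup>2) \<le>
     (LINT x|Om L. 1 / \<tau> * ((w x - v x) * (w x - w' x)) + 1 / \<tau> * ((w' x - v' x) * (w' x - w x))
       + ((g (w x) - u x) * (w x - w' x) + (g (w' x) - u x) * (w' x - w x)))"
  proof (rule integral_mono_AE)
    show "AE x in Om L. c * (w x - w' x)\<^sup>2 \<le>
       1 / \<tau> * ((w x - v x) * (w x - w' x)) + 1 / \<tau> * ((w' x - v' x) * (w' x - w x))
       + ((g (w x) - u x) * (w x - w' x) + (g (w' x) - u x) * (w' x - w x))"
      using vv
    proof eventually_elim
      case (elim x)
      have "1 / \<tau> * ((w x - v x) * (w x - w' x)) + 1 / \<tau> * ((w' x - v' x) * (w' x - w x)) = 1 / \<tau> * (w x - w' x)\<^sup>2"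
        unfolding elim distrib_left[symmetric] by (simp add: power2_eq_square algebra_simps)
      moreover have "(g (w x) - u x) * (w x - w' x) + (g (w' x) - u x) * (w' x - w x)
          = (g (w x) - g (w' x)) * (w x - w' x)"
        by (simp add: algebra_simps)
      moreover have "c * (w x - w' x)\<^sup>2 = 1 / \<tau> * (w x - w' x)\<^sup>2 + - C\<^sub>g * (w x - w' x)\<^sup>2"
        by (simp add: c_def left_diff_distrib)
      ultimately show ?case using g_strong_mono[of "w x" "w' x"] by linarith
    qed
  qed (use i L2_sq[OF dL(1)] in auto)
  also have "\<dots> = 1 / \<tau> * (LINT x|Om L. (w x - v x) * (w x - w' x)) + 1 / \<tau> * (LINT x|Om L. (w' x - v' x) * (w' x - w x))
       + ((LINT x|Om L. (g (w x) - u x) * (w x - w' x)) + (LINT x|Om L. (g (w' x) - u x) * (w' x - w x)))"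
    using i by simp
  also have "\<dots> \<le> 0" using 1 2 by simp
  finally have "c * sqn L (\<lambda>x. w x - w' x) \<le> 0" by simp
  then have "sqn L (\<lambda>x. w x - w' x) = 0"
    using c_pos sqn_nonneg[of L "\<lambda>x. w x - w' x"] by (simp add: mult_le_0_iff order.antisym)
  then have "AE x in Om L. (w x - w' x)\<^sup>2 = 0"
    by (subst (asm) integral_nonneg_eq_0_iff_AE) (use L2_sq[OF dL(1)] in auto)
  then show ?thesis by eventually_elim simp
qed

lemma G_continuous: "continuous_on UNIV G"
  by (rule DERIV_continuous_on) (use G_deriv in auto)

text \<open>Comparison with the previous time level \<open>z = v\<close>; the factor \<open>1/(2\<tau>)\<close> survives because the
  concave part of \<open>G\<close> and the forcing each cost at most \<open>1/(4\<tau>)\<close>.\<close>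

lemma VI_energy:
  assumes w: "VI v u w" and v: "v \<in> L2 L" and u: "u \<in> L2 L"
  shows "ereal (1 / (2 * \<tau>) * (L2_norm L (\<lambda>x. w x - v x))\<^sup>2)
      + Energy L \<nu> f Kh G \<epsilon> \<delta> w - Energy L \<nu> f Kh G \<epsilon> \<delta> v \<le> ereal (\<tau> * (L2_norm L u)\<^sup>2)"
proof -
  have norm2: "(L2_norm L a)\<^sup>2 = sqn L a" for a
    by (simp add: L2_norm_def L2_inner_def power2_eq_square Bochner_Integration.integral_nonneg)
  have GE: "(\<integral>\<^sup>+x. ennreal (G (z x)) \<partial>Om L) = ennreal (LINT x|Om L. G (z x))" if "z \<in> \<D>" for z
    by (rule nn_integral_eq_integral[OF L2_integrable[OF comp_L2_of_DPsi[OF that G_continuous]]]) (simp add: G_nonneg)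
  have D: "w \<in> \<D>" using w by (simp add: VI_def)
  have Ew: "Energy L \<nu> f Kh G \<epsilon> \<delta> z = ereal (a + (LINT x|Om L. G (z x)))" if "z \<in> \<D>" "\<Psi> z = ereal a" for z a
    using that by (simp add: Energy_def GE enn2ereal_ennreal Bochner_Integration.integral_nonneg G_nonneg)
  show ?thesis
  proof (cases "v \<in> \<D>")
    case True
    obtain a b where ab: "\<Psi> w = ereal a" "\<Psi> v = ereal b"
      "1 / \<tau> * (LINT x|Om L. (w x - v x) * (w x - v x)) + (LINT x|Om L. (g (w x) - u x) * (w x - v x)) + a - b \<le> 0"
      by (rule VI_real[OF w True])
    have dL: "(\<lambda>x. w x - v x) \<in> L2 L" by (intro L2_diff DPsi_L2 D True)
    have uL: "(\<lambda>x. g (w x) - u x) \<in> L2 L" by (intro L2_diff comp_L2_of_DPsi[OF D g_continuous] u)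
    have GL: "integrable (Om L) (\<lambda>x. G (w x))" "integrable (Om L) (\<lambda>x. G (v x))"
      by (intro L2_integrable comp_L2_of_DPsi D True G_continuous)+
    note i = L2_sq[OF dL] L2_mult_integrable[OF uL dL] L2_sq[OF u] GL
    have "(LINT x|Om L. G (w x) - G (v x)) \<le>
      (LINT x|Om L. (g (w x) - u x) * (w x - v x) + 1 / (2 * \<tau>) * (w x - v x)\<^sup>2 + \<tau> * (u x)\<^sup>2)"
    proof (rule integral_mono)
      fix x
      let ?d = "w x - v x"
      \<comment> \<open>Young's inequality with the weight that leaves \<open>1/(4\<tau>)\<close> for the concave part of \<open>G\<close>.\<close>
      have "0 \<le> (2 * \<tau> * u x - ?d)\<^sup>2 / (4 * \<tau>)" using \<tau> by simp
      also have "\<dots> = \<tau> * (u x)\<^sup>2 - u x * ?d + 1 / (4 * \<tau>) * ?d\<^sup>2"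
        using \<tau> by (simp add: power2_eq_square field_simps)
      finally have "u x * ?d \<le> \<tau> * (u x)\<^sup>2 + 1 / (4 * \<tau>) * ?d\<^sup>2" by simp
      moreover have "C\<^sub>g / 2 * ?d\<^sup>2 \<le> 1 / (4 * \<tau>) * ?d\<^sup>2"
        using \<tau>_small \<tau> by (intro mult_right_mono) (simp_all add: field_simps)
      moreover have "G (w x) - G (v x) \<le> g (w x) * ?d + C\<^sub>g / 2 * ?d\<^sup>2" by (rule G_semiconvex)
      moreover have "1 / (2 * \<tau>) * ?d\<^sup>2 = 1 / (4 * \<tau>) * ?d\<^sup>2 + 1 / (4 * \<tau>) * ?d\<^sup>2"
        by (simp add: field_simps)
      ultimately show "G (w x) - G (v x) \<le> (g (w x) - u x) * ?d + 1 / (2 * \<tau>) * ?d\<^sup>2 + \<tau> * (u x)\<^sup>2"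
        unfolding left_diff_distrib by linarith
    qed (use i in auto)
    also have "\<dots> = (LINT x|Om L. (g (w x) - u x) * (w x - v x)) + 1 / (2 * \<tau>) * sqn L (\<lambda>x. w x - v x) + \<tau> * sqn L u"
      using i by simp
    finally have G: "(LINT x|Om L. G (w x)) - (LINT x|Om L. G (v x)) \<le> \<dots>" using GL by simp
    have sq: "(LINT x|Om L. (w x - v x) * (w x - v x)) = sqn L (\<lambda>x. w x - v x)"
      by (simp add: power2_eq_square)
    have half: "1 / \<tau> * S = 1 / (2 * \<tau>) * S + 1 / (2 * \<tau>) * S" for S :: real
      by simp
    have "1 / (2 * \<tau>) * sqn L (\<lambda>x. w x - v x) + (a + (LINT x|Om L. G (w x))) - (b + (LINT x|Om L. G (v x)))
        \<le> \<tau> * sqn L u"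
      using ab(3)[unfolded sq half] G by linarith
    then show ?thesis
      unfolding Ew[OF D ab(1)] Ew[OF True ab(2)] norm2 by simp
  next
    case False
    then have "\<Psi> v = \<infinity>" using v by (auto simp: DPsi_def less_top[symmetric] top_ereal_def)
    then have "Energy L \<nu> f Kh G \<epsilon> \<delta> v = \<infinity>" by (simp add: Energy_def)
    moreover obtain a where "\<Psi> w = ereal a" using DPsi_prim[OF D] by metis
    ultimately show ?thesis by (simp add: Ew[OF D])
  qed
qed

text \<open>Everything is a function of the flux \<open>H = prim L r\<close>: \<open>w' = \<beta>(H)\<close> and
  \<open>\<omega> = H - \<nu>\<^sup>2 \<beta>(H)\<close>.\<close>

lemma strong_step_regular:
  assumes s: "strong_step v u d r \<xi>"
  shows "path d r \<in> H1 L" "path d r \<in> H2 L"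
    "has_value_at L (Dx L (path d r)) (-L) 0" "has_value_at L (Dx L (path d r)) L 0"
    "\<exists>\<omega>. \<omega> \<in> H1 L \<inter> Linf L \<and>
       (AE x in Om L. 1 / \<tau> * (path d r x - v x) - Dx L \<omega> x - \<nu>\<^sup>2 * Dx L (Dx L (path d r)) x
          + \<xi> x + g (path d r x) = u x) \<and>
       (AE x in Om L. \<omega> x \<in> subdiff (\<lambda>r. ereal (f \<epsilon> r)) (Dx L (path d r) x))"
proof -
  have r: "r \<in> L2 L" and rL: "prim L r L = 0"
    and eq: "AE x in Om L. r x = 1 / \<tau> * (path d r x - v x) + (g (path d r x) - u x) + \<xi> x"
    using s by (auto simp: strong_step_def)
  let ?w = "path d r" and ?p = "\<lambda>x. \<beta> (prim L r x)"
  have weq: "AE x in Om L. ?w x = d + prim L ?p x" by (simp add: path_def)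
  note wm = path_measurable[OF r, of d]
  note D = Dx_AE_eq[OF L wm \<beta>_prim_L2[OF r] weq]
  show H1: "?w \<in> H1 L" using H1_iff_prim[OF L] wm \<beta>_prim_L2[OF r] weq by blast
  obtain l where l: "l \<in> L2 L" "\<And>x. x \<in> {-L..L} \<Longrightarrow> ?p x = prim L l x"
    by (rule \<beta>_prim_is_prim[OF L r]) (rule that)
  have pl: "AE x in Om L. ?p x = prim L l x" by (rule AE_I2) (simp add: l(2))
  have Dl: "AE x in Om L. Dx L ?w x = 0 + prim L l x" using D(1) pl by eventually_elim simp
  have DH1: "Dx L ?w \<in> H1 L" using H1_iff_prim[OF L] L2_meas[OF D(2)] l(1) Dl by blast
  then show "?w \<in> H2 L" using H1 by (simp add: H2_def)
  note DD = Dx_AE_eq[OF L L2_meas[OF D(2)] l(1) Dl]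
  have pc: "continuous_on {-L..L} ?p" by (rule \<beta>_prim_continuous[OF L2_integrable[OF r]])
  have pD: "AE x in Om L. ?p x = Dx L ?w x" using D(1) by eventually_elim simp
  show "has_value_at L (Dx L ?w) (-L) 0" "has_value_at L (Dx L ?w) L 0"
    unfolding has_value_at_def using pc pD L rL \<beta>_0
    by (auto intro!: exI[of _ ?p] simp: prim_left)
  define \<omega> where "\<omega> x = prim L r x - \<nu>\<^sup>2 * ?p x" for x
  have rl: "(\<lambda>x. r x - \<nu>\<^sup>2 * l x) \<in> L2 L" by (intro L2_diff L2_cmult r l)
  have \<omega>c: "continuous_on {-L..L} \<omega>"
    unfolding \<omega>_def by (intro continuous_intros continuous_on_prim L2_integrable r pc)
  note \<omega>m = continuous_on_borel_measurable_Om[OF \<omega>c]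
  have \<omega>eq: "AE x in Om L. \<omega> x = 0 + prim L (\<lambda>x. r x - \<nu>\<^sup>2 * l x) x"
    using pl
  proof eventually_elim
    case (elim x)
    then show ?case
      using prim_diff[OF L2_integrable[OF r] L2_integrable[OF L2_cmult[OF l(1)]], of "\<nu>\<^sup>2" x] prim_cmult[of L "\<nu>\<^sup>2" l x]
      by (simp add: \<omega>_def)
  qed
  have "bounded (\<omega> ` {-L..L})" by (intro compact_imp_bounded compact_continuous_image \<omega>c) simp
  then obtain B where "\<forall>x\<in>{-L..L}. \<bar>\<omega> x\<bar> \<le> B" by (auto simp: bounded_iff)
  then have "\<omega> \<in> Linf L" using \<omega>m by (auto simp: Linf_def intro!: exI[of _ B] AE_I2)
  moreover have "\<omega> \<in> H1 L" using H1_iff_prim[OF L] \<omega>m rl \<omega>eq by blast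
  moreover have "AE x in Om L. 1 / \<tau> * (?w x - v x) - Dx L \<omega> x - \<nu>\<^sup>2 * Dx L (Dx L ?w) x + \<xi> x + g (?w x) = u x"
    using Dx_AE_eq(1)[OF L \<omega>m rl \<omega>eq] DD(1) eq by eventually_elim simp
  moreover have "AE x in Om L. \<omega> x \<in> subdiff (\<lambda>r. ereal (f \<epsilon> r)) (Dx L ?w x)"
    using pD
  proof eventually_elim
    case (elim x)
    show ?case
      using subgrad_\<beta>[of "prim L r x"] unfolding elim[symmetric] \<omega>_def
      by (simp add: subdiff_def subgrad_def inner_real_def)
  qed
  ultimately show "\<exists>\<omega>. \<omega> \<in> H1 L \<inter> Linf L \<and>
       (AE x in Om L. 1 / \<tau> * (path d r x - v x) - Dx L \<omega> x - \<nu>\<^sup>2 * Dx L (Dx L (path d r)) x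
          + \<xi> x + g (path d r x) = u x) \<and>
       (AE x in Om L. \<omega> x \<in> subdiff (\<lambda>r. ereal (f \<epsilon> r)) (Dx L (path d r) x))" by blast
qed

end

section \<open>The time-discrete system\<close>

text \<open>For \<open>\<epsilon> > 0\<close> the mean value theorem turns the linear bound on the derivative into the growth condition.\<close>

lemma f_assumption_diffusion:
  assumes f: "f_assumption f" and \<epsilon>: "\<epsilon> \<in> {0..1}" and \<nu>: "0 < \<nu>"
  obtains C\<^sub>f where "diffusion (f \<epsilon>) \<nu> C\<^sub>f"
proof (cases "\<epsilon> = 0")
  case True
  have "diffusion (f \<epsilon>) \<nu> 1"
  proof
    have f0: "f \<epsilon> = (\<lambda>r. \<bar>r\<bar>)" using f True by (simp add: f_assumption_def)
    show "0 < \<nu>" by (rule \<nu>)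
    show "convex_on UNIV (f \<epsilon>)"
      using convex_on_dist[OF convex_UNIV, of "0::real"] by (simp add: f0 dist_real_def)
    show "f \<epsilon> 0 = 0" "0 \<le> f \<epsilon> r" for r by (simp_all add: f0)
    fix a b :: real
    have "\<bar>\<bar>a\<bar> - \<bar>b\<bar>\<bar> \<le> 1 * \<bar>a - b\<bar>" by simp
    also have "\<dots> \<le> (1 * (1 + \<bar>a\<bar> + \<bar>b\<bar>)) * \<bar>a - b\<bar>" by (rule mult_right_mono) auto
    finally show "\<bar>f \<epsilon> a - f \<epsilon> b\<bar> \<le> 1 * (1 + \<bar>a\<bar> + \<bar>b\<bar>) * \<bar>a - b\<bar>" by (simp add: f0)
  qed
  then show ?thesis by (rule that)
next
  case False
  with \<epsilon> have \<epsilon>': "\<epsilon> \<in> {0<..1}" by auto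
  then have Ck: "Ck 2 (f \<epsilon>)" and cv: "convex_on UNIV (f \<epsilon>)" "f \<epsilon> 0 = 0" "\<And>r. 0 \<le> f \<epsilon> r"
    using f by (auto simp: f_assumption_def)
  obtain C0 where C0: "0 < C0" "\<And>r. \<bar>deriv (f \<epsilon>) r\<bar> \<le> C0 * (1 + \<bar>r\<bar>)"
    using f \<epsilon>' unfolding f_assumption_def by blast
  have "\<forall>j<2. \<forall>x. (deriv ^^ j) (f \<epsilon>) differentiable at x" using Ck by (simp add: Ck_def)
  from this[rule_format, of 0] have "f \<epsilon> differentiable at x" for x by simp
  then have d: "(f \<epsilon> has_real_derivative deriv (f \<epsilon>) x) (at x)" for x
    by (simp add: DERIV_deriv_iff_real_differentiable)
  have lip: "\<bar>f \<epsilon> b - f \<epsilon> a\<bar> \<le> C0 * (1 + \<bar>a\<bar> + \<bar>b\<bar>) * \<bar>b - a\<bar>" if "a < b" for a b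
  proof -
    from MVT2[OF that d] obtain z where z: "a < z" "z < b" "f \<epsilon> b - f \<epsilon> a = (b - a) * deriv (f \<epsilon>) z"
      by blast
    have "\<bar>deriv (f \<epsilon>) z\<bar> \<le> C0 * (1 + \<bar>a\<bar> + \<bar>b\<bar>)"
      using C0(1) z by (intro order_trans[OF C0(2)] mult_left_mono) auto
    then have "\<bar>deriv (f \<epsilon>) z\<bar> * \<bar>b - a\<bar> \<le> C0 * (1 + \<bar>a\<bar> + \<bar>b\<bar>) * \<bar>b - a\<bar>"
      by (rule mult_right_mono) simp
    then show ?thesis unfolding z(3) by (simp add: abs_mult mult.commute)
  qed
  have "diffusion (f \<epsilon>) \<nu> C0"
  proof
    fix a b :: real
    show "\<bar>f \<epsilon> a - f \<epsilon> b\<bar> \<le> C0 * (1 + \<bar>a\<bar> + \<bar>b\<bar>) * \<bar>a - b\<bar>"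
      using lip[of a b] lip[of b a]
      by (cases a b rule: linorder_cases) (auto simp: abs_minus_commute add.assoc add.commute[of "\<bar>a\<bar>"])
  qed (use \<nu> cv in auto)
  then show ?thesis by (rule that)
qed

lemma allen_cahn_step_intro:
  assumes "0 < L" "0 < \<nu>" "f_assumption f" "g_assumption g G C\<^sub>g" "K_assumption Kh K"
    and "0 < \<tau>" "\<tau> < 1 / (8 * (C\<^sub>g + 1))" "\<epsilon> \<in> {0..1}" "\<delta> \<in> {0..1}"
  obtains C\<^sub>f where "allen_cahn_step f \<epsilon> \<nu> C\<^sub>f L \<tau> C\<^sub>g \<delta> g G Kh K"
proof -
  obtain C\<^sub>f where "diffusion (f \<epsilon>) \<nu> C\<^sub>f"
    by (rule f_assumption_diffusion[OF assms(3,8,2)])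
  then interpret diffusion "f \<epsilon>" \<nu> C\<^sub>f .
  have g: "Ck 1 g" "0 < C\<^sub>g" "mono (\<lambda>r. g r + C\<^sub>g * r)" "\<And>r. 0 \<le> G r"
    "\<And>r. (G has_real_derivative g r) (at r)"
    using assms(4) by (auto simp: g_assumption_def)
  have diff1: "(k has_real_derivative deriv k x) (at x)" if "Ck 1 k" for k x
  proof -
    have "\<forall>j<1. \<forall>x. (deriv ^^ j) k differentiable at x" using that unfolding Ck_def by blast
    from this[rule_format, of 0] show ?thesis by (simp add: DERIV_deriv_iff_real_differentiable)
  qed
  have cont1: "continuous_on UNIV k" if "Ck 1 k" for k
    by (rule DERIV_continuous_on) (use diff1[OF that] in auto)
  have "allen_cahn_step f \<epsilon> \<nu> C\<^sub>f L \<tau> C\<^sub>g \<delta> g G Kh K"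
  proof
    show "0 < L" "0 < \<tau>" "0 < C\<^sub>g" "mono (\<lambda>r. g r + C\<^sub>g * r)" "0 \<le> G r"
      "(G has_real_derivative g r) (at r)" for r using assms g by auto
    show "continuous_on UNIV g" by (rule cont1[OF g(1)])
    have "8 * (C\<^sub>g + 1) * \<tau> < 1" using assms(7) g(2) by (simp add: field_simps)
    then show "2 * C\<^sub>g * \<tau> \<le> 1"
      using mult_pos_pos[OF g(2) assms(6)] assms(6) by (simp add: algebra_simps)
    assume "\<delta> \<noteq> 0"
    with assms(9) have \<delta>: "\<delta> \<in> {0<..1}" by auto
    then have K: "Ck 1 (K \<delta>)" "\<And>r. (Kh \<delta> has_real_derivative K \<delta> r) (at r)"
      "\<And>r. r \<in> {-1..1} \<Longrightarrow> Kh \<delta> r = 0" "\<And>r. 0 \<le> deriv (K \<delta>) r"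
      using assms(5) unfolding K_assumption_def by blast+
    show "continuous_on UNIV (K \<delta>)" by (rule cont1[OF K(1)])
    show mK: "mono (K \<delta>)"
    proof (rule monoI)
      fix x y :: real assume "x \<le> y"
      then show "K \<delta> x \<le> K \<delta> y"
        by (rule DERIV_nonneg_imp_nondecreasing) (use diff1[OF K(1)] K(4) in blast)
    qed
    show "(Kh \<delta> has_real_derivative K \<delta> r) (at r)" for r by (rule K(2))
    \<comment> \<open>A convex function vanishing on an interval around the origin has its minimum there.\<close>
    have cv: "convex_on UNIV (Kh \<delta>)"
      by (rule convex_on_realI[of UNIV "Kh \<delta>" "K \<delta>"]) (use K(2) mK in \<open>auto simp: mono_def\<close>)
    have K0: "K \<delta> 0 = 0"
    proof -
      have "((\<lambda>r. 0) has_real_derivative 0) (at (0::real))" by simp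
      then have "(Kh \<delta> has_real_derivative 0) (at 0)"
        by (rule has_field_derivative_transform_within_open[where S = "{-1<..<1}"]) (use K(3) in auto)
      then show ?thesis using K(2) DERIV_unique by blast
    qed
    show "0 \<le> Kh \<delta> r" for r
    proof -
      have "Kh \<delta> r - Kh \<delta> 0 \<ge> K \<delta> 0 * (r - 0)"
        by (rule convex_on_imp_above_tangent[of UNIV]) (use cv K(2) in auto)
      then show ?thesis using K0 K(3)[of 0] by simp
    qed
  qed
  then show ?thesis by (rule that)
qed

theorem theorem1:
  fixes L T \<nu> M\<^sub>u C\<^sub>g \<tau> \<epsilon> \<delta> :: real
    and n :: nat
    and f Kh K :: "real \<Rightarrow> real \<Rightarrow> real"
    and g G :: "real \<Rightarrow> real"
    and u :: "nat \<Rightarrow> real \<Rightarrow> real"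
    and w0 :: "real \<Rightarrow> real"
  assumes "0 < L" "0 < T" "1 \<le> n" "0 < \<nu>" "0 \<le> M\<^sub>u"
    and "f_assumption f" "g_assumption g G C\<^sub>g" "K_assumption Kh K"
    and "\<tau> = T / real n" "0 < \<tau>" "\<tau> < 1 / (8 * (C\<^sub>g + 1))"
    and "\<epsilon> \<in> {0..1}" "\<delta> \<in> {0..1}"
    and "\<forall>i\<in>{1..n}. u i \<in> L2 L"
    and "w0 \<in> H1 L" "(\<lambda>x. Khat Kh \<delta> (w0 x)) \<in> L1_ext L"
  shows "\<exists>w.
    AC_solution L \<nu> f Kh g M\<^sub>u n \<tau> \<epsilon> \<delta> u w0 w \<and>
    (\<forall>i\<in>{1..n}. w i \<in> H1 L) \<and>
    (\<forall>w'. AC_solution L \<nu> f Kh g M\<^sub>u n \<tau> \<epsilon> \<delta> u w0 w' \<longrightarrow>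
       (\<forall>i\<in>{1..n}. AE x in Om L. w' i x = w i x)) \<and>
    (\<forall>i\<in>{1..n}. w i \<in> H2 L \<and>
       has_value_at L (Dx L (w i)) (-L) 0 \<and> has_value_at L (Dx L (w i)) L 0) \<and>
    (\<exists>\<omega> \<xi>. \<forall>i\<in>{1..n}.
       \<omega> i \<in> H1 L \<inter> Linf L \<and> \<xi> i \<in> L2 L \<and>
       (AE x in Om L. 1 / \<tau> * (w i x - w (i - 1) x) - Dx L (\<omega> i) x
          - \<nu>\<^sup>2 * Dx L (Dx L (w i)) x + \<xi> i x + g (w i x) = M\<^sub>u * u i x) \<and>
       (AE x in Om L. \<omega> i x \<in> subdiff (\<lambda>r. ereal (f \<epsilon> r)) (Dx L (w i) x)) \<and>
       (AE x in Om L. \<xi> i x \<in> Kset K \<delta> (w i x))) \<and>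
    (\<forall>i\<in>{1..n}.
       ereal (1 / (2 * \<tau>) * (L2_norm L (\<lambda>x. w i x - w (i - 1) x))\<^sup>2)
         + Energy L \<nu> f Kh G \<epsilon> \<delta> (w i) - Energy L \<nu> f Kh G \<epsilon> \<delta> (w (i - 1))
       \<le> ereal (\<tau> * M\<^sub>u\<^sup>2 * (L2_norm L (u i))\<^sup>2))"
proof -
  have L: "0 < L" by fact
  obtain C\<^sub>f where "allen_cahn_step f \<epsilon> \<nu> C\<^sub>f L \<tau> C\<^sub>g \<delta> g G Kh K"
    by (rule allen_cahn_step_intro[OF assms(1,4,6-8,10-13)])
  then interpret allen_cahn_step f \<epsilon> \<nu> C\<^sub>f L \<tau> C\<^sub>g \<delta> g G Kh K .
  define U where "U i x = M\<^sub>u * u i x" for i x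
  have U: "U i \<in> L2 L" if "i \<in> {1..n}" for i
    unfolding U_def using assms(14) that by (intro L2_cmult) blast
  define step where "step v i = (SOME s. strong_step v (U i) (fst s) (fst (snd s)) (snd (snd s)))" for v i
  have step: "strong_step v (U i) (fst (step v i)) (fst (snd (step v i))) (snd (snd (step v i)))"
    if v: "v \<in> L2 L" and i: "i \<in> {1..n}" for v i
  proof -
    obtain d r \<xi> where "strong_step v (U i) d r \<xi>" using strong_step_exists[OF v U[OF i]] by blast
    then show ?thesis
      unfolding step_def
      by (intro someI[where P = "\<lambda>s. strong_step v (U i) (fst s) (fst (snd s)) (snd (snd s))" and x = "(d, r, \<xi>)"]) simp
  qed
  define w where "w = rec_nat w0 (\<lambda>i v. path (fst (step v (Suc i))) (fst (snd (step v (Suc i)))))"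
  have w_0: "w 0 = w0" by (simp add: w_def)
  define d r \<xi> where "d i = fst (step (w (i - 1)) i)" and "r i = fst (snd (step (w (i - 1)) i))"
    and "\<xi> i = snd (snd (step (w (i - 1)) i))" for i
  have w_step: "w i = path (d i) (r i)" if "i \<in> {1..n}" for i
    using that by (cases i) (auto simp: w_def d_def r_def)
  have w0L: "w0 \<in> L2 L" using assms(15) by (simp add: H1_def)
  have wL: "w i \<in> L2 L" if "i \<le> n" for i
    using that
  proof (induction i)
    case 0
    then show ?case using w0L by (simp add: w_0)
  next
    case (Suc i)
    have "strong_step (w i) (U (Suc i)) (d (Suc i)) (r (Suc i)) (\<xi> (Suc i))"
      using step[OF Suc.IH, of "Suc i"] Suc.prems by (simp add: d_def r_def \<xi>_def)
    from DPsi_L2[OF strong_step_DPsi(1)[OF this]] show ?case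
      using w_step[of "Suc i"] Suc.prems by simp
  qed
  have wL': "w (i - 1) \<in> L2 L" if "i \<in> {1..n}" for i by (rule wL) (use that in auto)
  have strong: "strong_step (w (i - 1)) (U i) (d i) (r i) (\<xi> i)" if "i \<in> {1..n}" for i
    unfolding d_def r_def \<xi>_def by (rule step[OF wL'[OF that] that])
  have vi: "VI (w (i - 1)) (U i) (w i)" if "i \<in> {1..n}" for i
    unfolding w_step[OF that] by (rule strong_step_VI[OF strong[OF that] wL'[OF that] U[OF that]])
  have AC_iff: "AC_solution L \<nu> f Kh g M\<^sub>u n \<tau> \<epsilon> \<delta> u w0 y \<longleftrightarrow>
      y 0 = w0 \<and> (\<forall>i\<in>{1..n}. VI (y (i - 1)) (U i) (y i))" for y
    by (simp add: AC_solution_def VI_def U_def)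
  have AC: "AC_solution L \<nu> f Kh g M\<^sub>u n \<tau> \<epsilon> \<delta> u w0 w"
    unfolding AC_iff using w_0 vi by blast
  have unique: "AE x in Om L. w' i x = w i x"
    if w': "AC_solution L \<nu> f Kh g M\<^sub>u n \<tau> \<epsilon> \<delta> u w0 w'" and i: "i \<le> n" for w' i
    using i
  proof (induction i)
    case 0
    then show ?case using w' by (simp add: AC_iff w_0)
  next
    case (Suc i)
    have i: "Suc i \<in> {1..n}" using Suc.prems by simp
    have vi': "VI (w' (j - 1)) (U j) (w' j)" if "j \<in> {1..n}" for j using w' that by (simp add: AC_iff)
    have w'L: "w' i \<in> L2 L"
    proof (cases "i = 0")
      case True
      then show ?thesis using w' w0L by (simp add: AC_iff)
    next
      case False
      then have "i \<in> {1..n}" using Suc.prems by simp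
      from vi'[OF this] show ?thesis by (simp add: VI_def DPsi_L2)
    qed
    have IH: "AE x in Om L. w' i x = w i x" using Suc by simp
    show ?case
    proof (rule VI_unique)
      show "VI (w' i) (U (Suc i)) (w' (Suc i))" "VI (w i) (U (Suc i)) (w (Suc i))"
        using vi'[OF i] vi[OF i] by simp_all
    qed (use w'L IH U[OF i] wL[of i] Suc.prems in auto)
  qed
  have norm_U: "\<tau> * (L2_norm L (U i))\<^sup>2 = \<tau> * M\<^sub>u\<^sup>2 * (L2_norm L (u i))\<^sup>2" for i
  proof -
    have "(L2_norm L a)\<^sup>2 = sqn L a" for a
      by (simp add: L2_norm_def L2_inner_def power2_eq_square Bochner_Integration.integral_nonneg)
    then show ?thesis unfolding U_def by (simp add: sqn_cmult)
  qed
  have energy: "ereal (1 / (2 * \<tau>) * (L2_norm L (\<lambda>x. w i x - w (i - 1) x))\<^sup>2)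
         + Energy L \<nu> f Kh G \<epsilon> \<delta> (w i) - Energy L \<nu> f Kh G \<epsilon> \<delta> (w (i - 1))
       \<le> ereal (\<tau> * M\<^sub>u\<^sup>2 * (L2_norm L (u i))\<^sup>2)" if "i \<in> {1..n}" for i
    using VI_energy[OF vi[OF that] wL'[OF that] U[OF that]] unfolding norm_U .
  have regular: "w i \<in> H1 L" "w i \<in> H2 L"
    "has_value_at L (Dx L (w i)) (-L) 0" "has_value_at L (Dx L (w i)) L 0"
    "\<exists>\<omega>. \<omega> \<in> H1 L \<inter> Linf L \<and>
       (AE x in Om L. 1 / \<tau> * (w i x - w (i - 1) x) - Dx L \<omega> x - \<nu>\<^sup>2 * Dx L (Dx L (w i)) x
          + \<xi> i x + g (w i x) = U i x) \<and>
       (AE x in Om L. \<omega> x \<in> subdiff (\<lambda>r. ereal (f \<epsilon> r)) (Dx L (w i) x))"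
    if "i \<in> {1..n}" for i
    using strong_step_regular[OF strong[OF that]] unfolding w_step[OF that, symmetric] .
  have "\<exists>\<omega>. \<forall>i\<in>{1..n}. \<omega> i \<in> H1 L \<inter> Linf L \<and>
       (AE x in Om L. 1 / \<tau> * (w i x - w (i - 1) x) - Dx L (\<omega> i) x
          - \<nu>\<^sup>2 * Dx L (Dx L (w i)) x + \<xi> i x + g (w i x) = M\<^sub>u * u i x) \<and>
       (AE x in Om L. \<omega> i x \<in> subdiff (\<lambda>r. ereal (f \<epsilon> r)) (Dx L (w i) x))"
    by (rule bchoice) (use regular(5) in \<open>simp add: U_def\<close>)
  then obtain \<omega> where \<omega>: "\<forall>i\<in>{1..n}. \<omega> i \<in> H1 L \<inter> Linf L \<and>
       (AE x in Om L. 1 / \<tau> * (w i x - w (i - 1) x) - Dx L (\<omega> i) x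
          - \<nu>\<^sup>2 * Dx L (Dx L (w i)) x + \<xi> i x + g (w i x) = M\<^sub>u * u i x) \<and>
       (AE x in Om L. \<omega> i x \<in> subdiff (\<lambda>r. ereal (f \<epsilon> r)) (Dx L (w i) x))" by blast
  have \<xi>: "\<xi> i \<in> L2 L \<and> (AE x in Om L. \<xi> i x \<in> Kset K \<delta> (w i x))" if "i \<in> {1..n}" for i
    using strong[OF that] w_step[OF that] by (simp add: strong_step_def)
  show ?thesis
  proof (rule exI[of _ w], intro conjI)
    show "\<exists>\<omega> \<xi>. \<forall>i\<in>{1..n}.
       \<omega> i \<in> H1 L \<inter> Linf L \<and> \<xi> i \<in> L2 L \<and>
       (AE x in Om L. 1 / \<tau> * (w i x - w (i - 1) x) - Dx L (\<omega> i) x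
          - \<nu>\<^sup>2 * Dx L (Dx L (w i)) x + \<xi> i x + g (w i x) = M\<^sub>u * u i x) \<and>
       (AE x in Om L. \<omega> i x \<in> subdiff (\<lambda>r. ereal (f \<epsilon> r)) (Dx L (w i) x)) \<and>
       (AE x in Om L. \<xi> i x \<in> Kset K \<delta> (w i x))"
      using \<omega> \<xi> by (intro exI[of _ \<omega>] exI[of _ \<xi>]) blast
    show "\<forall>w'. AC_solution L \<nu> f Kh g M\<^sub>u n \<tau> \<epsilon> \<delta> u w0 w' \<longrightarrow>
       (\<forall>i\<in>{1..n}. AE x in Om L. w' i x = w i x)"
      using unique by auto
  qed (use AC regular(1-4) energy in blast)+
qed

end
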